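(* Let $J$ be a complex structure on a real nilpotent Lie algebra $\mathfrak g$ of dimension $8$ with $1$-dimensional center. Then there exists a basis $\{\omega^k\}_{k=1}^4$ of $\mathfrak g^{1,0}_J$ in terms of which the complex structure equations of $(\mathfrak g,J)$ are one (and only one) of the following. (i) If $J$ belongs to Family I, then $$\begin{cases} d\omega^1 = 0,\\ d\omega^2 = \varepsilon\,\omega^{1\bar 1},\\ d\omega^3 = \omega^{14}+\omega^{1\bar 4}+a\,\omega^{2\bar 1}+ i\,\delta\,\varepsilon\,b\,\omega^{1\bar 2},\\ d\omega^4 = i\,\nu\,\omega^{1\bar 1} +b\,\omega^{2\bar 2}+ i\,\delta\,(\omega^{1\bar 3}-\omega^{3\bar 1}),\end{cases}$$ where $\delta=\pm 1$, $(a,b)\in \mathbb R^2\setminus\{(0,0)\}$ with $a\geq 0$, and the tuple $(\varepsilon, \nu, a, b)$ takes the following values: $(0,0,0,1)$, $(0,0,1,0)$, $(0,0,1,1)$, $(0,1,0,b/|b|)$, $(0,1,1,b)$, $(1,0,0,1)$, $(1,0,1,|b|)$ or $(1,1,a,b)$. Moreover, the ascending type of $\mathfrak g$ is $(1,3,8)$, $(1,3,6,8)$, $(1,4,8)$, $(1,4,6,8)$, $(1,5,8)$ or $(1,5,6,8)$, and the relation between the parameters and the ascending type is as follows (with $\delta=\pm1$ arbitrary in each case): - $(1,3,8)$: $(\varepsilon,\nu,a,b)=(0,0,1,0)$ or $(0,0,1,1)$; - $(1,3,6,8)$: $(\varepsilon,\nu,a,b)=(1,0,1,b)$ with $b\ge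 0$; or $(0,1,1,b)$ with $b\in\mathbb R$; or $(1,1,a,b)$ with $a>0$, $b\in\mathbb R$; - $(1,4,8)$: $(\varepsilon,\nu,a,b)=(1,1,0,2\delta)$; - $(1,4,6,8)$: $(\varepsilon,\nu,a,b)=(1,0,0,1)$; or $(1,1,0,b)$ with $b\in\mathbb R\setminus\{0,2\delta\}$; - $(1,5,8)$: $(\varepsilon,\nu,a,b)=(0,0,0,1)$; - $(1,5,6,8)$: $(\varepsilon,\nu,a,b)=(0,1,0,-1)$ or $(0,1,0,1)$. (ii) If $J$ belongs to Family II, then $$\begin{cases} d\omega^1=0,\\ d\omega^2=\omega^{14}+\omega^{1\bar 4},\\ d\omega^3=a\,\omega^{1\bar 1}+\varepsilon\,(\omega^{12}+\omega^{1\bar 2}-\omega^{2\bar 1})+i\,\mu\,(\omega^{24}+\omega^{2\bar 4}),\\ d\omega^4=i\,\nu\,\omega^{1\bar 1}-\mu\,\omega^{2\bar 2}+i\,b\,(\omega^{1\bar 2}-\omega^{2\bar 1})+i\,(\omega^{1\bar 3}-\omega^{3\bar 1}),\end{cases}$$ where $a,b\in\mathbb R$, and the tuple $(\varepsilon, \mu, \nu, a, b)$ takes the following values: $(1,1,0,a,b)$, $(1,0,1,a,b)$, $(1,0,0,0,b)$, $(1,0,0,1,b)$, $(0,1,0,0,0)$ or $(0,1,0,1,0)$. Moreover, the ascending type of $\mathfrak g$ is $(1,3,5,8)$ or $(1,3,5,6,8)$, and the relation between the parameters and the ascending type is as follows: - $(1,3,5,8)$: $(\varepsilon,\mu,\nu,a,b)=(0,1,0,a,0)$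 with $a\in\{0,1\}$; or $(1,0,0,a,b)$ with $a\in\{0,1\}$, $b\in\mathbb R$; or $(1,1,0,a,b)$ with $a,b\in\mathbb R$; - $(1,3,5,6,8)$: $(\varepsilon,\mu,\nu,a,b)=(1,0,1,a,b)$ with $a,b\in\mathbb R$.
   Context: A complex structure on a real Lie algebra $\mathfrak g$ is an endomorphism $J$ with $J^2=-\mathrm{Id}$ and $[X,Y]+J[JX,Y]+J[X,JY]-[JX,JY]=0$ for all $X,Y$. Let $\mathfrak g_{\mathbb C}^*$ be the dual of the complexification, on which $J$ acts by $(J\alpha)(X)=\alpha(JX)$; $\mathfrak g^{1,0}_J$ and $\mathfrak g^{0,1}_J$ are the eigenspaces for $i$ and $-i$, and $\mathfrak g^{p,q}_J$ is the induced bigraduation of $\bigwedge^*\mathfrak g_{\mathbb C}^*$. The differential $d$ is the complexified Chevalley–Eilenberg differential, $d\alpha(X,Y)=-\alpha([X,Y])$; it splits as $d=\partial+\bar\partial$, with $\bar\partial:\mathfrak g^{p,q}_J\to\mathfrak g^{p,q+1}_J$. The Lie-algebra Dolbeault cohomology in bidegree $(0,1)$ is $H^{0,1}_{\bar\partial}(\mathfrak g,J)=\ker\{\bar\partial:\mathfrak g^{0,1}_J\to\mathfrak g^{0,2}_J\}$. For a basis $\{\omega^k\}$ of $\mathfrak g^{1,0}_J$, $\omega^{\bar k}$ is the complex conjugate of $\omega^k$, $\omega^{jk}=\omega^j\wedge\omega^k$, $\omega^{j\bar k}=\omega^j\wedge\omega^{\bar k}$. The complex structure equations of $(\mathfrak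 g,J)$ are the expressions of $d\omega^k$ in this basis. On an 8-dimensional nilpotent Lie algebra with $1$-dimensional center, every complex structure $J$ satisfies $\dim H^{0,1}_{\bar\partial}(\mathfrak g,J)\in\{2,3\}$; $J$ belongs to Family I if this dimension is $3$, and to Family II if it is $2$. The ascending central series is $\mathfrak g_0=\{0\}$, $\mathfrak g_k=\{X\in\mathfrak g\mid [X,\mathfrak g]\subseteq\mathfrak g_{k-1}\}$; if $s$ is the smallest integer with $\mathfrak g_s=\mathfrak g$, the ascending type of $\mathfrak g$ is $(\dim\mathfrak g_1,\dots,\dim\mathfrak g_s)$. Two pairs $(\mathfrak g,J)$, $(\mathfrak g',J')$ are equivalent if there is a Lie algebra isomorphism $f:\mathfrak g\to\mathfrak g'$ with $J=f^{-1}\circ J'\circ f$, equivalently a $\mathbb C$-linear isomorphism $F:\mathfrak g'^{1,0}_{J'}\to\mathfrak g^{1,0}_J$ commuting with the differentials. "One and only one" expresses that the theorem classifies complex structures up to equivalence: different listed parameter values (including $\delta$ in Family I) give non-equivalent complex structures. In the value lists, $a,b$ denote arbitrary real numbers subject to the stated restrictions (so $b\ne0$ in $(0,1,0,b/|b|)$, and $a\ge0$, $(a,b)\neq(0,0)$ in $(1,1,a,b)$ of Family I). *)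

theory Defs
  imports "HOL-Analysis.Analysis" "HOL-Library.Function_Algebras"
begin

definition lie_bracket :: "('g::real_vector \<Rightarrow> 'g \<Rightarrow> 'g) \<Rightarrow> bool" where
  "lie_bracket br \<longleftrightarrow>
     bilinear br \<and> (\<forall>X. br X X = 0) \<and>
     (\<forall>X Y Z. br X (br Y Z) + br Y (br Z X) + br Z (br X Y) = 0)"

primrec ascending_series :: "('g::real_vector \<Rightarrow> 'g \<Rightarrow> 'g) \<Rightarrow> nat \<Rightarrow> 'g set" where
  "ascending_series br 0 = {0}"
| "ascending_series br (Suc k) = {X. \<forall>Y. br X Y \<in> ascending_series br k}"

definition nilpotent_lie :: "('g::real_vector \<Rightarrow> 'g \<Rightarrow> 'g) \<Rightarrow> bool" where
  "nilpotent_lie br \<longleftrightarrow> (\<exists>s. ascending_series br s = UNIV)"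

definition lie_center :: "('g::real_vector \<Rightarrow> 'g \<Rightarrow> 'g) \<Rightarrow> 'g set" where
  "lie_center br = {X. \<forall>Y. br X Y = 0}"

definition ascending_type :: "('g::real_vector \<Rightarrow> 'g \<Rightarrow> 'g) \<Rightarrow> nat list" where
  "ascending_type br =
     map (\<lambda>k. dim (ascending_series br k)) [1..<Suc (LEAST s. ascending_series br s = UNIV)]"

definition complex_structure :: "('g::real_vector \<Rightarrow> 'g \<Rightarrow> 'g) \<Rightarrow> ('g \<Rightarrow> 'g) \<Rightarrow> bool" where
  "complex_structure br J \<longleftrightarrow>
     linear J \<and> (\<forall>X. J (J X) = - X) \<and>
     (\<forall>X Y. br X Y + J (br (J X) Y) + J (br X (J Y)) - br (J X) (J Y) = 0)"

definition equivalent_pairs ::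
  "('g::real_vector \<Rightarrow> 'g \<Rightarrow> 'g) \<Rightarrow> ('g \<Rightarrow> 'g) \<Rightarrow>
   ('h::real_vector \<Rightarrow> 'h \<Rightarrow> 'h) \<Rightarrow> ('h \<Rightarrow> 'h) \<Rightarrow> bool" where
  "equivalent_pairs br J br' J' \<longleftrightarrow>
     (\<exists>f. linear f \<and> bij f \<and> (\<forall>X Y. f (br X Y) = br' (f X) (f Y)) \<and> J = inv f \<circ> J' \<circ> f)"

text \<open>
  A complex-linear form on the complexification of a real Lie algebra is determined by its
  restriction to the real Lie algebra, which is an arbitrary real-linear complex-valued
  function. The dual of the complexification is accordingly represented by the real-linear maps
  from \<open>'g\<close> to the complex numbers, and complex 2-forms by functions on \<open>'g \<times> 'g\<close>. Complex
  conjugation of forms is then pointwise conjugation. Addition and zero of forms are the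
  pointwise operations on functions; \<open>cscale\<close> is the complex scalar multiplication.
\<close>

definition cscale :: "complex \<Rightarrow> ('x \<Rightarrow> complex) \<Rightarrow> 'x \<Rightarrow> complex" (infixr "*\<^sub>f" 75) where
  "c *\<^sub>f \<alpha> = (\<lambda>x. c * \<alpha> x)"

global_interpretation cform: vector_space "cscale :: complex \<Rightarrow> ('x \<Rightarrow> complex) \<Rightarrow> 'x \<Rightarrow> complex"
  by unfold_locales (simp_all add: cscale_def fun_eq_iff algebra_simps)

definition cnj_form :: "('x \<Rightarrow> complex) \<Rightarrow> 'x \<Rightarrow> complex" where
  "cnj_form \<alpha> = (\<lambda>X. cnj (\<alpha> X))"

definition wedge :: "('g \<Rightarrow> complex) \<Rightarrow> ('g \<Rightarrow> complex) \<Rightarrow> 'g \<times> 'g \<Rightarrow> complex" where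
  "wedge \<alpha> \<beta> = (\<lambda>(X, Y). \<alpha> X * \<beta> Y - \<alpha> Y * \<beta> X)"

definition ce_d :: "('g \<Rightarrow> 'g \<Rightarrow> 'g) \<Rightarrow> ('g \<Rightarrow> complex) \<Rightarrow> 'g \<times> 'g \<Rightarrow> complex" where
  "ce_d br \<alpha> = (\<lambda>(X, Y). - \<alpha> (br X Y))"

definition forms10 :: "('g::real_vector \<Rightarrow> 'g) \<Rightarrow> ('g \<Rightarrow> complex) set" where
  "forms10 J = {\<alpha>. linear \<alpha> \<and> (\<forall>X. \<alpha> (J X) = \<i> * \<alpha> X)}"

definition forms01 :: "('g::real_vector \<Rightarrow> 'g) \<Rightarrow> ('g \<Rightarrow> complex) set" where
  "forms01 J = {\<alpha>. linear \<alpha> \<and> (\<forall>X. \<alpha> (J X) = - \<i> * \<alpha> X)}"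

definition forms20 :: "('g::real_vector \<Rightarrow> 'g) \<Rightarrow> ('g \<times> 'g \<Rightarrow> complex) set" where
  "forms20 J = cform.span {wedge \<alpha> \<beta> | \<alpha> \<beta>. \<alpha> \<in> forms10 J \<and> \<beta> \<in> forms10 J}"

definition forms11 :: "('g::real_vector \<Rightarrow> 'g) \<Rightarrow> ('g \<times> 'g \<Rightarrow> complex) set" where
  "forms11 J = cform.span {wedge \<alpha> \<beta> | \<alpha> \<beta>. \<alpha> \<in> forms10 J \<and> \<beta> \<in> forms01 J}"

definition forms02 :: "('g::real_vector \<Rightarrow> 'g) \<Rightarrow> ('g \<times> 'g \<Rightarrow> complex) set" where
  "forms02 J = cform.span {wedge \<alpha> \<beta> | \<alpha> \<beta>. \<alpha> \<in> forms01 J \<and> \<beta> \<in> forms01 J}"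

text \<open>\<open>dbar01\<close> is \<open>\<partial>\<close>-bar on (0,1)-forms: the (0,2)-component of the differential.\<close>

definition dbar01 ::
  "('g::real_vector \<Rightarrow> 'g \<Rightarrow> 'g) \<Rightarrow> ('g \<Rightarrow> 'g) \<Rightarrow> ('g \<Rightarrow> complex) \<Rightarrow> 'g \<times> 'g \<Rightarrow> complex" where
  "dbar01 br J \<alpha> =
     (THE \<gamma>. \<gamma> \<in> forms02 J \<and> (\<exists>\<eta>\<in>forms20 J. \<exists>\<zeta>\<in>forms11 J. ce_d br \<alpha> = \<eta> + \<zeta> + \<gamma>))"

definition dolbeault01 :: "('g::real_vector \<Rightarrow> 'g \<Rightarrow> 'g) \<Rightarrow> ('g \<Rightarrow> 'g) \<Rightarrow> ('g \<Rightarrow> complex) set" where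
  "dolbeault01 br J = {\<alpha> \<in> forms01 J. dbar01 br J \<alpha> = 0}"

definition family_I :: "('g::real_vector \<Rightarrow> 'g \<Rightarrow> 'g) \<Rightarrow> ('g \<Rightarrow> 'g) \<Rightarrow> bool" where
  "family_I br J \<longleftrightarrow> cform.dim (dolbeault01 br J) = 3"

definition family_II :: "('g::real_vector \<Rightarrow> 'g \<Rightarrow> 'g) \<Rightarrow> ('g \<Rightarrow> 'g) \<Rightarrow> bool" where
  "family_II br J \<longleftrightarrow> cform.dim (dolbeault01 br J) = 2"

definition basis10 :: "('g::real_vector \<Rightarrow> 'g) \<Rightarrow> (nat \<Rightarrow> 'g \<Rightarrow> complex) \<Rightarrow> bool" where
  "basis10 J \<omega> \<longleftrightarrow>
     inj_on \<omega> {1..4} \<and> cform.independent (\<omega> ` {1..4}) \<and> cform.span (\<omega> ` {1..4}) = forms10 J"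

text \<open>
  \<open>Eqs_I \<delta> \<epsilon> \<nu> a b\<close> and \<open>Eqs_II \<epsilon> \<mu> \<nu> a b\<close> are names for the structure equations with these
  coefficients; \<open>has_equations\<close> gives the equations themselves. There
  \<open>w j k\<close> is the wedge product of the j-th and the k-th basis form, and \<open>wb j k\<close> the wedge
  product of the j-th basis form and the conjugate of the k-th one.
\<close>

datatype equations =
    Eqs_I real real real real real
  | Eqs_II real real real real real

primrec has_equations ::
  "('g::real_vector \<Rightarrow> 'g \<Rightarrow> 'g) \<Rightarrow> (nat \<Rightarrow> 'g \<Rightarrow> complex) \<Rightarrow> equations \<Rightarrow> bool" where
  "has_equations br \<omega> (Eqs_I \<delta> \<epsilon> \<nu> a b) \<longleftrightarrow>
     (let w = (\<lambda>j k. wedge (\<omega> j) (\<omega> k));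
          wb = (\<lambda>j k. wedge (\<omega> j) (cnj_form (\<omega> k)))
      in ce_d br (\<omega> 1) = 0 \<and>
         ce_d br (\<omega> 2) = of_real \<epsilon> *\<^sub>f wb 1 1 \<and>
         ce_d br (\<omega> 3) = w 1 4 + wb 1 4 + of_real a *\<^sub>f wb 2 1
                            + (\<i> * of_real (\<delta> * \<epsilon> * b)) *\<^sub>f wb 1 2 \<and>
         ce_d br (\<omega> 4) = (\<i> * of_real \<nu>) *\<^sub>f wb 1 1 + of_real b *\<^sub>f wb 2 2
                            + (\<i> * of_real \<delta>) *\<^sub>f (wb 1 3 - wb 3 1))"
| "has_equations br \<omega> (Eqs_II \<epsilon> \<mu> \<nu> a b) \<longleftrightarrow>
     (let w = (\<lambda>j k. wedge (\<omega> j) (\<omega> k));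
          wb = (\<lambda>j k. wedge (\<omega> j) (cnj_form (\<omega> k)))
      in ce_d br (\<omega> 1) = 0 \<and>
         ce_d br (\<omega> 2) = w 1 4 + wb 1 4 \<and>
         ce_d br (\<omega> 3) = of_real a *\<^sub>f wb 1 1 + of_real \<epsilon> *\<^sub>f (w 1 2 + wb 1 2 - wb 2 1)
                            + (\<i> * of_real \<mu>) *\<^sub>f (w 2 4 + wb 2 4) \<and>
         ce_d br (\<omega> 4) = (\<i> * of_real \<nu>) *\<^sub>f wb 1 1 - of_real \<mu> *\<^sub>f wb 2 2
                            + (\<i> * of_real b) *\<^sub>f (wb 1 2 - wb 2 1)
                            + \<i> *\<^sub>f (wb 1 3 - wb 3 1))"

definition admits_equations ::
  "('g::real_vector \<Rightarrow> 'g \<Rightarrow> 'g) \<Rightarrow> ('g \<Rightarrow> 'g) \<Rightarrow> equations \<Rightarrow> bool" where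
  "admits_equations br J e \<longleftrightarrow> (\<exists>\<omega>. basis10 J \<omega> \<and> has_equations br \<omega> e)"

definition values_I :: "(real \<times> real \<times> real \<times> real) set" where
  "values_I =
     {(0, 0, 0, 1), (0, 0, 1, 0), (0, 0, 1, 1)} \<union>
     {(0, 1, 0, b / \<bar>b\<bar>) | b. b \<noteq> 0} \<union>
     {(0, 1, 1, b) | b. True} \<union>
     {(1, 0, 0, 1)} \<union>
     {(1, 0, 1, \<bar>b\<bar>) | b. True} \<union>
     {(1, 1, a, b) | a b. a \<ge> 0 \<and> (a, b) \<noteq> (0, 0)}"

definition values_II :: "(real \<times> real \<times> real \<times> real \<times> real) set" where
  "values_II =
     {(1, 1, 0, a, b) | a b. True} \<union>
     {(1, 0, 1, a, b) | a b. True} \<union>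
     {(1, 0, 0, 0, b) | b. True} \<union>
     {(1, 0, 0, 1, b) | b. True} \<union>
     {(0, 1, 0, 0, 0), (0, 1, 0, 1, 0)}"

definition listed_equations :: "equations set" where
  "listed_equations =
     {Eqs_I \<delta> \<epsilon> \<nu> a b | \<delta> \<epsilon> \<nu> a b. \<delta> \<in> {1, -1} \<and> (\<epsilon>, \<nu>, a, b) \<in> values_I} \<union>
     {Eqs_II \<epsilon> \<mu> \<nu> a b | \<epsilon> \<mu> \<nu> a b. (\<epsilon>, \<mu>, \<nu>, a, b) \<in> values_II}"

definition type_relation_I ::
  "nat list \<Rightarrow> real \<Rightarrow> real \<times> real \<times> real \<times> real \<Rightarrow> bool" where
  "type_relation_I t \<delta> p \<longleftrightarrow>
     t \<in> {[1,3,8], [1,3,6,8], [1,4,8], [1,4,6,8], [1,5,8], [1,5,6,8]} \<and>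
     (t = [1,3,8] \<longleftrightarrow> p \<in> {(0, 0, 1, 0), (0, 0, 1, 1)}) \<and>
     (t = [1,3,6,8] \<longleftrightarrow>
        p \<in> {(1, 0, 1, b) | b. b \<ge> 0} \<union> {(0, 1, 1, b) | b. True}
           \<union> {(1, 1, a, b) | a b. a > 0}) \<and>
     (t = [1,4,8] \<longleftrightarrow> p = (1, 1, 0, 2 * \<delta>)) \<and>
     (t = [1,4,6,8] \<longleftrightarrow>
        p \<in> {(1, 0, 0, 1)} \<union> {(1, 1, 0, b) | b. b \<notin> {0, 2 * \<delta>}}) \<and>
     (t = [1,5,8] \<longleftrightarrow> p = (0, 0, 0, 1)) \<and>
     (t = [1,5,6,8] \<longleftrightarrow> p \<in> {(0, 1, 0, -1), (0, 1, 0, 1)})"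

definition type_relation_II ::
  "nat list \<Rightarrow> real \<times> real \<times> real \<times> real \<times> real \<Rightarrow> bool" where
  "type_relation_II t p \<longleftrightarrow>
     t \<in> {[1,3,5,8], [1,3,5,6,8]} \<and>
     (t = [1,3,5,8] \<longleftrightarrow>
        p \<in> {(0, 1, 0, a, 0) | a. a \<in> {0, 1}} \<union> {(1, 0, 0, a, b) | a b. a \<in> {0, 1}}
           \<union> {(1, 1, 0, a, b) | a b. True}) \<and>
     (t = [1,3,5,6,8] \<longleftrightarrow> p \<in> {(1, 0, 1, a, b) | a b. True})"

end

theory Submission
  imports Defs
begin

text \<open>
  View the Lie algebra as a complex vector space through \<open>J\<close>. By integrability the bracket is
  \<open>P X Y + R X Y - R Y X\<close> with \<open>P\<close> complex bilinear and \<open>R\<close> antilinear in \<open>X\<close> and linear in \<open>Y\<close>.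
  If \<open>T\<close> spans the center and \<open>E = - J T\<close>, then \<open>N = P E = R E\<close> is a nonzero nilpotent complex
  endomorphism, and \<open>R X E = 0\<close> for all \<open>X\<close>. If \<open>N\<close> has rank 2, a basis adapted to \<open>N\<close> leads to
  Family II; if it has rank 1, the remaining values of \<open>P\<close> lead to either family. In both cases the
  Jacobi identity, the nilpotency of \<open>P X\<close> and \<open>R X\<close>, and the absence of central vectors outside the
  line of \<open>T\<close> leave only the coefficients of the stated equations, up to a change of basis.
  Conversely, \<open>E\<close> is determined up to a real factor, so the transition matrix between two normalized
  bases is nearly triangular, and comparing \<open>P\<close> and \<open>R\<close> in the two bases identifies the parameters.
\<close>

section \<open>The complex bilinear and the sesquilinear part of the bracket\<close>

text \<open>A one-dimensional center never contains a nonzero vector together with its image under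
  \<open>J\<close>. So \<open>J T\<close> is not central and \<open>N\<close> is nonzero; the same
  fact later rules out degenerate coefficients. \<open>N\<close> kills \<open>E\<close>, and its
  image meets the complex line of \<open>E\<close> only in 0 since each \<open>P X\<close> is
  nilpotent. Hence \<open>N\<close> acts nilpotently on a three-dimensional quotient, and its rank
  is at most 2. The obstacle is that the terms of the ascending series need not be stable under
  \<open>J\<close>. Nilpotency reaches \<open>P\<close> through the largest \<open>J\<close>-stable
  subspaces of the terms and \<open>R\<close> through their \<open>J\<close>-stable hulls; the hulls
  also yield a form that annihilates all commutators. One component of the Jacobi identity says that
  \<open>R\<close> represents the Lie algebra with bracket \<open>P\<close> by endomorphisms, so
  \<open>R\<close> on values of \<open>P\<close> is known from \<open>R\<close> on generators and
  few coefficients remain free. The factor of \<open>E\<close> is real because \<open>P\<close> is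
  linear and \<open>R\<close> antilinear in the first argument, while both give \<open>N\<close> at
  \<open>E\<close>. The families differ by the dimension spanned by the values of \<open>P\<close>,
  which is the codimension of the Dolbeault space.\<close>

lemma sum_1_4: "(\<Sum>k=1..4::nat. f k) = f 1 + f 2 + f 3 + (f 4 :: 'a::comm_monoid_add)"
  by (simp add: eval_nat_numeral add.assoc)

locale complex_lie =
  fixes br :: "'g::real_vector \<Rightarrow> 'g \<Rightarrow> 'g" and J :: "'g \<Rightarrow> 'g"
  assumes lie: "lie_bracket br" and cs: "complex_structure br J"
begin

definition scl :: "complex \<Rightarrow> 'g \<Rightarrow> 'g" (infixr "\<odot>" 75)
  where "c \<odot> X = Re c *\<^sub>R X + Im c *\<^sub>R J X"

text \<open>Under the isomorphism \<open>X \<mapsto> X - i J X\<close> with the (1,0)-vectors, \<open>P\<close> is half the bracket of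
  (1,0)-vectors, and \<open>R X Y\<close> is half the (1,0)-part of the bracket of \<open>X + i J X\<close> with \<open>Y - i J Y\<close>.\<close>

definition P :: "'g \<Rightarrow> 'g \<Rightarrow> 'g"
  where "P X Y = (1/2) *\<^sub>R (br X Y - br (J X) (J Y))"

definition R :: "'g \<Rightarrow> 'g \<Rightarrow> 'g"
  where "R X Y = (1/2) *\<^sub>R (br X Y + J (br (J X) Y))"

lemma linear_J: "linear J" and JJ [simp]: "J (J X) = - X"
  and nijenhuis: "br X Y + J (br (J X) Y) + J (br X (J Y)) - br (J X) (J Y) = 0"
  using cs by (auto simp: complex_structure_def)

lemmas J_simps [simp] = linear_add[OF linear_J] linear_scale[OF linear_J] linear_diff[OF linear_J]
  linear_neg[OF linear_J] linear_0[OF linear_J]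

lemma bilinear_br: "bilinear br"
  and br_self [simp]: "br X X = 0"
  and jacobi: "br X (br Y Z) + br Y (br Z X) + br Z (br X Y) = 0"
  using lie by (auto simp: lie_bracket_def)

lemmas br_simps [simp] = bilinear_ladd[OF bilinear_br] bilinear_radd[OF bilinear_br]
  bilinear_lmul[OF bilinear_br] bilinear_rmul[OF bilinear_br] bilinear_lneg[OF bilinear_br]
  bilinear_rneg[OF bilinear_br] bilinear_lzero[OF bilinear_br] bilinear_rzero[OF bilinear_br]
  bilinear_lsub[OF bilinear_br] bilinear_rsub[OF bilinear_br]

lemma br_anti: "br Y X = - br X Y"
proof -
  have "br (X + Y) (X + Y) = 0" by (rule br_self)
  then show ?thesis by (simp add: eq_neg_iff_add_eq_0 del: br_self) (simp add: add.commute)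
qed

lemma br_JJ: "br (J X) (J Y) = br X Y + J (br (J X) Y) + J (br X (J Y))"
  using nijenhuis[of X Y] by (simp add: algebra_simps)

sublocale V: vector_space scl
  by unfold_locales (simp_all add: scl_def algebra_simps)

lemma P_J: "P (J X) Y = J (P X Y)" "P X (J Y) = J (P X Y)"
proof -
  have "J (br (J X) (J Y)) = J (br X Y) - br (J X) Y - br X (J Y)"
    by (simp add: br_JJ)
  then show "P (J X) Y = J (P X Y)" "P X (J Y) = J (P X Y)"
    by (simp_all add: P_def)
qed

lemma R_J: "R (J X) Y = - J (R X Y)" "R X (J Y) = J (R X Y)"
proof -
  show "R (J X) Y = - J (R X Y)" by (simp add: R_def scaleR_right_diff_distrib)
  have "J (br (J X) (J Y)) = J (br X Y) - br (J X) Y - br X (J Y)"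
    by (simp add: br_JJ)
  then show "R X (J Y) = J (R X Y)"
    by (simp add: R_def scaleR_right_diff_distrib)
qed

lemma P_lin: "P (X + X') Y = P X Y + P X' Y" "P X (Y + Y') = P X Y + P X Y'"
  "P (t *\<^sub>R X) Y = t *\<^sub>R P X Y" "P X (t *\<^sub>R Y) = t *\<^sub>R P X Y"
  by (simp_all add: P_def algebra_simps)

lemma R_lin: "R (X + X') Y = R X Y + R X' Y" "R X (Y + Y') = R X Y + R X Y'"
  "R (t *\<^sub>R X) Y = t *\<^sub>R R X Y" "R X (t *\<^sub>R Y) = t *\<^sub>R R X Y"
  by (simp_all add: R_def algebra_simps)

lemma P_scl: "P (c \<odot> X) Y = c \<odot> P X Y" "P X (c \<odot> Y) = c \<odot> P X Y"
  by (simp_all add: scl_def P_lin P_J)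

lemma R_scl: "R (c \<odot> X) Y = cnj c \<odot> R X Y" "R X (c \<odot> Y) = c \<odot> R X Y"
  by (simp_all add: scl_def R_lin R_J)

lemma P_zero: "P 0 Y = 0" "P X 0 = 0" and R_zero: "R 0 Y = 0" "R X 0 = 0"
  by (simp_all add: P_def R_def)

lemma P_neg: "P (-X) Y = - P X Y" "P X (-Y) = - P X Y"
  and R_neg: "R (-X) Y = - R X Y" "R X (-Y) = - R X Y"
  by (simp_all add: P_def R_def algebra_simps)

lemma P_diff: "P (X-X') Y = P X Y - P X' Y" "P X (Y-Y') = P X Y - P X Y'"
  and R_diff: "R (X-X') Y = R X Y - R X' Y" "R X (Y-Y') = R X Y - R X Y'"
  by (simp_all add: P_def R_def algebra_simps)

lemma P_anti: "P Y X = - P X Y"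
  by (simp add: P_def br_anti[of Y X] br_anti[of "J Y" "J X"] algebra_simps)

lemma P_self: "P X X = 0"
  by (simp add: P_def)

lemma br_eq: "br X Y = P X Y + R X Y - R Y X"
proof -
  have "J (br (J Y) X) = - J (br X (J Y))" by (simp add: br_anti[of "J Y" X])
  moreover have "br Y X = - br X Y" by (rule br_anti)
  ultimately have "P X Y + R X Y - R Y X = (1/2) *\<^sub>R (br X Y + br X Y)"
    by (simp add: P_def R_def br_JJ algebra_simps)
  also have "\<dots> = br X Y" by (simp flip: scaleR_left_distrib)
  finally show ?thesis by simp
qed

text \<open>Evaluating the sum at \<open>J X\<close> and cancelling \<open>J\<close> gives
  \<open>A X - B X = 0\<close>, which together with \<open>A X + B X = 0\<close> kills both. Applied
  once per argument, this splits an identity into its types.\<close>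

lemma type_split:
  assumes "\<And>X. A (J X) = J (A X)" "\<And>X. B (J X) = - J (B X)" "\<And>X. A X + B X = 0"
  shows "A X = 0" "B X = 0"
proof -
  have "J (A X - B X) = 0" using assms(3)[of "J X"] by (simp add: assms(1,2))
  then have "J (J (A X - B X)) = J 0" by (rule arg_cong)
  then have "A X = B X" by simp
  with assms(3)[of X] have "2 *\<^sub>R A X = 0" by (simp add: scaleR_2)
  then show "A X = 0" by simp
  with \<open>A X = B X\<close> show "B X = 0" by simp
qed

lemmas PR_simps = P_lin R_lin P_J R_J P_neg R_neg P_diff R_diff P_zero R_zero

text \<open>The Jacobi identity is split into its components that are complex linear or antilinear
  in each of the three arguments.\<close>

lemma jacobi_PR:
  shows jacobi_P: "P X (P Y Z) + P Y (P Z X) + P Z (P X Y) = 0"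
    and R_P: "R (P X Y) Z = R X (R Y Z) - R Y (R X Z)"
    and R_of_P: "R Z (P X Y) = P (R Z X) Y + P X (R Z Y) - R (R X Z) Y + R (R Y Z) X"
proof -
  \<comment> \<open>\<open>A\<close> collects the terms of the expanded Jacobi sum that are complex
    linear in \<open>Z\<close>, and \<open>B\<close> the antilinear ones. A term such as
    \<open>R (R Z Y) X\<close> is linear in \<open>Z\<close>, being antilinear twice.\<close>
  define A where "A X Y Z = P X (P Y Z) + P Y (P Z X) + P Z (P X Y)
     + (P X (R Y Z) - P Z (R Y X) + R Y (P Z X) + R (R Z Y) X - R (R X Y) Z)
     + (P Y (- R X Z) + P Z (R X Y) + R X (P Y Z) + R (R Y X) Z - R (R Z X) Y)
     + (R X (R Y Z) - R Y (R X Z) - R (P X Y) Z)" for X Y Z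
  define B where "B X Y Z = - P X (R Z Y) + P Y (R Z X) + R Z (P X Y) - R (R Y Z) X + R (R X Z) Y
     + (- R X (R Z Y) + R Z (R X Y) - R (P Z X) Y)
     + (R Y (R Z X) - R Z (R Y X) - R (P Y Z) X)" for X Y Z
  have tot: "A X Y Z + B X Y Z = 0" for X Y Z
    using jacobi[of X Y Z] by (simp add: A_def B_def br_eq PR_simps algebra_simps)
  have A: "A X Y Z = 0" and B: "B X Y Z = 0" for X Y Z
  proof -
    have 1: "A X Y (J Z) = J (A X Y Z)" for Z
      unfolding A_def by (simp add: PR_simps algebra_simps)
    have 2: "B X Y (J Z) = - J (B X Y Z)" for Z
      unfolding B_def by (simp add: PR_simps algebra_simps)
    show "A X Y Z = 0" "B X Y Z = 0"
      by (rule type_split[of "\<lambda>Z. A X Y Z" "\<lambda>Z. B X Y Z", OF 1 2 tot])+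
  qed
  \<comment> \<open>Within \<open>B\<close>, the terms of \<open>B1\<close> are complex linear in
    \<open>X\<close> and those of \<open>B2\<close> antilinear.\<close>
  define B1 where "B1 X Y Z = - P X (R Z Y) + P Y (R Z X) + R Z (P X Y) - R (R Y Z) X + R (R X Z) Y
     + (R Y (R Z X) - R Z (R Y X) - R (P Y Z) X)" for X Y Z
  define B2 where "B2 X Y Z = - R X (R Z Y) + R Z (R X Y) - R (P Z X) Y" for X Y Z
  have B1: "B1 X Y Z = 0" for X Y Z
  proof -
    have 1: "B1 (J X) Y Z = J (B1 X Y Z)" for X
      unfolding B1_def by (simp add: PR_simps algebra_simps)
    have 2: "B2 (J X) Y Z = - J (B2 X Y Z)" for X
      unfolding B2_def by (simp add: PR_simps algebra_simps)
    have 3: "B1 X Y Z + B2 X Y Z = 0" for X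
      using B[of X Y Z] unfolding B_def B1_def B2_def by (simp add: algebra_simps)
    show ?thesis
      by (rule type_split[of "\<lambda>X. B1 X Y Z" "\<lambda>X. B2 X Y Z", OF 1 2 3])
  qed
  \<comment> \<open>The last splitting is by type in \<open>Y\<close>: \<open>C\<close> becomes the
    mixed identity \<open>R_of_P\<close>, and \<open>D\<close> becomes \<open>R_P\<close>.\<close>
  define C where "C X Y Z = - P X (R Z Y) + P Y (R Z X) + R Z (P X Y) - R (R Y Z) X + R (R X Z) Y"
    for X Y Z
  define D where "D X Y Z = R Y (R Z X) - R Z (R Y X) - R (P Y Z) X" for X Y Z
  have C: "C X Y Z = 0" and D: "D X Y Z = 0" for X Y Z
  proof -
    have 1: "C X (J Y) Z = J (C X Y Z)" for Y
      unfolding C_def by (simp add: PR_simps algebra_simps)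
    have 2: "D X (J Y) Z = - J (D X Y Z)" for Y
      unfolding D_def by (simp add: PR_simps algebra_simps)
    have 3: "C X Y Z + D X Y Z = 0" for Y
      using B1[of X Y Z] unfolding B1_def C_def D_def by (simp add: algebra_simps)
    show "C X Y Z = 0" "D X Y Z = 0"
      by (rule type_split[of "\<lambda>Y. C X Y Z" "\<lambda>Y. D X Y Z", OF 1 2 3])+
  qed
  show "R (P X Y) Z = R X (R Y Z) - R Y (R X Z)" for X Y Z
    using D[of Z X Y] by (simp add: D_def algebra_simps)
  show "R Z (P X Y) = P (R Z X) Y + P X (R Z Y) - R (R X Z) Y + R (R Y Z) X" for X Y Z
    using C[of X Y Z] by (simp add: C_def algebra_simps P_anti[of "R Z X"])
  show "P X (P Y Z) + P Y (P Z X) + P Z (P X Y) = 0"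
  proof -
    \<comment> \<open>Apart from the three nested values of \<open>P\<close>, the terms of
      \<open>A\<close> are permuted copies of \<open>C\<close> and \<open>D\<close>, which already
      vanish.\<close>
    have "P X (P Y Z) + P Y (P Z X) + P Z (P X Y) = A X Y Z - C Y Z X - C Z X Y - D Z X Y"
      unfolding A_def C_def D_def by (simp add: PR_simps algebra_simps)
    then show ?thesis by (simp add: A C D)
  qed
qed

end

section \<open>Coordinates\<close>

declare One_nat_def [simp del]

section \<open>Dimension counts for linear maps between a Euclidean space and the Lie
  algebra\<close>

lemma linear_inj_from_euclidean_surj:
  fixes f :: "'e::euclidean_space \<Rightarrow> 'g::real_vector"
  assumes f: "linear f" "inj f" and d: "dim (UNIV :: 'g set) = DIM('e)"
  shows "surj f"
proof -
  obtain B :: "'g set" where B: "independent B" "span B = UNIV" "card B = DIM('e)"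
    using real_vector.basis_exists[of "UNIV :: 'g set"] d by (metis top.extremum_uniqueI)
  \<comment> \<open>An infinite basis would have \<open>card B = 0\<close>, whereas
    \<open>DIM('e)\<close> is positive.\<close>
  have fB: "finite B" using B(3) by (metis DIM_positive card.infinite less_irrefl)
  have i: "independent (f ` Basis)"
    using f by (metis independent_Basis inj_on_subset linear_independent_injective_image subset_UNIV)
  have c: "card (f ` Basis) = DIM('e)"
    using f by (metis card_image inj_on_subset subset_UNIV)
  have "y \<in> span (f ` Basis)" for y
  proof (rule ccontr)
    assume y: "y \<notin> span (f ` Basis)"
    then have "independent (insert y (f ` Basis))" using i by (simp add: independent_insert)
    then have "card (insert y (f ` Basis)) \<le> card B"
      using real_vector.independent_span_bound[OF fB] B(2) by simp
    moreover have "y \<notin> f ` Basis" using y by (meson span_base)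
    ultimately show False using c B(3) by simp
  qed
  then show ?thesis
    using linear_span_image[OF f(1), of Basis] by (auto simp: surj_def span_Basis)
qed

lemma linear_surj_from_euclidean_dim_le:
  fixes f :: "'e::euclidean_space \<Rightarrow> 'g::real_vector"
  assumes f: "linear f" "surj f"
  shows "dim (UNIV :: 'g set) \<le> DIM('e)"
proof -
  have "UNIV \<subseteq> span (f ` Basis)"
    using f linear_span_image[OF f(1), of Basis] by (simp add: span_Basis)
  then have "dim (UNIV :: 'g set) \<le> card (f ` Basis)"
    by (rule real_vector.dim_le_card) simp
  also have "\<dots> \<le> DIM('e)" by (rule card_image_le) simp
  finally show ?thesis .
qed

lemma linear_inj_to_euclidean_surj:
  fixes f :: "'g::real_vector \<Rightarrow> 'e::euclidean_space"
  assumes f: "linear f" "inj f" and d: "dim (UNIV :: 'g set) = DIM('e)"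
  shows "surj f"
proof -
  obtain B :: "'g set" where B: "independent B" "span B = UNIV" "card B = DIM('e)"
    using real_vector.basis_exists[of "UNIV :: 'g set"] d by (metis top.extremum_uniqueI)
  have i: "independent (f ` B)"
    using f B by (metis inj_on_subset linear_independent_injective_image subset_UNIV)
  have c: "card (f ` B) = DIM('e)"
    using f B by (metis card_image inj_on_subset subset_UNIV)
  have "UNIV \<subseteq> span (f ` B)"
    using i c by (intro card_ge_dim_independent) auto
  then show ?thesis
    using linear_span_image[OF f(1), of B] B(2) by auto
qed

lemma dim_linear_inj_range:
  fixes f :: "'e::euclidean_space \<Rightarrow> 'g::real_vector"
  assumes f: "linear f" "inj f"
  shows "dim (range f) = DIM('e)"
proof -
  have i: "independent (f ` Basis)"
    using f by (metis independent_Basis inj_on_subset linear_independent_injective_image subset_UNIV)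
  have c: "card (f ` Basis) = DIM('e)"
    using f by (metis card_image inj_on_subset subset_UNIV)
  have "range f = span (f ` Basis)"
    using linear_span_image[OF f(1), of Basis] by (simp add: span_Basis)
  then show ?thesis using i c by (metis dim_eq_card_independent dim_span)
qed

text \<open>Spans and independence of sets of forms become statements about coefficient sums
  evaluated at vectors, the shape in which bases are dualized, changed and pulled back.\<close>

lemma basis10_iff:
  "basis10 J \<omega> \<longleftrightarrow> (\<forall>k\<in>{1..4}. \<omega> k \<in> forms10 J) \<and>
     (\<forall>\<alpha>\<in>forms10 J. \<exists>c. \<forall>X. \<alpha> X = (\<Sum>k=1..4. c k * \<omega> k X)) \<and>
     (\<forall>c. (\<forall>X. (\<Sum>k=1..4. c k * \<omega> k X) = 0) \<longrightarrow> (\<forall>k\<in>{1..4}. c k = 0))"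
  (is "_ \<longleftrightarrow> ?in \<and> ?span \<and> ?ind")
proof -
  have sumf: "(\<Sum>k\<in>K. c k *\<^sub>f \<omega> k) = (\<lambda>X. \<Sum>k\<in>K. c k * \<omega> k X)" for c and K :: "nat set"
    by (induction K rule: infinite_finite_induct) (auto simp: cscale_def)
  show ?thesis
  proof
    assume b: "basis10 J \<omega>"
    then have inj: "inj_on \<omega> {1..4}" and ind: "cform.independent (\<omega> ` {1..4})"
      and sp: "cform.span (\<omega> ` {1..4}) = forms10 J"
      by (auto simp: basis10_def)
    have "?in"
      unfolding sp[symmetric] by (auto intro: cform.span_base)
    moreover have "?span"
    proof
      fix \<alpha> assume "\<alpha> \<in> forms10 J"
      then have "\<alpha> \<in> cform.span (\<omega> ` {1..4})" using sp by simp
      then obtain u where "\<alpha> = (\<Sum>v\<in>\<omega> ` {1..4}. u v *\<^sub>f v)"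
        by (auto simp: cform.span_finite)
      also have "\<dots> = (\<Sum>k=1..4. u (\<omega> k) *\<^sub>f \<omega> k)"
        by (subst sum.reindex[OF inj]) simp
      finally show "\<exists>c. \<forall>X. \<alpha> X = (\<Sum>k=1..4. c k * \<omega> k X)"
        by (intro exI[of _ "\<lambda>k. u (\<omega> k)"]) (simp add: sumf)
    qed
    moreover have "?ind"
    proof (intro allI impI)
      fix c :: "nat \<Rightarrow> complex" assume 0: "\<forall>X. (\<Sum>k=1..4. c k * \<omega> k X) = 0"
      define u where "u = (\<lambda>v. c (inv_into {1..4} \<omega> v))"
      have "(\<Sum>v\<in>\<omega> ` {1..4}. u v *\<^sub>f v) = (\<Sum>k=1..4. c k *\<^sub>f \<omega> k)"
        by (subst sum.reindex[OF inj]) (auto simp: u_def inv_into_f_f[OF inj] simp del: atLeastAtMost_iff intro!: sum.cong)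
      also have "\<dots> = 0" using 0 by (simp add: sumf fun_eq_iff)
      finally have "\<forall>v\<in>\<omega> ` {1..4}. u v = 0"
        using ind by (auto simp: cform.dependent_finite)
      then show "\<forall>k\<in>{1..4}. c k = 0" by (auto simp: u_def inv_into_f_f[OF inj])
    qed
    ultimately show "?in \<and> ?span \<and> ?ind" by (intro conjI)
  next
    assume r: "?in \<and> ?span \<and> ?ind"
    have inj: "inj_on \<omega> {1..4}"
    proof (rule inj_onI, rule ccontr)
      fix j k :: nat assume jk: "j \<in> {1..4}" "k \<in> {1..4}" "\<omega> j = \<omega> k" "j \<noteq> k"
      \<comment> \<open>Equal forms at different indices would satisfy the nontrivial relation with
        coefficients 1 and -1.\<close>
      define c :: "nat \<Rightarrow> complex" where "c = (\<lambda>i. if i = j then 1 else if i = k then -1 else 0)"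
      have "(\<Sum>i=1..4. c i * \<omega> i X) = 0" for X
      proof -
        have "(\<Sum>i=1..4. c i * \<omega> i X) = (\<Sum>i\<in>{j,k}. c i * \<omega> i X)"
          by (rule sum.mono_neutral_right) (use jk in \<open>auto simp: c_def\<close>)
        also have "\<dots> = 0" using jk by (simp add: c_def)
        finally show ?thesis .
      qed
      then have "c j = 0" using r jk by blast
      then show False by (simp add: c_def)
    qed
    have "cform.independent (\<omega> ` {1..4})"
    proof (rule cform.independent_if_scalars_zero)
      fix u v assume u: "(\<Sum>v\<in>\<omega> ` {1..4}. u v *\<^sub>f v) = 0" and v: "v \<in> \<omega> ` {1..4}"
      have "(\<Sum>k=1..4. u (\<omega> k) *\<^sub>f \<omega> k) = 0"
        using u by (subst (asm) sum.reindex[OF inj]) simp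
      then have "\<forall>X. (\<Sum>k=1..4. u (\<omega> k) * \<omega> k X) = 0" by (simp add: sumf fun_eq_iff)
      then have "\<forall>k\<in>{1..4}. u (\<omega> k) = 0" 
        using r[THEN conjunct2, THEN conjunct2, rule_format, of "\<lambda>k. u (\<omega> k)"] by blast
      then show "u v = 0" using v by auto
    qed simp
    moreover have "cform.span (\<omega> ` {1..4}) = forms10 J"
    proof
      have "cform.subspace (forms10 J)"
        by (rule cform.subspaceI)
          (auto simp: forms10_def cscale_def algebra_simps linear_iff scaleR_conv_of_real)
      then show "cform.span (\<omega> ` {1..4}) \<subseteq> forms10 J"
        using r by (intro cform.span_minimal) auto
      show "forms10 J \<subseteq> cform.span (\<omega> ` {1..4})"
      proof
        fix \<alpha> assume "\<alpha> \<in> forms10 J"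
        then obtain c where "\<forall>X. \<alpha> X = (\<Sum>k=1..4. c k * \<omega> k X)" using r by blast
        then have "\<alpha> = (\<Sum>k=1..4. c k *\<^sub>f \<omega> k)" by (simp add: sumf fun_eq_iff)
        also have "\<dots> \<in> cform.span (\<omega> ` {1..4})"
          by (intro cform.span_sum cform.span_scale cform.span_base) auto
        finally show "\<alpha> \<in> cform.span (\<omega> ` {1..4})" .
      qed
    qed
    ultimately show "basis10 J \<omega>" using inj by (simp add: basis10_def)
  qed
qed

section \<open>Complex bases and their dual (1,0)-forms\<close>

locale complex_lie8 = complex_lie +
  assumes dim8: "dim (UNIV :: 'a set) = 8"
begin

lemma form10:
  assumes "\<alpha> \<in> forms10 J"
  shows "linear \<alpha>" "\<alpha> (X + Y) = \<alpha> X + \<alpha> Y" "\<alpha> (X - Y) = \<alpha> X - \<alpha> Y" "\<alpha> (- X) = - \<alpha> X" "\<alpha> 0 = 0"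
    "\<alpha> (t *\<^sub>R X) = of_real t * \<alpha> X" "\<alpha> (J X) = \<i> * \<alpha> X" "\<alpha> (c \<odot> X) = c * \<alpha> X"
proof -
  have l: "linear \<alpha>" and J: "\<And>X. \<alpha> (J X) = \<i> * \<alpha> X" using assms by (auto simp: forms10_def)
  then show "linear \<alpha>" "\<alpha> (X + Y) = \<alpha> X + \<alpha> Y" "\<alpha> (X - Y) = \<alpha> X - \<alpha> Y" "\<alpha> (- X) = - \<alpha> X" "\<alpha> 0 = 0"
    "\<alpha> (t *\<^sub>R X) = of_real t * \<alpha> X" "\<alpha> (J X) = \<i> * \<alpha> X"
    by (auto simp: linear_add linear_diff linear_neg linear_0 linear_scale scaleR_conv_of_real)
  show "\<alpha> (c \<odot> X) = c * \<alpha> X"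
    by (subst (2) complex_eq[of c])
      (simp add: scl_def linear_add[OF l] linear_scale[OF l] J scaleR_conv_of_real algebra_simps)
qed

lemma form10_separates:
  assumes "X \<noteq> 0" obtains \<alpha> where "\<alpha> \<in> forms10 J" "\<alpha> X \<noteq> 0"
proof -
  have "independent {X}" using assms by simp
  then obtain f :: "'a \<Rightarrow> real" where f: "linear f" "f X = 1"
    using linear_independent_extend[of "{X}" "\<lambda>_. 1 :: real"] by auto
  \<comment> \<open>The (1,0)-form with real part \<open>f\<close>.\<close>
  define \<alpha> where "\<alpha> Y = of_real (f Y) - \<i> * of_real (f (J Y))" for Y
  have "linear \<alpha>"
    by (rule linearI) (simp_all add: \<alpha>_def linear_add[OF f(1)] linear_scale[OF f(1)]
        scaleR_conv_of_real algebra_simps)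
  then have "\<alpha> \<in> forms10 J"
    by (simp add: forms10_def \<alpha>_def linear_neg[OF f(1)] algebra_simps)
  moreover have "Re (\<alpha> X) = 1" using f by (simp add: \<alpha>_def)
  then have "\<alpha> X \<noteq> 0" by auto
  ultimately show thesis by (rule that)
qed

text \<open>The last clause says that \<open>e\<close> spans over the complex numbers, so vector
  identities may be checked on four coordinates.\<close>

definition dual :: "(nat \<Rightarrow> 'a \<Rightarrow> complex) \<Rightarrow> (nat \<Rightarrow> 'a) \<Rightarrow> bool" where
  "dual \<omega> e \<longleftrightarrow> (\<forall>k\<in>{1..4}. \<omega> k \<in> forms10 J) \<and> (\<forall>j\<in>{1..4}. \<forall>k\<in>{1..4}. \<omega> k (e j) = (if j = k then 1 else 0)) \<and>
     (\<forall>X. X = \<omega> 1 X \<odot> e 1 + \<omega> 2 X \<odot> e 2 + \<omega> 3 X \<odot> e 3 + \<omega> 4 X \<odot> e 4)"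

lemma dual_basis10:
  assumes "dual \<omega> e" shows "basis10 J \<omega>"
  unfolding basis10_iff
proof (intro conjI ballI allI impI)
  fix \<alpha> assume a: "\<alpha> \<in> forms10 J"
  have *: "\<alpha> X = (\<Sum>k=1..4. \<alpha> (e k) * \<omega> k X)" for X
  proof -
    have "X = \<omega> 1 X \<odot> e 1 + \<omega> 2 X \<odot> e 2 + \<omega> 3 X \<odot> e 3 + \<omega> 4 X \<odot> e 4"
      using assms by (simp add: dual_def)
    then have "\<alpha> X = \<alpha> (\<omega> 1 X \<odot> e 1 + \<omega> 2 X \<odot> e 2 + \<omega> 3 X \<odot> e 3 + \<omega> 4 X \<odot> e 4)" by simp
    then show ?thesis by (simp add: form10[OF a] sum_1_4)
  qed
  show "\<exists>c. \<forall>X. \<alpha> X = (\<Sum>k=1..4. c k * \<omega> k X)"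
    by (intro exI[of _ "\<lambda>k. \<alpha> (e k)"] allI) (rule *)
next
  fix c :: "nat \<Rightarrow> complex" and k :: nat
  assume 0: "\<forall>X. (\<Sum>k=1..4. c k * \<omega> k X) = 0" and k: "k \<in> {1..4}"
  have "(\<Sum>j=1..4. c j * \<omega> j (e k)) = (\<Sum>j=1..4. if j = k then c j else 0)"
    by (rule sum.cong) (use assms k in \<open>auto simp: dual_def\<close>)
  also have "\<dots> = c k" using k by simp
  finally have "(\<Sum>j=1..4. c j * \<omega> j (e k)) = c k" .
  then show "c k = 0" using 0 by simp
qed (use assms in \<open>auto simp: dual_def\<close>)

text \<open>The coordinate map into complex 4-space is injective because (1,0)-forms separate
  points, and surjective because both sides have real dimension 8. The vectors \<open>e j\<close>
  are the preimages of the unit vectors.\<close>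

lemma basis10_dual:
  assumes b: "basis10 J \<omega>" obtains e where "dual \<omega> e"
proof -
  have in10: "\<omega> k \<in> forms10 J" if "k \<in> {1..4}" for k using b that by (simp add: basis10_iff)
  define f where "f X = (\<omega> 1 X, \<omega> 2 X, \<omega> 3 X, \<omega> 4 X)" for X
  have w: "\<omega> 1 \<in> forms10 J" "\<omega> 2 \<in> forms10 J" "\<omega> 3 \<in> forms10 J" "\<omega> 4 \<in> forms10 J"
    by (simp_all add: in10)
  have lf: "linear f"
    by (rule linearI) (simp_all add: f_def w[THEN form10(2)] w[THEN form10(6)] scaleR_conv_of_real)
  have "inj f"
    unfolding linear_injective_0[OF lf]
  proof (intro allI impI, rule ccontr)
    fix X assume "f X = 0" "X \<noteq> 0"
    then obtain \<alpha> where \<alpha>: "\<alpha> \<in> forms10 J" "\<alpha> X \<noteq> 0" using form10_separates by blast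
    then obtain c where "\<alpha> X = (\<Sum>k=1..4. c k * \<omega> k X)" using b by (auto simp: basis10_iff)
    with \<alpha> \<open>f X = 0\<close> show False by (simp add: sum_1_4 f_def zero_prod_def)
  qed
  moreover have "surj f" by (rule linear_inj_to_euclidean_surj[OF lf \<open>inj f\<close>]) (simp add: dim8)
  define g where "g = inv f"
  have fg: "f (g y) = y" for y using \<open>surj f\<close> by (simp add: g_def surj_f_inv_f)
  define e where "e j = g (if j = 1 then (1,0,0,0) else if j = 2 then (0,1,0,0)
     else if j = 3 then (0,0,1,0) else (0,0,0,1))" for j :: nat
  have fe: "f (e 1) = (1,0,0,0)" "f (e 2) = (0,1,0,0)" "f (e 3) = (0,0,1,0)" "f (e 4) = (0,0,0,1)"
    by (simp_all add: e_def fg)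
  have all4: "(\<forall>j\<in>{1..4::nat}. Q j) \<longleftrightarrow> Q 1 \<and> Q 2 \<and> Q 3 \<and> Q 4" for Q
  proof -
    have "{1..4::nat} = {1,2,3,4}" by auto
    then show ?thesis by simp
  qed
  have X: "X = \<omega> 1 X \<odot> e 1 + \<omega> 2 X \<odot> e 2 + \<omega> 3 X \<odot> e 3 + \<omega> 4 X \<odot> e 4" (is "X = ?Y") for X
  proof -
    have "f ?Y = f X"
      using fe by (simp add: f_def w[THEN form10(2)] w[THEN form10(8)])
    then show ?thesis using \<open>inj f\<close> by (metis injD)
  qed
  have "dual \<omega> e"
    unfolding dual_def all4 using fe w X by (auto simp: f_def)
  then show thesis by (rule that)
qed

text \<open>By the dimension count the combination map is bijective; the coordinates of its inverse
  are compatible with \<open>J\<close> and are the dual forms. Every adapted basis below is produced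
  from chosen vectors in this way.\<close>

lemma dual_exists:
  assumes ind: "\<And>w x y z. w \<odot> a + x \<odot> b + y \<odot> c + z \<odot> d = 0 \<Longrightarrow> w = 0 \<and> x = 0 \<and> y = 0 \<and> z = 0"
  obtains \<omega> e where "dual \<omega> e" "e 1 = a" "e 2 = b" "e 3 = c" "e 4 = d"
proof -
  define f where "f = (\<lambda>(w, x, y, z). w \<odot> a + x \<odot> b + y \<odot> c + z \<odot> d)"
  have lf: "linear f"
    by (rule linearI) (auto simp: f_def V.scale_left_distrib algebra_simps scl_def)
  have "inj f" unfolding linear_injective_0[OF lf]
    using ind by (auto simp: f_def zero_prod_def)
  have "surj f" by (rule linear_inj_from_euclidean_surj[OF lf \<open>inj f\<close>]) (simp add: dim8)
  define g where "g = inv f"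
  have fg: "f (g X) = X" for X using \<open>surj f\<close> by (simp add: g_def surj_f_inv_f)
  have gf: "g (f y) = y" for y using \<open>inj f\<close> by (simp add: g_def)
  have lg: "linear g"
    by (rule linearI; rule injD[OF \<open>inj f\<close>]) (simp_all add: fg linear_add[OF lf] linear_scale[OF lf])
  have fJ: "f (\<i> * w, \<i> * x, \<i> * y, \<i> * z) = J (f (w, x, y, z))" for w x y z
    by (simp add: f_def scl_def algebra_simps)
  have gJ: "g (J X) = (\<i> * fst (g X), \<i> * fst (snd (g X)), \<i> * fst (snd (snd (g X))), \<i> * snd (snd (snd (g X))))" for X
    by (rule injD[OF \<open>inj f\<close>]) (simp add: fJ fg)
  define \<omega> where "\<omega> k X = (if k = 1 then fst (g X) else if k = 2 then fst (snd (g X))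
     else if k = 3 then fst (snd (snd (g X))) else snd (snd (snd (g X))))" for k :: nat and X
  define e where "e k = (if k = 1 then a else if k = 2 then b else if k = 3 then c else d)" for k :: nat
  have ge: "g a = (1,0,0,0)" "g b = (0,1,0,0)" "g c = (0,0,1,0)" "g d = (0,0,0,1)"
    using gf[of "(1,0,0,0)"] gf[of "(0,1,0,0)"] gf[of "(0,0,1,0)"] gf[of "(0,0,0,1)"]
    by (simp_all add: f_def)
  have "\<omega> k \<in> forms10 J" for k
    by (auto simp: forms10_def \<omega>_def gJ linear_iff linear_add[OF lg] linear_scale[OF lg])
  moreover have "\<omega> 1 X \<odot> e 1 + \<omega> 2 X \<odot> e 2 + \<omega> 3 X \<odot> e 3 + \<omega> 4 X \<odot> e 4 = f (g X)" for X
    by (simp add: \<omega>_def e_def f_def split_beta)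
  then have "X = \<omega> 1 X \<odot> e 1 + \<omega> 2 X \<odot> e 2 + \<omega> 3 X \<odot> e 3 + \<omega> 4 X \<odot> e 4" for X by (simp add: fg)
  moreover have "\<forall>j\<in>{1..4}. \<forall>k\<in>{1..4}. \<omega> k (e j) = (if j = k then 1 else 0)"
    by (auto simp: \<omega>_def e_def ge)
  ultimately have "dual \<omega> e" unfolding dual_def by blast
  then show thesis by (rule that) (simp_all add: e_def)
qed

text \<open>Complex combinations of three vectors fill real dimension at most 6.\<close>

lemma exists_outside3:
  "\<exists>X. \<forall>x y z. X \<noteq> x \<odot> a + y \<odot> b + z \<odot> c"
proof -
  define f where "f = (\<lambda>(x, y, z). x \<odot> a + y \<odot> b + z \<odot> c)"
  have lf: "linear f"
    by (rule linearI) (auto simp: f_def V.scale_left_distrib algebra_simps scl_def)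
  have "\<not> surj f"
    using linear_surj_from_euclidean_dim_le[OF lf] dim8 by auto
  then obtain X where "\<And>u. X \<noteq> f u" by (auto simp: surj_def)
  then have "X \<noteq> x \<odot> a + y \<odot> b + z \<odot> c" for x y z
    using \<open>\<And>u. X \<noteq> f u\<close>[of "(x, y, z)"] by (simp add: f_def)
  then show ?thesis by blast
qed

text \<open>Each vector lies outside the span of those after it, so a relation could be solved for
  the vector with the first nonzero coefficient.\<close>

lemma independent4I:
  assumes 1: "d \<noteq> 0" and 2: "\<And>z. c \<noteq> z \<odot> d" and 3: "\<And>y z. b \<noteq> y \<odot> c + z \<odot> d"
    and 4: "\<And>x y z. a \<noteq> x \<odot> b + y \<odot> c + z \<odot> d"
    and 0: "w \<odot> a + x \<odot> b + y \<odot> c + z \<odot> d = 0"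
  shows "w = 0 \<and> x = 0 \<and> y = 0 \<and> z = 0"
proof -
  have div: "u = (- 1 / s) \<odot> v" if "s \<odot> u + v = 0" "s \<noteq> 0" for s u v
  proof -
    have "(1 / s) \<odot> (s \<odot> u + v) = 0" using that by simp
    then have "u + (1 / s) \<odot> v = 0" using that(2) by (simp add: V.scale_right_distrib)
    then show ?thesis by (simp add: eq_neg_iff_add_eq_0)
  qed
  have w: "w = 0"
  proof (rule ccontr)
    assume "w \<noteq> 0"
    then have "a = (- 1 / w) \<odot> (x \<odot> b + y \<odot> c + z \<odot> d)" using 0 by (intro div) (simp_all add: add.assoc)
    then show False using 4[of "- 1 / w * x" "- 1 / w * y" "- 1 / w * z"]
      by (simp add: V.scale_right_distrib)
  qed
  have x: "x = 0"
  proof (rule ccontr)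
    assume "x \<noteq> 0"
    then have "b = (- 1 / x) \<odot> (y \<odot> c + z \<odot> d)" using 0 w by (intro div) (simp_all add: add.assoc)
    then show False using 3[of "- 1 / x * y" "- 1 / x * z"] by (simp add: V.scale_right_distrib)
  qed
  have y: "y = 0"
  proof (rule ccontr)
    assume "y \<noteq> 0"
    then have "c = (- 1 / y) \<odot> (z \<odot> d)" using 0 w x by (intro div) simp_all
    then show False using 2[of "- 1 / y * z"] by simp
  qed
  with 0 w x 1 show ?thesis by simp
qed

end

section \<open>Structure equations in coordinates\<close>

context complex_lie8 begin

text \<open>The minus sign of \<open>ce_d\<close> is absorbed by reversing indices: a term
  \<open>wedge (\<omega> j) (cnj_form (\<omega> k))\<close> in the differential of
  \<open>\<alpha>\<close> becomes \<open>hh \<omega> k j\<close> in \<open>\<alpha> (R X Y)\<close>,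
  and \<open>wedge (\<omega> j) (\<omega> k)\<close> becomes \<open>aa \<omega> k j\<close> in
  \<open>\<alpha> (P X Y)\<close>.\<close>

abbreviation hh :: "(nat \<Rightarrow> 'a \<Rightarrow> complex) \<Rightarrow> nat \<Rightarrow> nat \<Rightarrow> 'a \<Rightarrow> 'a \<Rightarrow> complex"
  where "hh \<omega> j k X Y \<equiv> cnj (\<omega> j X) * \<omega> k Y"

abbreviation aa :: "(nat \<Rightarrow> 'a \<Rightarrow> complex) \<Rightarrow> nat \<Rightarrow> nat \<Rightarrow> 'a \<Rightarrow> 'a \<Rightarrow> complex"
  where "aa \<omega> j k X Y \<equiv> \<omega> j X * \<omega> k Y - \<omega> k X * \<omega> j Y"

text \<open>The equations before scaling: \<open>k\<close> and \<open>a\<close> may be complex and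
  \<open>\<delta>\<close> is any real number. The quotient \<open>b / \<delta>\<close> keeps its
  form under scaling and equals \<open>\<delta> * b\<close> when \<open>\<delta>\<close> is 1 or
  -1.\<close>

definition has_I :: "(nat \<Rightarrow> 'a \<Rightarrow> complex) \<Rightarrow> complex \<Rightarrow> real \<Rightarrow> complex \<Rightarrow> real \<Rightarrow> real \<Rightarrow> bool" where
  "has_I \<omega> k \<nu> a b \<delta> \<longleftrightarrow> (\<forall>X Y.
     \<omega> 1 (P X Y) = 0 \<and> \<omega> 2 (P X Y) = 0 \<and> \<omega> 3 (P X Y) = aa \<omega> 4 1 X Y \<and> \<omega> 4 (P X Y) = 0 \<and>
     \<omega> 1 (R X Y) = 0 \<and> \<omega> 2 (R X Y) = k * hh \<omega> 1 1 X Y \<and>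
     \<omega> 3 (R X Y) = hh \<omega> 4 1 X Y + a * hh \<omega> 1 2 X Y + \<i> * k * of_real (b / \<delta>) * hh \<omega> 2 1 X Y \<and>
     \<omega> 4 (R X Y) = \<i> * of_real \<nu> * hh \<omega> 1 1 X Y + of_real b * hh \<omega> 2 2 X Y
        + \<i> * of_real \<delta> * (hh \<omega> 3 1 X Y - hh \<omega> 1 3 X Y))"

text \<open>Here \<open>\<epsilon>\<close> and \<open>a\<close> may be complex. The bilinear part
  carries \<open>\<epsilon>\<close> and the sesquilinear part its conjugate, a shape that complex
  rescaling preserves.\<close>

definition has_II :: "(nat \<Rightarrow> 'a \<Rightarrow> complex) \<Rightarrow> complex \<Rightarrow> real \<Rightarrow> real \<Rightarrow> complex \<Rightarrow> real \<Rightarrow> bool" where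
  "has_II \<omega> \<epsilon> \<mu> \<nu> a b \<longleftrightarrow> (\<forall>X Y.
     \<omega> 1 (P X Y) = 0 \<and> \<omega> 2 (P X Y) = aa \<omega> 4 1 X Y \<and>
     \<omega> 3 (P X Y) = \<epsilon> * aa \<omega> 2 1 X Y + \<i> * of_real \<mu> * aa \<omega> 4 2 X Y \<and> \<omega> 4 (P X Y) = 0 \<and>
     \<omega> 1 (R X Y) = 0 \<and> \<omega> 2 (R X Y) = hh \<omega> 4 1 X Y \<and>
     \<omega> 3 (R X Y) = a * hh \<omega> 1 1 X Y + cnj \<epsilon> * (hh \<omega> 2 1 X Y - hh \<omega> 1 2 X Y)
        + \<i> * of_real \<mu> * hh \<omega> 4 2 X Y \<and>
     \<omega> 4 (R X Y) = \<i> * of_real \<nu> * hh \<omega> 1 1 X Y - of_real \<mu> * hh \<omega> 2 2 X Y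
        + \<i> * of_real b * (hh \<omega> 2 1 X Y - hh \<omega> 1 2 X Y)
        + \<i> * (hh \<omega> 3 1 X Y - hh \<omega> 1 3 X Y))"

lemma has_ID:
  assumes "has_I \<omega> k \<nu> a b \<delta>"
  shows "\<omega> 1 (P X Y) = 0"
    "\<omega> 2 (P X Y) = 0"
    "\<omega> 3 (P X Y) = aa \<omega> 4 1 X Y"
    "\<omega> 4 (P X Y) = 0"
    "\<omega> 1 (R X Y) = 0"
    "\<omega> 2 (R X Y) = k * hh \<omega> 1 1 X Y"
    "\<omega> 3 (R X Y) = hh \<omega> 4 1 X Y + a * hh \<omega> 1 2 X Y + \<i> * k * of_real (b / \<delta>) * hh \<omega> 2 1 X Y"
    "\<omega> 4 (R X Y) = \<i> * of_real \<nu> * hh \<omega> 1 1 X Y + of_real b * hh \<omega> 2 2 X Y + \<i> * of_real \<delta> * (hh \<omega> 3 1 X Y - hh \<omega> 1 3 X Y)"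
  using assms unfolding has_I_def by blast+

lemma has_IID:
  assumes "has_II \<omega> \<epsilon> \<mu> \<nu> a b"
  shows "\<omega> 1 (P X Y) = 0"
    "\<omega> 2 (P X Y) = aa \<omega> 4 1 X Y"
    "\<omega> 3 (P X Y) = \<epsilon> * aa \<omega> 2 1 X Y + \<i> * of_real \<mu> * aa \<omega> 4 2 X Y"
    "\<omega> 4 (P X Y) = 0"
    "\<omega> 1 (R X Y) = 0"
    "\<omega> 2 (R X Y) = hh \<omega> 4 1 X Y"
    "\<omega> 3 (R X Y) = a * hh \<omega> 1 1 X Y + cnj \<epsilon> * (hh \<omega> 2 1 X Y - hh \<omega> 1 2 X Y) + \<i> * of_real \<mu> * hh \<omega> 4 2 X Y"
    "\<omega> 4 (R X Y) = \<i> * of_real \<nu> * hh \<omega> 1 1 X Y - of_real \<mu> * hh \<omega> 2 2 X Y + \<i> * of_real b * (hh \<omega> 2 1 X Y - hh \<omega> 1 2 X Y) + \<i> * (hh \<omega> 3 1 X Y - hh \<omega> 1 3 X Y)"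
  using assms unfolding has_II_def by blast+

lemma form10_P:
  assumes "\<alpha> \<in> forms10 J"
  shows "\<alpha> (P X Y) = (\<alpha> (br X Y) - \<alpha> (br (J X) (J Y))) / 2"
    and "\<alpha> (R X Y) = (\<alpha> (br X Y) + \<i> * \<alpha> (br (J X) Y)) / 2"
    and "\<alpha> (br X Y) = \<alpha> (P X Y) + \<alpha> (R X Y) - \<alpha> (R Y X)"
proof -
  note a = form10[OF assms]
  show "\<alpha> (P X Y) = (\<alpha> (br X Y) - \<alpha> (br (J X) (J Y))) / 2" by (simp add: P_def a)
  show "\<alpha> (R X Y) = (\<alpha> (br X Y) + \<i> * \<alpha> (br (J X) Y)) / 2" by (simp add: R_def a)
  show "\<alpha> (br X Y) = \<alpha> (P X Y) + \<alpha> (R X Y) - \<alpha> (R Y X)" by (subst br_eq) (simp add: a)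
qed

lemma basis10_forms10:
  assumes "basis10 J \<omega>"
  shows "\<omega> 1 \<in> forms10 J" "\<omega> 2 \<in> forms10 J" "\<omega> 3 \<in> forms10 J" "\<omega> 4 \<in> forms10 J"
  using assms by (auto simp: basis10_iff)

text \<open>A (1,0)-form recovers its values on \<open>P\<close> and \<open>R\<close> from the
  bracket by applying \<open>J\<close> to arguments, so the differentials determine both parts;
  conversely \<open>br_eq\<close> reassembles the bracket.\<close>

lemma has_equations_I:
  assumes b: "basis10 J \<omega>" and d: "\<delta> \<in> {1, -1}"
  shows "has_equations br \<omega> (Eqs_I \<delta> \<epsilon> \<nu> a b) \<longleftrightarrow> has_I \<omega> (of_real \<epsilon>) \<nu> (of_real a) b \<delta>"
proof -
  note w = basis10_forms10[OF b]
  have bd: "b / \<delta> = \<delta> * b" using d by auto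
  show ?thesis
  proof
    assume h: "has_equations br \<omega> (Eqs_I \<delta> \<epsilon> \<nu> a b)"
    note E = h[unfolded has_equations.simps Let_def, THEN conjunct1]
      h[unfolded has_equations.simps Let_def, THEN conjunct2, THEN conjunct1]
      h[unfolded has_equations.simps Let_def, THEN conjunct2, THEN conjunct2, THEN conjunct1]
      h[unfolded has_equations.simps Let_def, THEN conjunct2, THEN conjunct2, THEN conjunct2]
    have e1: "\<omega> 1 (br X Y) = 0"
      and e2: "\<omega> 2 (br X Y) = of_real \<epsilon> * (hh \<omega> 1 1 X Y - hh \<omega> 1 1 Y X)"
      and e3: "\<omega> 3 (br X Y) = aa \<omega> 4 1 X Y + (hh \<omega> 4 1 X Y - hh \<omega> 4 1 Y X)
         + of_real a * (hh \<omega> 1 2 X Y - hh \<omega> 1 2 Y X) + \<i> * of_real (\<delta> * \<epsilon> * b) * (hh \<omega> 2 1 X Y - hh \<omega> 2 1 Y X)"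
      and e4: "\<omega> 4 (br X Y) = \<i> * of_real \<nu> * (hh \<omega> 1 1 X Y - hh \<omega> 1 1 Y X)
         + of_real b * (hh \<omega> 2 2 X Y - hh \<omega> 2 2 Y X)
         + \<i> * of_real \<delta> * ((hh \<omega> 3 1 X Y - hh \<omega> 3 1 Y X) - (hh \<omega> 1 3 X Y - hh \<omega> 1 3 Y X))" for X Y
      using arg_cong[OF fun_cong[OF E(1), of "(X, Y)"], of uminus]
        arg_cong[OF fun_cong[OF E(2), of "(X, Y)"], of uminus]
        arg_cong[OF fun_cong[OF E(3), of "(X, Y)"], of uminus]
        arg_cong[OF fun_cong[OF E(4), of "(X, Y)"], of uminus]
      by (simp_all add: ce_d_def wedge_def cscale_def cnj_form_def algebra_simps)
    show "has_I \<omega> (of_real \<epsilon>) \<nu> (of_real a) b \<delta>"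
      unfolding has_I_def bd
      by (simp add: form10_P(1,2)[OF w(1)] form10_P(1,2)[OF w(2)] form10_P(1,2)[OF w(3)]
          form10_P(1,2)[OF w(4)] e1 e2 e3 e4 w[THEN form10(7)] field_simps)
  next
    assume "has_I \<omega> (of_real \<epsilon>) \<nu> (of_real a) b \<delta>"
    note h = has_ID[OF this]
    show "has_equations br \<omega> (Eqs_I \<delta> \<epsilon> \<nu> a b)"
      by (simp add: h bd fun_eq_iff ce_d_def wedge_def cscale_def cnj_form_def w[THEN form10_P(3)]
        algebra_simps)
  qed
qed

lemma has_equations_II:
  assumes b: "basis10 J \<omega>"
  shows "has_equations br \<omega> (Eqs_II \<epsilon> \<mu> \<nu> a b) \<longleftrightarrow> has_II \<omega> (of_real \<epsilon>) \<mu> \<nu> (of_real a) b"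
proof -
  note w = basis10_forms10[OF b]
  show ?thesis
  proof
    assume h: "has_equations br \<omega> (Eqs_II \<epsilon> \<mu> \<nu> a b)"
    note E = h[unfolded has_equations.simps Let_def, THEN conjunct1]
      h[unfolded has_equations.simps Let_def, THEN conjunct2, THEN conjunct1]
      h[unfolded has_equations.simps Let_def, THEN conjunct2, THEN conjunct2, THEN conjunct1]
      h[unfolded has_equations.simps Let_def, THEN conjunct2, THEN conjunct2, THEN conjunct2]
    have e1: "\<omega> 1 (br X Y) = 0"
      and e2: "\<omega> 2 (br X Y) = aa \<omega> 4 1 X Y + (hh \<omega> 4 1 X Y - hh \<omega> 4 1 Y X)"
      and e3: "\<omega> 3 (br X Y) = of_real a * (hh \<omega> 1 1 X Y - hh \<omega> 1 1 Y X)
         + of_real \<epsilon> * (aa \<omega> 2 1 X Y + (hh \<omega> 2 1 X Y - hh \<omega> 2 1 Y X) - (hh \<omega> 1 2 X Y - hh \<omega> 1 2 Y X))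
         + \<i> * of_real \<mu> * (aa \<omega> 4 2 X Y + (hh \<omega> 4 2 X Y - hh \<omega> 4 2 Y X))"
      and e4: "\<omega> 4 (br X Y) = \<i> * of_real \<nu> * (hh \<omega> 1 1 X Y - hh \<omega> 1 1 Y X)
         - of_real \<mu> * (hh \<omega> 2 2 X Y - hh \<omega> 2 2 Y X)
         + \<i> * of_real b * ((hh \<omega> 2 1 X Y - hh \<omega> 2 1 Y X) - (hh \<omega> 1 2 X Y - hh \<omega> 1 2 Y X))
         + \<i> * ((hh \<omega> 3 1 X Y - hh \<omega> 3 1 Y X) - (hh \<omega> 1 3 X Y - hh \<omega> 1 3 Y X))" for X Y
      using arg_cong[OF fun_cong[OF E(1), of "(X, Y)"], of uminus]
        arg_cong[OF fun_cong[OF E(2), of "(X, Y)"], of uminus]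
        arg_cong[OF fun_cong[OF E(3), of "(X, Y)"], of uminus]
        arg_cong[OF fun_cong[OF E(4), of "(X, Y)"], of uminus]
      by (simp_all add: ce_d_def wedge_def cscale_def cnj_form_def algebra_simps)
    show "has_II \<omega> (of_real \<epsilon>) \<mu> \<nu> (of_real a) b"
      unfolding has_II_def
      by (simp add: form10_P(1,2)[OF w(1)] form10_P(1,2)[OF w(2)] form10_P(1,2)[OF w(3)]
          form10_P(1,2)[OF w(4)] e1 e2 e3 e4 w[THEN form10(7)] field_simps)
  next
    assume "has_II \<omega> (of_real \<epsilon>) \<mu> \<nu> (of_real a) b"
    note h = has_IID[OF this]
    show "has_equations br \<omega> (Eqs_II \<epsilon> \<mu> \<nu> a b)"
      by (simp add: h fun_eq_iff ce_d_def wedge_def cscale_def cnj_form_def w[THEN form10_P(3)]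
        algebra_simps)
  qed
qed

end

section \<open>Normalization of the coefficients\<close>

definition family4 :: "'b \<Rightarrow> 'b \<Rightarrow> 'b \<Rightarrow> 'b \<Rightarrow> nat \<Rightarrow> 'b"
  where "family4 a b c d k = (if k = 1 then a else if k = 2 then b else if k = 3 then c else d)"

lemma family4_simps [simp]:
  "family4 a b c d 1 = a" "family4 a b c d 2 = b" "family4 a b c d 3 = c" "family4 a b c d 4 = d"
  by (simp_all add: family4_def)

lemma ball_1_4: "(\<forall>j\<in>{1..4::nat}. Q j) \<longleftrightarrow> Q 1 \<and> Q 2 \<and> Q 3 \<and> Q 4"
proof -
  have "{1..4::nat} = {1,2,3,4}" by auto
  then show ?thesis by simp
qed

context complex_lie8 begin

lemma triangular_basis10:
  assumes b: "basis10 J \<omega>" and l: "l1 \<noteq> 0" "l2 \<noteq> 0" "l3 \<noteq> 0" "l4 \<noteq> 0"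
  obtains \<omega>' where "basis10 J \<omega>'" "\<And>X. \<omega>' 1 X = l1 * \<omega> 1 X"
    "\<And>X. \<omega>' 2 X = l2 * \<omega> 2 X + c21 * \<omega> 1 X"
    "\<And>X. \<omega>' 3 X = l3 * \<omega> 3 X + c32 * \<omega> 2 X + c31 * \<omega> 1 X"
    "\<And>X. \<omega>' 4 X = l4 * \<omega> 4 X + c41 * \<omega> 1 X"
proof -
  define \<omega>' where "\<omega>' = family4 (\<lambda>X. l1 * \<omega> 1 X) (\<lambda>X. l2 * \<omega> 2 X + c21 * \<omega> 1 X)
    (\<lambda>X. l3 * \<omega> 3 X + c32 * \<omega> 2 X + c31 * \<omega> 1 X) (\<lambda>X. l4 * \<omega> 4 X + c41 * \<omega> 1 X)"
  note w = basis10_forms10[OF b]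
  have "basis10 J \<omega>'"
    unfolding basis10_iff ball_1_4 sum_1_4
  proof (intro conjI ballI allI impI)
    have "\<alpha> \<in> forms10 J" if "\<And>X. \<alpha> X = x * \<omega> 1 X + y * \<omega> 2 X + z * \<omega> 3 X + u * \<omega> 4 X" for \<alpha> x y z u
      using w by (auto simp: forms10_def that linear_iff scaleR_conv_of_real algebra_simps)
    from this[of _ l1 0 0 0] this[of _ c21 l2 0 0] this[of _ c31 c32 l3 0] this[of _ c41 0 0 l4]
    show "\<omega>' 1 \<in> forms10 J" "\<omega>' 2 \<in> forms10 J" "\<omega>' 3 \<in> forms10 J" "\<omega>' 4 \<in> forms10 J"
      by (simp_all add: \<omega>'_def)
  next
    fix \<alpha> assume "\<alpha> \<in> forms10 J"
    then obtain d :: "nat \<Rightarrow> complex" where d: "\<And>X. \<alpha> X = d 1 * \<omega> 1 X + d 2 * \<omega> 2 X + d 3 * \<omega> 3 X + d 4 * \<omega> 4 X"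
      using b unfolding basis10_iff sum_1_4 by blast
    \<comment> \<open>Back substitution in the triangular system.\<close>
    define c4 where "c4 = d 4 / l4"
    define c3 where "c3 = d 3 / l3"
    define c2 where "c2 = (d 2 - c3 * c32) / l2"
    define c1 where "c1 = (d 1 - c2 * c21 - c3 * c31 - c4 * c41) / l1"
    have c: "d 4 = c4 * l4" "d 3 = c3 * l3" "d 2 = c2 * l2 + c3 * c32"
      "d 1 = c1 * l1 + c2 * c21 + c3 * c31 + c4 * c41"
      using l by (simp_all add: c1_def c2_def c3_def c4_def)
    show "\<exists>c :: nat \<Rightarrow> complex. \<forall>X. \<alpha> X = c 1 * \<omega>' 1 X + c 2 * \<omega>' 2 X + c 3 * \<omega>' 3 X + c 4 * \<omega>' 4 X"
      by (rule exI[of _ "family4 c1 c2 c3 c4"]) (simp add: \<omega>'_def d c algebra_simps)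
  next
    fix c :: "nat \<Rightarrow> complex"
    assume 0: "\<forall>X. c 1 * \<omega>' 1 X + c 2 * \<omega>' 2 X + c 3 * \<omega>' 3 X + c 4 * \<omega>' 4 X = 0"
    define d where "d = family4 (c 1 * l1 + c 2 * c21 + c 3 * c31 + c 4 * c41) (c 2 * l2 + c 3 * c32)
      (c 3 * l3) (c 4 * l4)"
    have "\<forall>X. d 1 * \<omega> 1 X + d 2 * \<omega> 2 X + d 3 * \<omega> 3 X + d 4 * \<omega> 4 X = 0"
      using 0 by (simp add: d_def \<omega>'_def algebra_simps)
    then have "d 1 = 0 \<and> d 2 = 0 \<and> d 3 = 0 \<and> d 4 = 0"
      using b unfolding basis10_iff sum_1_4 ball_1_4 by blast
    then show "c 1 = 0" "c 2 = 0" "c 3 = 0" "c 4 = 0" using l by (auto simp: d_def)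
  qed
  then show thesis by (rule that) (simp_all add: \<omega>'_def)
qed

text \<open>The factors of \<open>\<omega> 3\<close> and \<open>\<omega> 4\<close> are forced: the
  unit coefficients of \<open>aa \<omega> 4 1\<close> and \<open>hh \<omega> 4 1\<close> survive
  only if the factor of \<open>\<omega> 3\<close> is \<open>l1\<close> times that of
  \<open>\<omega> 4\<close> and also \<open>l1\<close> times its conjugate. So
  \<open>\<omega> 4\<close> is scaled by a real number.\<close>

lemma has_I_scale:
  assumes b: "basis10 J \<omega>" and h: "has_I \<omega> k \<nu> a b \<delta>" and l: "l1 \<noteq> 0" "l2 \<noteq> 0" "t \<noteq> 0" and \<delta>: "\<delta> \<noteq> 0"
  obtains \<omega>' where "basis10 J \<omega>'"
    "has_I \<omega>' (k * l2 / of_real ((cmod l1)\<^sup>2)) (\<nu> * t / (cmod l1)\<^sup>2)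
       (a * l1 * of_real t / (cnj l1 * l2)) (b * t / (cmod l2)\<^sup>2) (\<delta> / (cmod l1)\<^sup>2)"
proof -
  obtain \<omega>' where b': "basis10 J \<omega>'" and w: "\<And>X. \<omega>' 1 X = l1 * \<omega> 1 X"
    "\<And>X. \<omega>' 2 X = l2 * \<omega> 2 X + 0 * \<omega> 1 X"
    "\<And>X. \<omega>' 3 X = l1 * of_real t * \<omega> 3 X + 0 * \<omega> 2 X + 0 * \<omega> 1 X"
    "\<And>X. \<omega>' 4 X = of_real t * \<omega> 4 X + 0 * \<omega> 1 X"
    using triangular_basis10[OF b, of l1 l2 "l1 * of_real t" "of_real t" 0 0 0 0] l
    by (metis mult_eq_0_iff of_real_eq_0_iff)
  note h = has_ID[OF h]
  have "has_I \<omega>' (k * l2 / of_real ((cmod l1)\<^sup>2)) (\<nu> * t / (cmod l1)\<^sup>2)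
       (a * l1 * of_real t / (cnj l1 * l2)) (b * t / (cmod l2)\<^sup>2) (\<delta> / (cmod l1)\<^sup>2)"
    unfolding has_I_def of_real_divide of_real_mult complex_norm_square
    using l \<delta> by (simp add: w h field_simps)
  with b' show thesis by (rule that)
qed

text \<open>The unit coefficients in \<open>\<omega> 2\<close> make the factor \<open>t\<close> of
  \<open>\<omega> 4\<close> real and that of \<open>\<omega> 2\<close> equal to
  \<open>t * l\<close>; the unit coefficient joining 1 and 3 in \<open>\<omega> 4\<close> then
  forces \<open>t / cnj l\<close> for \<open>\<omega> 3\<close>. The effect on
  \<open>\<epsilon>\<close> is independent of \<open>t\<close>.\<close>

lemma has_II_scale:
  assumes b: "basis10 J \<omega>" and h: "has_II \<omega> \<epsilon> \<mu> \<nu> a b" and l: "l \<noteq> 0" "t \<noteq> 0"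
  obtains \<omega>' where "basis10 J \<omega>'"
    "has_II \<omega>' (\<epsilon> / (cnj l * l\<^sup>2)) (\<mu> / (t * (cmod l)\<^sup>2)) (\<nu> * t / (cmod l)\<^sup>2)
       (a * of_real t / (cnj l * of_real ((cmod l)\<^sup>2))) (b / (cmod l)\<^sup>2)"
proof -
  obtain \<omega>' where b': "basis10 J \<omega>'" and w: "\<And>X. \<omega>' 1 X = l * \<omega> 1 X"
    "\<And>X. \<omega>' 2 X = of_real t * l * \<omega> 2 X + 0 * \<omega> 1 X"
    "\<And>X. \<omega>' 3 X = of_real t / cnj l * \<omega> 3 X + 0 * \<omega> 2 X + 0 * \<omega> 1 X"
    "\<And>X. \<omega>' 4 X = of_real t * \<omega> 4 X + 0 * \<omega> 1 X"
    using triangular_basis10[OF b, of l "of_real t * l" "of_real t / cnj l" "of_real t" 0 0 0 0] l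
    by (metis complex_cnj_zero_iff divide_eq_0_iff mult_eq_0_iff of_real_eq_0_iff)
  note h = has_IID[OF h]
  have "has_II \<omega>' (\<epsilon> / (cnj l * l\<^sup>2)) (\<mu> / (t * (cmod l)\<^sup>2)) (\<nu> * t / (cmod l)\<^sup>2)
       (a * of_real t / (cnj l * of_real ((cmod l)\<^sup>2))) (b / (cmod l)\<^sup>2)"
    unfolding has_II_def of_real_divide of_real_mult complex_norm_square
    using l by (simp add: w h field_simps power2_eq_square)
  with b' show thesis by (rule that)
qed

text \<open>Dually, \<open>e\<^sub>1\<close> is replaced by \<open>e\<^sub>1 + i s e\<^sub>2\<close>; \<open>g\<close> removes the real part this creates in the
  coefficient of \<open>\<omega>\<^sup>1 \<and> cnj \<omega>\<^sup>1\<close> in \<open>d\<omega>\<^sup>4\<close>.\<close>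

lemma has_II_shift:
  assumes b: "basis10 J \<omega>" and h: "has_II \<omega> \<epsilon> \<mu> \<nu> a b"
  obtains \<omega>' where "basis10 J \<omega>'" "has_II \<omega>' \<epsilon> \<mu> \<nu> (a - 2 * \<i> * of_real s * cnj \<epsilon>) (b - 2 * \<mu> * s)"
proof -
  define g where "g = \<i> * of_real ((2 * b * s - 3 * \<mu> * s\<^sup>2) / 2)"
  obtain \<omega>' where b': "basis10 J \<omega>'" and w: "\<And>X. \<omega>' 1 X = 1 * \<omega> 1 X"
    "\<And>X. \<omega>' 2 X = 1 * \<omega> 2 X + (- \<i> * of_real s) * \<omega> 1 X"
    "\<And>X. \<omega>' 3 X = 1 * \<omega> 3 X + of_real (\<mu> * s) * \<omega> 2 X + g * \<omega> 1 X"
    "\<And>X. \<omega>' 4 X = 1 * \<omega> 4 X + 0 * \<omega> 1 X"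
    using triangular_basis10[OF b, of 1 1 1 1 "- \<i> * of_real s" "of_real (\<mu> * s)" g 0] by (metis one_neq_zero)
  note h = has_IID[OF h]
  have "has_II \<omega>' \<epsilon> \<mu> \<nu> (a - 2 * \<i> * of_real s * cnj \<epsilon>) (b - 2 * \<mu> * s)"
    unfolding has_II_def
    by (simp add: w h g_def field_simps power2_eq_square)
  with b' show thesis by (rule that)
qed

end

section \<open>Removal of inessential coefficients and scaling to the listed values\<close>

context complex_lie8 begin

text \<open>Each added term removes one coefficient: \<open>d\<close> cancels \<open>q\<close> and
  its conjugate, the imaginary multiple of \<open>\<omega> 1\<close> in the third form cancels the
  real part of \<open>k4\<close>, and the change of the fourth form absorbs \<open>k3\<close>
  together with the term \<open>k2 * d\<close> that \<open>d\<close> creates.\<close>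

lemma normalize_I:
  assumes b: "basis10 J \<omega>" and \<delta>: "\<delta> \<noteq> 0" and l3: "l3 = \<i> * k2 * of_real (b / \<delta>)"
    and h: "\<And>X Y. \<omega> 1 (P X Y) = 0" "\<And>X Y. \<omega> 2 (P X Y) = 0" "\<And>X Y. \<omega> 3 (P X Y) = aa \<omega> 4 1 X Y"
      "\<And>X Y. \<omega> 4 (P X Y) = 0" "\<And>X Y. \<omega> 1 (R X Y) = 0" "\<And>X Y. \<omega> 2 (R X Y) = k2 * hh \<omega> 1 1 X Y"
      "\<And>X Y. \<omega> 3 (R X Y) = hh \<omega> 4 1 X Y + k3 * hh \<omega> 1 1 X Y + a * hh \<omega> 1 2 X Y + l3 * hh \<omega> 2 1 X Y"
      "\<And>X Y. \<omega> 4 (R X Y) = k4 * hh \<omega> 1 1 X Y + q * hh \<omega> 1 2 X Y + cnj q * hh \<omega> 2 1 X Y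
        + of_real b * hh \<omega> 2 2 X Y + \<i> * of_real \<delta> * (hh \<omega> 3 1 X Y - hh \<omega> 1 3 X Y)"
  obtains \<omega>' where "basis10 J \<omega>'" "has_I \<omega>' k2 (Im k4) a b \<delta>"
proof -
  obtain x y where k4: "k4 = of_real x + \<i> * of_real y" using complex_eq by blast
  define d where "d = \<i> * q / of_real \<delta>"
  obtain \<omega>' where b': "basis10 J \<omega>'" and w: "\<And>X. \<omega>' 1 X = 1 * \<omega> 1 X"
    "\<And>X. \<omega>' 2 X = 1 * \<omega> 2 X + 0 * \<omega> 1 X"
    "\<And>X. \<omega>' 3 X = 1 * \<omega> 3 X + d * \<omega> 2 X + (\<i> * of_real (x / (2 * \<delta>))) * \<omega> 1 X"
    "\<And>X. \<omega>' 4 X = 1 * \<omega> 4 X + cnj (k3 + k2 * d) * \<omega> 1 X"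
    using triangular_basis10[OF b, of 1 1 1 1 0 d "\<i> * of_real (x / (2 * \<delta>))" "cnj (k3 + k2 * d)"]
    by (metis one_neq_zero)
  have "has_I \<omega>' k2 y a b \<delta>"
    unfolding has_I_def
    using \<delta> by (simp add: w h k4 d_def l3 field_simps)
  then show thesis using b' by (intro that) (simp_all add: k4)
qed

text \<open>The factor \<open>\<i> * s\<close> standardizes the terms joining 1 and 3,
  \<open>cnj k2\<close> absorbs the \<open>hh \<omega> 1 1\<close> term of
  \<open>\<omega> 2\<close>, and \<open>x / 2\<close> removes the real part of \<open>k4\<close>.
  The relation for \<open>e * s\<close> then makes the coefficient of \<open>hh \<omega> 1 2\<close>
  in the third form the negative conjugate of the new \<open>\<epsilon>\<close>.\<close>

lemma normalize_II:
  assumes b: "basis10 J \<omega>" and s: "s \<noteq> 0" "m * s = of_real \<mu>"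
    and es: "e * s = 2 * cnj k2 * of_real \<mu> - cnj p3 * cnj s" and p4: "Re p4 = 0"
    and h: "\<And>X Y. \<omega> 1 (P X Y) = 0" "\<And>X Y. \<omega> 2 (P X Y) = aa \<omega> 4 1 X Y"
      "\<And>X Y. \<omega> 3 (P X Y) = e * aa \<omega> 1 2 X Y + m * aa \<omega> 4 2 X Y"
      "\<And>X Y. \<omega> 4 (P X Y) = 0" "\<And>X Y. \<omega> 1 (R X Y) = 0"
      "\<And>X Y. \<omega> 2 (R X Y) = hh \<omega> 4 1 X Y + k2 * hh \<omega> 1 1 X Y"
      "\<And>X Y. \<omega> 3 (R X Y) = k3 * hh \<omega> 1 1 X Y + p3 * hh \<omega> 1 2 X Y + (k2 * m - p3) * hh \<omega> 2 1 X Y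
        + m * hh \<omega> 4 2 X Y"
      "\<And>X Y. \<omega> 4 (R X Y) = k4 * hh \<omega> 1 1 X Y + p4 * (hh \<omega> 1 2 X Y - hh \<omega> 2 1 X Y)
        - of_real \<mu> * hh \<omega> 2 2 X Y + s * hh \<omega> 1 3 X Y + cnj s * hh \<omega> 3 1 X Y"
  obtains \<omega>' where "basis10 J \<omega>'"
    "has_II \<omega>' (\<i> * s * (m * cnj k2 - e)) \<mu> (Im k4) (\<i> * s * k3) (- Im p4)"
proof -
  obtain x y where k4: "k4 = of_real x + \<i> * of_real y" using complex_eq by blast
  obtain v where v: "p4 = - \<i> * of_real v" using p4 by (metis (no_types) complex_eq mult_minus_left
      minus_mult_minus minus_minus of_real_0 add_0 mult_minus_right of_real_minus)
  have m: "m = of_real \<mu> / s" using s by (simp add: field_simps)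
  have e: "e = (2 * cnj k2 * of_real \<mu> - cnj p3 * cnj s) / s" using s es by (simp add: field_simps)
  have cs: "cnj s \<noteq> 0" using s by simp
  obtain \<omega>' where b': "basis10 J \<omega>'" and w: "\<And>X. \<omega>' 1 X = 1 * \<omega> 1 X"
    "\<And>X. \<omega>' 2 X = 1 * \<omega> 2 X + 0 * \<omega> 1 X"
    "\<And>X. \<omega>' 3 X = (\<i> * s) * \<omega> 3 X + 0 * \<omega> 2 X + (\<i> * of_real (x / 2)) * \<omega> 1 X"
    "\<And>X. \<omega>' 4 X = 1 * \<omega> 4 X + cnj k2 * \<omega> 1 X"
    using triangular_basis10[OF b, of 1 1 "\<i> * s" 1 0 0 "\<i> * of_real (x / 2)" "cnj k2"] s
    by (metis one_neq_zero mult_eq_0_iff complex_i_not_zero)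
  have "has_II \<omega>' (\<i> * s * (m * cnj k2 - e)) \<mu> y (\<i> * s * k3) v"
    unfolding has_II_def
    using s(1) cs by (simp add: w h k4 v m e field_simps)
  then show thesis using b' by (intro that) (simp_all add: k4 v)
qed

text \<open>A factor \<open>l1\<close> of modulus 1 keeps \<open>\<delta>\<close>, so this is the
  freedom that remains once \<open>\<delta>\<close> is a sign and \<open>\<epsilon>\<close> is 0 or
  1.\<close>

lemma listed_I_aux:
  assumes b: "basis10 J \<omega>" and h: "has_I \<omega> (of_real \<epsilon>) \<nu> a b \<delta>" and \<delta>: "\<delta> \<in> {1, -1}"
    and l: "cmod l1 = 1" "l2 \<noteq> 0" "t \<noteq> 0" and \<epsilon>: "of_real \<epsilon> * l2 = of_real \<epsilon>"
    and a': "a * l1 * of_real t = of_real a' * (cnj l1 * l2)"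
    and v: "(\<epsilon>, \<nu> * t, a', b * t / (cmod l2)\<^sup>2) \<in> values_I"
  shows "\<exists>\<delta> \<epsilon> \<nu> a b. \<delta> \<in> {1, -1} \<and> (\<epsilon>, \<nu>, a, b) \<in> values_I \<and> admits_equations br J (Eqs_I \<delta> \<epsilon> \<nu> a b)"
proof -
  have l1: "l1 \<noteq> 0" using l by auto
  obtain \<omega>' where b': "basis10 J \<omega>'" and h': "has_I \<omega>' (of_real \<epsilon> * l2 / of_real ((cmod l1)\<^sup>2))
     (\<nu> * t / (cmod l1)\<^sup>2) (a * l1 * of_real t / (cnj l1 * l2)) (b * t / (cmod l2)\<^sup>2) (\<delta> / (cmod l1)\<^sup>2)"
    by (rule has_I_scale[OF b h l1 l(2,3)]) (use \<delta> in auto)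
  have "a * l1 * of_real t / (cnj l1 * l2) = of_real a'" using a' l1 l by (simp add: field_simps)
  with h' have "has_I \<omega>' (of_real \<epsilon>) (\<nu> * t) (of_real a') (b * t / (cmod l2)\<^sup>2) \<delta>"
    by (simp add: \<epsilon> l)
  then have "admits_equations br J (Eqs_I \<delta> \<epsilon> (\<nu> * t) a' (b * t / (cmod l2)\<^sup>2))"
    unfolding admits_equations_def using b' has_equations_I[OF b' \<delta>, THEN iffD2] by blast
  with v \<delta> show ?thesis by blast
qed

lemma exists_phase:
  fixes a :: complex and \<sigma> :: real
  assumes "\<sigma> \<in> {1, -1}"
  obtains l where "cmod l = 1" "a * l = of_real (\<sigma> * cmod a) * cnj l"
proof (cases "a = 0")
  case True then show thesis using that[of 1] by simp
next
  case False
  \<comment> \<open>A square root of the phase that turns \<open>a\<close> onto the real axis: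
    \<open>a * (l * l)\<close> has to be \<open>\<sigma> * cmod a\<close>.\<close>
  define l where "l = csqrt (of_real \<sigma> * cnj a / of_real (cmod a))"
  have l2: "l * l = of_real \<sigma> * cnj a / of_real (cmod a)"
    using power2_csqrt[of "of_real \<sigma> * cnj a / of_real (cmod a)"] by (simp add: l_def power2_eq_square)
  then have "cmod l * cmod l = 1"
    using False assms by (auto simp flip: norm_mult simp: norm_divide norm_mult)
  then have n: "cmod l = 1" by (metis norm_ge_zero square_eq_1_iff not_one_le_zero abs_neg_one
      abs_of_nonneg zero_neq_one neg_0_le_iff_le)
  then have ll: "l * cnj l = 1" by (simp flip: complex_norm_square)
  have "a * (l * l) = of_real \<sigma> * (a * cnj a) / of_real (cmod a)" by (simp add: l2)
  also have "\<dots> = of_real (\<sigma> * cmod a)" using False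
    by (simp flip: complex_norm_square add: power2_eq_square)
  finally have "a * (l * l) * cnj l = of_real (\<sigma> * cmod a) * cnj l" by simp
  then have "a * l = of_real (\<sigma> * cmod a) * cnj l" using ll by (simp add: mult.assoc)
  with n show thesis by (rule that)
qed

lemma listed_I:
  assumes b: "basis10 J \<omega>" and h: "has_I \<omega> k \<nu> a b \<delta>" and \<delta>: "\<delta> \<noteq> 0" and ab: "a \<noteq> 0 \<or> b \<noteq> 0"
  shows "\<exists>\<delta> \<epsilon> \<nu> a b. \<delta> \<in> {1, -1} \<and> (\<epsilon>, \<nu>, a, b) \<in> values_I \<and> admits_equations br J (Eqs_I \<delta> \<epsilon> \<nu> a b)"
proof -
  \<comment> \<open>Scaling \<open>\<omega> 1\<close> by \<open>s\<close> reduces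
    \<open>\<delta>\<close> to its sign; this factor of \<open>\<omega> 2\<close> then turns a
    nonzero \<open>k\<close> into 1.\<close>
  define l2 where "l2 = (if k = 0 then 1 else of_real \<bar>\<delta>\<bar> / k)"
  define \<epsilon> :: real where "\<epsilon> = (if k = 0 then 0 else 1)"
  define s where "s = complex_of_real (sqrt \<bar>\<delta>\<bar>)"
  have s: "s \<noteq> 0" "(cmod s)\<^sup>2 = \<bar>\<delta>\<bar>" using \<delta> by (auto simp: s_def)
  have l2: "l2 \<noteq> 0" using \<delta> by (simp add: l2_def)
  obtain \<omega>' where b': "basis10 J \<omega>'" and h': "has_I \<omega>' (k * l2 / of_real ((cmod s)\<^sup>2))
     (\<nu> * 1 / (cmod s)\<^sup>2) (a * s * of_real 1 / (cnj s * l2)) (b * 1 / (cmod l2)\<^sup>2) (\<delta> / (cmod s)\<^sup>2)"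
    by (rule has_I_scale[OF b h s(1) l2 _ \<delta>, of 1]) auto
  define \<nu>' where "\<nu>' = \<nu> * 1 / (cmod s)\<^sup>2"
  define a' where "a' = a * s * of_real 1 / (cnj s * l2)"
  define b'' where "b'' = b * 1 / (cmod l2)\<^sup>2"
  define \<delta>' where "\<delta>' = \<delta> / (cmod s)\<^sup>2"
  have k: "k * l2 / of_real ((cmod s)\<^sup>2) = of_real \<epsilon>" unfolding s(2) using \<delta> by (simp add: l2_def \<epsilon>_def)
  have h: "has_I \<omega>' (of_real \<epsilon>) \<nu>' a' b'' \<delta>'"
    using h' unfolding k \<nu>'_def a'_def b''_def \<delta>'_def .
  have d: "\<delta>' \<in> {1, -1}" unfolding \<delta>'_def s(2) using \<delta> by (auto simp: abs_if)
  have ab: "a' \<noteq> 0 \<or> b'' \<noteq> 0" using ab s(1) l2 by (simp add: a'_def b''_def)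
  note aux = listed_I_aux[OF b' h d]
  show ?thesis
  proof (cases "k = 0")
    case True
    then have \<epsilon>: "\<epsilon> = 0" by (simp add: \<epsilon>_def)
    consider "\<nu>' \<noteq> 0" "a' = 0" | "\<nu>' \<noteq> 0" "a' \<noteq> 0" | "\<nu>' = 0" "a' = 0" | "\<nu>' = 0" "a' \<noteq> 0" "b'' = 0"
      | "\<nu>' = 0" "a' \<noteq> 0" "b'' \<noteq> 0" by blast
    then show ?thesis
    proof cases
      case 1
      \<comment> \<open>Scaling \<open>\<omega> 2\<close> by the square root of
        \<open>\<bar>c\<bar>\<close> leaves only the sign of \<open>c\<close>.\<close>
      define c where "c = b'' / \<nu>'"
      have c: "c \<noteq> 0" using 1 ab by (simp add: c_def)
      have "(0, 1, 0, c / \<bar>c\<bar>) \<in> values_I" using c by (auto simp: values_I_def)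
      then show ?thesis using 1 c \<epsilon>
        by (intro aux[of 1 "of_real (sqrt \<bar>c\<bar>)" "1 / \<nu>'" 0]) (auto simp: c_def)
    next
      case 2
      have "(0, 1, 1, c) \<in> values_I" for c by (auto simp: values_I_def)
      then show ?thesis using 2 \<epsilon>
        by (intro aux[of 1 "a' / of_real \<nu>'" "1 / \<nu>'" 1]) auto
    next
      case 3
      have "(0, 0, 0, 1) \<in> values_I" by (auto simp: values_I_def)
      then show ?thesis using 3 \<epsilon> ab
        by (intro aux[of 1 1 "1 / b''" 0]) auto
    next
      case 4
      have "(0, 0, 1, 0) \<in> values_I" by (auto simp: values_I_def)
      then show ?thesis using 4 \<epsilon>
        by (intro aux[of 1 a' 1 1]) auto
    next
      case 5
      \<comment> \<open>With \<open>\<omega> 2\<close> scaled by \<open>a' * t\<close>, the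
        coefficient of \<open>hh \<omega> 1 2\<close> becomes 1 for every nonzero \<open>t\<close>;
        this choice also makes that of \<open>hh \<omega> 2 2\<close> equal to 1.\<close>
      define t where "t = b'' / (cmod a')\<^sup>2"
      have t: "t \<noteq> 0" using 5 by (simp add: t_def)
      have "b'' = t * (cmod a')\<^sup>2" using 5 by (simp add: t_def)
      then have bt: "b'' * t / (cmod (a' * of_real t))\<^sup>2 = 1"
        using t 5 by (simp add: norm_mult field_simps power2_eq_square)
      have "(0, 0, 1, 1) \<in> values_I" by (auto simp: values_I_def)
      then show ?thesis using 5 \<epsilon> t
        by (intro aux[of 1 "a' * of_real t" t 1]) (simp_all add: bt)
    qed
  next
    case False
    then have \<epsilon>: "\<epsilon> = 1" by (simp add: \<epsilon>_def)
    consider "\<nu>' \<noteq> 0" | "\<nu>' = 0" "a' = 0" | "\<nu>' = 0" "a' \<noteq> 0" by blast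
    then show ?thesis
    proof cases
      case 1
      \<comment> \<open>The scale of \<open>\<omega> 4\<close> must be \<open>1 / \<nu>'\<close>;
        its sign is compensated by the phase of \<open>\<omega> 1\<close>, which keeps the third
        parameter nonnegative.\<close>
      define \<sigma> where "\<sigma> = (if \<nu>' < 0 then -1 else 1 :: real)"
      obtain l where l: "cmod l = 1" "a' * l = of_real (\<sigma> * cmod a') * cnj l"
      proof (rule exists_phase[of \<sigma> a'])
        show "\<sigma> \<in> {1, -1}" by (simp add: \<sigma>_def)
      qed
      have eq: "\<sigma> * cmod a' / \<nu>' = \<bar>cmod a' / \<nu>'\<bar>"
        by (simp add: \<sigma>_def abs_divide abs_if[of \<nu>'])
      have "(1, 1, \<sigma> * cmod a' / \<nu>', b'' / \<nu>') \<in> values_I"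
        unfolding eq using ab 1 by (simp add: values_I_def)
      then show ?thesis using 1 \<epsilon> l
        by (intro aux[of l 1 "1 / \<nu>'" "\<sigma> * cmod a' / \<nu>'"]) simp_all
    next
      case 2
      have "(1, 0, 0, 1) \<in> values_I" by (auto simp: values_I_def)
      then show ?thesis using 2 \<epsilon> ab
        by (intro aux[of 1 1 "1 / b''" 0]) auto
    next
      case 3
      \<comment> \<open>Now the sign of the scale of \<open>\<omega> 4\<close> is free and serves to
        make the last parameter nonnegative.\<close>
      define \<sigma> where "\<sigma> = (if b'' < 0 then -1 else 1 :: real)"
      obtain l where l: "cmod l = 1" "a' * l = of_real (\<sigma> * cmod a') * cnj l"
      proof (rule exists_phase[of \<sigma> a'])
        show "\<sigma> \<in> {1, -1}" by (simp add: \<sigma>_def)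
      qed
      have eq: "b'' * (\<sigma> / cmod a') = \<bar>b'' / cmod a'\<bar>"
        by (simp add: \<sigma>_def abs_divide abs_if[of b''])
      have "(1, 0, 1, b'' * (\<sigma> / cmod a')) \<in> values_I"
        unfolding eq values_I_def by blast
      then show ?thesis using 3 \<epsilon> l
        by (intro aux[of l 1 "\<sigma> / cmod a'" 1]) (auto simp: \<sigma>_def)
    qed
  qed
qed

lemma listed_II_aux:
  assumes b: "basis10 J \<omega>" and h: "has_II \<omega> (of_real \<epsilon>) \<mu> \<nu> (of_real a) b"
    and v: "(\<epsilon>, \<mu>, \<nu>, a, b) \<in> values_II"
  shows "\<exists>\<epsilon> \<mu> \<nu> a b. (\<epsilon>, \<mu>, \<nu>, a, b) \<in> values_II \<and> admits_equations br J (Eqs_II \<epsilon> \<mu> \<nu> a b)"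
  unfolding admits_equations_def using b h v has_equations_II[OF b, THEN iffD2] by blast

lemma listed_II:
  assumes b: "basis10 J \<omega>" and h: "has_II \<omega> e \<mu> \<nu> a b" and em: "e \<noteq> 0 \<or> \<mu> \<noteq> 0" and \<nu>: "\<mu> \<noteq> 0 \<Longrightarrow> \<nu> = 0"
  shows "\<exists>\<epsilon> \<mu> \<nu> a b. (\<epsilon>, \<mu>, \<nu>, a, b) \<in> values_II \<and> admits_equations br J (Eqs_II \<epsilon> \<mu> \<nu> a b)"
proof (cases "e = 0")
  case False
  \<comment> \<open>Solves \<open>cnj l * l\<^sup>2 = e\<close>: the modulus of \<open>l\<close>
    must be the cube root of that of \<open>e\<close>, so \<open>e\<close> is divided by the cube
    root of its squared modulus.\<close>
  define c where "c = root 3 ((cmod e)\<^sup>2)"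
  have c: "c > 0" "c ^ 3 = (cmod e)\<^sup>2" using False by (simp_all add: c_def)
  define l where "l = e / of_real c"
  have l: "l \<noteq> 0" using False c by (simp add: l_def)
  have "cnj l * l\<^sup>2 * of_real (c ^ 3) = e * (e * cnj e)" using c(1)
    by (simp add: l_def field_simps power2_eq_square power3_eq_cube)
  also have "\<dots> = e * of_real (c ^ 3)" unfolding c(2) complex_norm_square ..
  finally have lE: "cnj l * l\<^sup>2 = e" using c(1) by simp
  \<comment> \<open>Once \<open>\<epsilon>\<close> is 1, a shift by half the imaginary part makes
    \<open>a\<close> real; the real scale \<open>t\<close> stays free for \<open>\<mu>\<close>,
    \<open>\<nu>\<close> or \<open>a\<close>.\<close>
  have red: "\<exists>\<omega>'. basis10 J \<omega>' \<and> has_II \<omega>' 1 (\<mu> / (t * (cmod l)\<^sup>2)) (\<nu> * t / (cmod l)\<^sup>2)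
     (of_real (Re (a * of_real t / (cnj l * of_real ((cmod l)\<^sup>2)))) )
     (b / (cmod l)\<^sup>2 - 2 * (\<mu> / (t * (cmod l)\<^sup>2)) * (Im (a * of_real t / (cnj l * of_real ((cmod l)\<^sup>2))) / 2))"
    if t: "t \<noteq> 0" for t
  proof -
    define A where "A = a * of_real t / (cnj l * of_real ((cmod l)\<^sup>2))"
    obtain \<omega>' where b': "basis10 J \<omega>'" and h': "has_II \<omega>' (e / (cnj l * l\<^sup>2)) (\<mu> / (t * (cmod l)\<^sup>2))
       (\<nu> * t / (cmod l)\<^sup>2) A (b / (cmod l)\<^sup>2)"
      using has_II_scale[OF b h l t] unfolding A_def by blast
    have e1: "e / (cnj l * l\<^sup>2) = 1" using lE False by simp
    obtain \<omega>'' where "basis10 J \<omega>''" "has_II \<omega>'' 1 (\<mu> / (t * (cmod l)\<^sup>2)) (\<nu> * t / (cmod l)\<^sup>2)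
        (A - 2 * \<i> * of_real (Im A / 2) * cnj 1) (b / (cmod l)\<^sup>2 - 2 * (\<mu> / (t * (cmod l)\<^sup>2)) * (Im A / 2))"
      using has_II_shift[OF b' h'[unfolded e1], of "Im A / 2"] by blast
    moreover have "A - 2 * \<i> * of_real (Im A / 2) * cnj 1 = of_real (Re A)"
      by (simp add: complex_eq_iff)
    ultimately show ?thesis unfolding A_def by auto
  qed
  have cl: "(cmod l)\<^sup>2 > 0" using l by simp
  consider "\<mu> \<noteq> 0" "\<nu> = 0" | "\<mu> = 0" "\<nu> \<noteq> 0" | "\<mu> = 0" "\<nu> = 0" using \<nu> by blast
  then show ?thesis
  proof cases
    case 1
    have t: "\<mu> / (cmod l)\<^sup>2 \<noteq> 0" using 1 l by simp
    have "(1, 1, 0, x, y) \<in> values_II" for x y by (auto simp: values_II_def)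
    moreover have "\<mu> / (\<mu> / (cmod l)\<^sup>2 * (cmod l)\<^sup>2) = 1" "\<nu> * (\<mu> / (cmod l)\<^sup>2) / (cmod l)\<^sup>2 = 0"
      using 1 l by simp_all
    ultimately show ?thesis using red[OF t] listed_II_aux[of _ 1 1 0] by (metis of_real_1)
  next
    case 2
    have t: "(cmod l)\<^sup>2 / \<nu> \<noteq> 0" using 2 l by simp
    have "(1, 0, 1, x, y) \<in> values_II" for x y by (auto simp: values_II_def)
    moreover have "\<mu> / ((cmod l)\<^sup>2 / \<nu> * (cmod l)\<^sup>2) = 0" "\<nu> * ((cmod l)\<^sup>2 / \<nu>) / (cmod l)\<^sup>2 = 1"
      using 2 l by simp_all
    ultimately show ?thesis using red[OF t] listed_II_aux[of _ 1 0 1] by (metis of_real_1)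
  next
    case 3
    obtain \<omega>' x y where b': "basis10 J \<omega>'" and h': "has_II \<omega>' 1 0 0 (of_real x) y"
      using red[of 1] 3 by auto
    show ?thesis
    proof (cases "x = 0")
      case True
      have "(1, 0, 0, 0, y) \<in> values_II" by (auto simp: values_II_def)
      then show ?thesis using listed_II_aux[OF b', of 1 0 0 0 y] h' True by simp
    next
      case False
      then have t: "1 / x \<noteq> 0" by simp
      obtain \<omega>'' where b'': "basis10 J \<omega>''" and h'': "has_II \<omega>'' (1 / (cnj 1 * 1\<^sup>2)) (0 / (1 / x * (cmod 1)\<^sup>2))
         (0 * (1 / x) / (cmod 1)\<^sup>2) (of_real x * of_real (1 / x) / (cnj 1 * of_real ((cmod 1)\<^sup>2))) (y / (cmod 1)\<^sup>2)"
        using has_II_scale[OF b' h' _ t, of 1] by auto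
      have "(1, 0, 0, 1, y) \<in> values_II" by (auto simp: values_II_def)
      then show ?thesis using listed_II_aux[OF b'', of 1 0 0 1 y] h'' False by simp
    qed
  qed
next
  case True
  with em have \<mu>: "\<mu> \<noteq> 0" "\<nu> = 0" using \<nu> by auto
  \<comment> \<open>With \<open>\<epsilon>\<close> zero the shift leaves \<open>a\<close> alone and
    can remove \<open>b\<close>.\<close>
  obtain \<omega>1 where b1: "basis10 J \<omega>1" and h1: "has_II \<omega>1 0 \<mu> 0 a 0"
    using has_II_shift[OF b h, of "b / (2 * \<mu>)"] \<mu> True by auto
  have red: "\<exists>\<omega>'. basis10 J \<omega>' \<and> has_II \<omega>' 0 1 0 (a * of_real \<mu> / (cnj l * (of_real ((cmod l)\<^sup>2))\<^sup>2)) 0"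
    if l: "l \<noteq> 0" for l
  proof -
    define t where "t = \<mu> / (cmod l)\<^sup>2"
    have t: "t \<noteq> 0" using l \<mu> by (simp add: t_def)
    obtain \<omega>' where b': "basis10 J \<omega>'" and h': "has_II \<omega>' (0 / (cnj l * l\<^sup>2)) (\<mu> / (t * (cmod l)\<^sup>2))
       (0 * t / (cmod l)\<^sup>2) (a * of_real t / (cnj l * of_real ((cmod l)\<^sup>2))) (0 / (cmod l)\<^sup>2)"
      by (rule has_II_scale[OF b1 h1 l t])
    have e: "0 / (cnj l * l\<^sup>2) = 0" "\<mu> / (t * (cmod l)\<^sup>2) = 1" "0 * t / (cmod l)\<^sup>2 = 0"
      "a * of_real t / (cnj l * of_real ((cmod l)\<^sup>2)) = a * of_real \<mu> / (cnj l * (of_real ((cmod l)\<^sup>2))\<^sup>2)"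
      "0 / (cmod l)\<^sup>2 = 0"
      using l \<mu> by (simp_all add: t_def power2_eq_square)
    show ?thesis using b' h'[unfolded e] by blast
  qed
  show ?thesis
  proof (cases "a = 0")
    case True
    have "(0, 1, 0, 0, 0) \<in> values_II" by (auto simp: values_II_def)
    then show ?thesis using red[of 1] True listed_II_aux[of _ 0 1 0 0 0] by auto
  next
    case False
    define z where "z = a * of_real \<mu>"
    have z: "z \<noteq> 0" using False \<mu> by (simp add: z_def)
    \<comment> \<open>Solves \<open>cnj l * (cmod l) ^ 4 = z\<close>: the modulus of
      \<open>l\<close> must be the fifth root of that of \<open>z\<close>.\<close>
    define c where "c = root 5 ((cmod z) ^ 4)"
    have c: "c > 0" "c ^ 5 = (cmod z) ^ 4" using z by (simp_all add: c_def)
    define l where "l = cnj z / of_real c"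
    have "((cmod l)\<^sup>2)\<^sup>2 = cmod z ^ 4 / c ^ 4"
      using c(1) by (simp add: l_def norm_divide power_divide flip: power_mult)
    also have "\<dots> = c ^ 5 / c ^ 4" unfolding c(2) ..
    also have "\<dots> = c" using c(1) by (simp add: power_diff[symmetric])
    finally have "(complex_of_real ((cmod l)\<^sup>2))\<^sup>2 = of_real c" by (metis of_real_power)
    then have "cnj l * (of_real ((cmod l)\<^sup>2))\<^sup>2 = z" using c(1) by (simp add: l_def)
    moreover have "l \<noteq> 0" using z c by (simp add: l_def)
    ultimately have "\<exists>\<omega>'. basis10 J \<omega>' \<and> has_II \<omega>' 0 1 0 1 0"
      using red[of l] z by (simp flip: z_def)
    moreover have "(0, 1, 0, 1, 0) \<in> values_II" by (auto simp: values_II_def)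
    ultimately show ?thesis using listed_II_aux[of _ 0 1 0 1 0] by auto
  qed
qed

end

section \<open>Uniqueness of the parameters\<close>

context complex_lie8 begin

lemma dualD:
  assumes "dual \<omega> e"
  shows "\<omega> 1 (e 1) = 1" "\<omega> 2 (e 1) = 0" "\<omega> 3 (e 1) = 0" "\<omega> 4 (e 1) = 0"
    "\<omega> 1 (e 2) = 0" "\<omega> 2 (e 2) = 1" "\<omega> 3 (e 2) = 0" "\<omega> 4 (e 2) = 0"
    "\<omega> 1 (e 3) = 0" "\<omega> 2 (e 3) = 0" "\<omega> 3 (e 3) = 1" "\<omega> 4 (e 3) = 0"
    "\<omega> 1 (e 4) = 0" "\<omega> 2 (e 4) = 0" "\<omega> 3 (e 4) = 0" "\<omega> 4 (e 4) = 1"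
    "\<omega> 1 \<in> forms10 J" "\<omega> 2 \<in> forms10 J" "\<omega> 3 \<in> forms10 J" "\<omega> 4 \<in> forms10 J"
  using assms unfolding dual_def ball_1_4 by simp_all

lemma dual_expand:
  assumes "dual \<omega> e"
  shows "X = \<omega> 1 X \<odot> e 1 + \<omega> 2 X \<odot> e 2 + \<omega> 3 X \<odot> e 3 + \<omega> 4 X \<odot> e 4"
  using assms unfolding dual_def by blast

lemma dual_expand_form:
  assumes "dual \<omega> e" "\<alpha> \<in> forms10 J"
  shows "\<alpha> X = \<omega> 1 X * \<alpha> (e 1) + \<omega> 2 X * \<alpha> (e 2) + \<omega> 3 X * \<alpha> (e 3) + \<omega> 4 X * \<alpha> (e 4)"
  by (subst dual_expand[OF assms(1), of X]) (simp add: form10[OF assms(2)])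

lemma dual_eq_0:
  assumes "dual \<omega> e" "\<omega> 1 X = 0" "\<omega> 2 X = 0" "\<omega> 3 X = 0" "\<omega> 4 X = 0"
  shows "X = 0"
  using dual_expand[OF assms(1), of X] assms(2-) by simp

text \<open>In Family I the values of \<open>P\<close> lie on one complex line. In Family II
  \<open>P (e' 4) (e' 1)\<close> has a component along \<open>e' 2\<close>, while another value is a
  nonzero multiple of \<open>e' 3\<close>.\<close>

lemma I_not_II:
  assumes b: "basis10 J \<omega>" and b': "basis10 J \<omega>'"
    and h: "has_I \<omega> k \<nu> a b \<delta>" and h': "has_II \<omega>' \<epsilon> \<mu> \<nu>' a' b'" and em: "\<epsilon> \<noteq> 0 \<or> \<mu> \<noteq> 0"
  shows False
proof -
  obtain e e' where d: "dual \<omega> e" and d': "dual \<omega>' e'" using b b' basis10_dual by meson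
  note w = dualD[OF d] and w' = dualD[OF d'] and h = has_ID[OF h] and h' = has_IID[OF h']
  have x: "\<omega>' 2 (P X Y) = \<omega> 3 (P X Y) * \<omega>' 2 (e 3)" "\<omega>' 3 (P X Y) = \<omega> 3 (P X Y) * \<omega>' 3 (e 3)" for X Y
    using dual_expand_form[OF d, of "\<omega>' 2" "P X Y"] dual_expand_form[OF d, of "\<omega>' 3" "P X Y"] w'
    by (simp_all add: h(1,2,4))
  have 1: "\<omega>' 2 (e 3) \<noteq> 0" using x(1)[of "e' 4" "e' 1"] by (auto simp: h'(2) w')
  have "\<omega> 3 (P (e' 2) (e' 1)) = 0" using x(1)[of "e' 2" "e' 1"] 1 by (simp add: h'(2) w')
  then have "\<epsilon> = 0" using x(2)[of "e' 2" "e' 1"] by (simp add: h'(3) w')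
  moreover have "\<omega> 3 (P (e' 4) (e' 2)) = 0" using x(1)[of "e' 4" "e' 2"] 1 by (simp add: h'(2) w')
  then have "\<mu> = 0" using x(2)[of "e' 4" "e' 2"] by (simp add: h'(3) w')
  ultimately show False using em by simp
qed

lemma cnj_mult_self: "cnj z * z = of_real ((cmod z)\<^sup>2)"
  by (simp only: complex_norm_square mult.commute)

text \<open>Every \<open>R X\<close> annihilates \<open>e 4\<close>, and this forces
  \<open>e 4\<close> to be a multiple of \<open>e' 4\<close>. The other entries of the transition
  matrix follow by applying \<open>P\<close> and \<open>R\<close> to it.\<close>

lemma I_transition:
  assumes b: "basis10 J \<omega>" and b': "basis10 J \<omega>'"
    and h: "has_I \<omega> (of_real \<epsilon>) \<nu> a b \<delta>" and h': "has_I \<omega>' (of_real \<epsilon>') \<nu>' a' b' \<delta>'"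
    and \<delta>: "\<delta> \<in> {1, -1}" "\<delta>' \<in> {1, -1}" and ab: "a' \<noteq> 0 \<or> b' \<noteq> 0"
  obtains t c where "\<delta>' = \<delta>" "t \<noteq> 0" "c \<noteq> 0" "\<nu>' = \<nu> * t" "of_real \<epsilon>' = c * of_real \<epsilon>"
    "cmod a' * cmod c = cmod a * \<bar>t\<bar>" "b' * (cmod c)\<^sup>2 = b * t"
proof -
  obtain e e' where d: "dual \<omega> e" and d': "dual \<omega>' e'" using b b' basis10_dual by meson
  note w = dualD[OF d] and w' = dualD[OF d'] and h = has_ID[OF h] and h' = has_ID[OF h']
  have d0: "\<delta> \<noteq> 0" "\<delta>' \<noteq> 0" using \<delta> by auto
  note f = w'(17)[THEN dual_expand_form[OF d]] w'(18)[THEN dual_expand_form[OF d]]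
    w'(19)[THEN dual_expand_form[OF d]] w'(20)[THEN dual_expand_form[OF d]]
  have R4: "R X (e 4) = 0" for X
    by (rule dual_eq_0[OF d]) (simp_all add: h w)
  have R4': "\<omega>' k (R X (e 4)) = 0" if "\<omega>' k \<in> forms10 J" for k X by (simp add: R4 form10[OF that])
  have m14: "\<omega>' 1 (e 4) = 0" using R4'[of 3 "e' 4"] by (simp add: h' w')
  have "a' * \<omega>' 2 (e 4) = 0" using R4'[of 3 "e' 1"] by (simp add: h' w')
  moreover have "b' * \<omega>' 2 (e 4) = 0" using R4'[of 4 "e' 2"] m14 by (simp add: h' w')
  ultimately have m24: "\<omega>' 2 (e 4) = 0" using ab by auto
  have m34: "\<omega>' 3 (e 4) = 0" using R4'[of 4 "e' 1"] m14 d0 by (simp add: h' w')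
  define t where "t = \<omega>' 4 (e 4)"
  have t0: "t \<noteq> 0"
  proof
    assume "t = 0"
    then have "e 4 = 0" using m14 m24 m34 by (intro dual_eq_0[OF d']) (simp_all add: t_def)
    then show False using w(16) form10(5)[OF w(20)] by simp
  qed
  \<comment> \<open>Both \<open>P (e 4) (e 1)\<close> and \<open>R (e 4) (e 1)\<close> are
    \<open>e 3\<close>, but the former is linear and the latter antilinear in \<open>e 4\<close>;
    comparing them gives \<open>cnj t = t\<close>.\<close>
  have m3: "\<omega>' 1 (e 3) = 0" "\<omega>' 2 (e 3) = 0" "\<omega>' 3 (e 3) = t * \<omega>' 1 (e 1)" "\<omega>' 4 (e 3) = 0"
    using f[of "P (e 4) (e 1)"] m14 by (simp_all add: h h' w t_def)
  have m33': "\<omega>' 3 (e 3) = cnj t * \<omega>' 1 (e 1)"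
    using f(3)[of "R (e 4) (e 1)"] m14 m24 by (simp add: h h' w t_def)
  have m12: "\<omega>' 1 (e 2) = 0"
    using f(3)[of "R (e 4) (e 2)"] m14 m24 t0 by (simp add: h h' w t_def)
  have m11: "\<omega>' 1 (e 1) \<noteq> 0"
    using f(1)[of "e' 1"] m14 m12 m3 by (auto simp: w')
  have tr: "cnj t = t" using m3(3) m33' m11 by simp
  define r where "r = Re t"
  have t: "t = of_real r" using tr by (simp add: r_def complex_eq_iff)
  have r0: "r \<noteq> 0" using t0 t by simp
  have m42: "\<omega>' 4 (e 2) = 0"
    using f(3)[of "P (e 1) (e 2)"] m12 m11 by (simp add: h h' w)
  define c where "c = \<omega>' 2 (e 2)"
  have c0: "c \<noteq> 0"
  proof
    assume c: "c = 0"
    \<comment> \<open>With \<open>c = 0\<close>, \<open>e 2\<close> would be a complex multiple of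
      \<open>e 3\<close>.\<close>
    let ?v = "e 2 - (\<omega>' 3 (e 2) / \<omega>' 3 (e 3)) \<odot> e 3"
    have "?v = 0"
      by (rule dual_eq_0[OF d'])
        (use c m12 m42 m3 t0 m11 in \<open>simp_all add: w'(17-20)[THEN form10(3)] w'(17-20)[THEN form10(8)] c_def\<close>)
    then have "\<omega> 2 ?v = 0" by (simp add: form10[OF w(18)])
    then show False by (simp add: w'(18) form10[OF w(18)] w)
  qed
  let ?l = "\<omega>' 1 (e 1)"
  \<comment> \<open>Two signs that differ by a nonnegative factor are equal, and the factor is
    1.\<close>
  have "\<delta>' * (cmod ?l)\<^sup>2 = \<delta>"
  proof -
    have "\<i> * of_real \<delta>' * (cnj ?l * ?l) * t = \<i> * of_real \<delta> * t"
      using f(4)[of "R (e 1) (e 3)"] m3 by (simp add: h h' w t_def)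
    then have "of_real (\<delta>' * (cmod ?l)\<^sup>2) = complex_of_real \<delta>"
      using t0 unfolding cnj_mult_self by simp
    then show ?thesis by (simp only: of_real_eq_iff)
  qed
  moreover have n1: "(cmod ?l)\<^sup>2 \<noteq> -1" by (smt (verit) zero_le_power2)
  ultimately have \<delta>\<delta>: "\<delta>' = \<delta>" and l: "(cmod ?l)\<^sup>2 = 1"
    using \<delta> n1 by auto
  have l1: "cmod ?l = 1" using arg_cong[OF l, of sqrt] by simp
  have ll: "cnj ?l * ?l = 1" unfolding cnj_mult_self l by simp
  have e1: "of_real \<epsilon>' = c * of_real \<epsilon>"
    using f(2)[of "R (e 1) (e 1)"] m24 ll by (simp add: h h' w c_def)
  have "\<i> * of_real \<nu>' * (cnj ?l * ?l) + of_real b' * (cnj (\<omega>' 2 (e 1)) * \<omega>' 2 (e 1))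
       + \<i> * of_real \<delta>' * (cnj (\<omega>' 3 (e 1)) * ?l - cnj ?l * \<omega>' 3 (e 1)) = \<i> * of_real \<nu> * t"
    using f(4)[of "R (e 1) (e 1)"] m42 by (simp add: h h' w t_def)
  then have "\<i> * of_real \<nu>' + of_real (b' * (cmod (\<omega>' 2 (e 1)))\<^sup>2)
       + \<i> * of_real \<delta>' * (cnj (\<omega>' 3 (e 1)) * ?l - cnj ?l * \<omega>' 3 (e 1)) = \<i> * of_real \<nu> * of_real r"
    unfolding cnj_mult_self[of "\<omega>' 2 (e 1)"] ll t by simp
  \<comment> \<open>The term with \<open>b'\<close> is real, and so is the one with
    \<open>\<delta>'\<close>, being \<open>\<i>\<close> times a difference of conjugates. The
    imaginary part isolates \<open>\<nu>'\<close>.\<close>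
  from arg_cong[OF this, of Im] have \<nu>: "\<nu>' = \<nu> * r" by simp
  have "of_real b' * (cnj c * c) = of_real b * t"
    using f(4)[of "R (e 2) (e 2)"] m12 by (simp add: h h' w t_def c_def)
  then have "complex_of_real (b' * (cmod c)\<^sup>2) = of_real (b * r)" unfolding cnj_mult_self t by simp
  then have bb: "b' * (cmod c)\<^sup>2 = b * r" by (simp only: of_real_eq_iff)
  have "a' * (cnj ?l * c) = a * (t * ?l)"
    using f(3)[of "R (e 1) (e 2)"] m12 m3 by (simp add: h h' w c_def)
  then have "cmod (a' * (cnj ?l * c)) = cmod (a * (t * ?l))" by simp
  then have "cmod a' * cmod c = cmod a * \<bar>r\<bar>" by (simp add: norm_mult l1 t)
  with \<delta>\<delta> r0 c0 \<nu> e1 bb show thesis by (intro that)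
qed

text \<open>Parameters confined to 0 and 1 cannot change under nonzero scales, and they pin these
  down: \<open>\<nu> = 1\<close> gives \<open>t = 1\<close>, and \<open>\<epsilon> = 1\<close> gives
  modulus 1 for \<open>c\<close>. In the other cases the list of values has fixed the remaining
  freedom.\<close>

lemma unique_I:
  assumes b: "basis10 J \<omega>" and b': "basis10 J \<omega>'" and \<delta>: "\<delta> \<in> {1, -1}" "\<delta>' \<in> {1, -1}"
    and h: "has_I \<omega> (of_real \<epsilon>) \<nu> (of_real a) b \<delta>" and h': "has_I \<omega>' (of_real \<epsilon>') \<nu>' (of_real a') b' \<delta>'"
    and v: "(\<epsilon>, \<nu>, a, b) \<in> values_I" "(\<epsilon>', \<nu>', a', b') \<in> values_I"
  shows "\<delta>' = \<delta> \<and> \<epsilon>' = \<epsilon> \<and> \<nu>' = \<nu> \<and> a' = a \<and> b' = b"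
proof -
  have "complex_of_real a' \<noteq> 0 \<or> b' \<noteq> 0" using v(2) by (auto simp: values_I_def)
  then obtain t c where tc: "\<delta>' = \<delta>" "t \<noteq> 0" "c \<noteq> 0" and \<nu>: "\<nu>' = \<nu> * t" and \<epsilon>: "of_real \<epsilon>' = c * complex_of_real \<epsilon>"
    and aa: "cmod (of_real a') * cmod c = cmod (of_real a) * \<bar>t\<bar>" and bb: "b' * (cmod c)\<^sup>2 = b * t"
    by (rule I_transition[OF b b' h h' \<delta>])
  define n where "n = cmod c"
  have n: "n > 0" using tc by (simp add: n_def)
  have "cmod (of_real \<epsilon>') = cmod (c * complex_of_real \<epsilon>)" by (simp only: \<epsilon>)
  then have \<epsilon>n: "\<bar>\<epsilon>'\<bar> = n * \<bar>\<epsilon>\<bar>" by (simp add: norm_mult n_def)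
  have aa: "\<bar>a'\<bar> * n = \<bar>a\<bar> * \<bar>t\<bar>" and bb: "b' * n\<^sup>2 = b * t" using aa bb by (simp_all add: n_def)
  have range: "\<epsilon> \<in> {0,1}" "\<epsilon>' \<in> {0,1}" "\<nu> \<in> {0,1}" "\<nu>' \<in> {0,1}" "a \<ge> 0" "a' \<ge> 0"
    using v by (auto simp: values_I_def)
  have "\<epsilon>' = \<epsilon>" and n1: "\<epsilon> = 1 \<Longrightarrow> n = 1" using range \<epsilon>n n by auto
  have "\<nu>' = \<nu>" and t1: "\<nu> = 1 \<Longrightarrow> t = 1" using range \<nu> tc by auto
  have a0: "a' = 0 \<longleftrightarrow> a = 0" using aa n tc by auto
  have b0: "b' = 0 \<longleftrightarrow> b = 0" using bb n tc by (metis mult_eq_0_iff not_less_iff_gr_or_eq power_eq_0_iff)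
  have "a' = a \<and> b' = b"
  proof (cases "\<nu> = 1")
    case True
    then have t: "t = 1" by (rule t1)
    show ?thesis
    proof (cases "\<epsilon> = 1")
      case True then show ?thesis using n1 t aa bb range by auto
    next
      case False
      then have e: "\<epsilon> = 0" "\<epsilon>' = 0" "\<nu> = 1" "\<nu>' = 1" using range \<open>\<epsilon>' = \<epsilon>\<close> \<open>\<nu>' = \<nu>\<close> \<open>\<nu> = 1\<close> by auto
      show ?thesis
      proof (cases "a = 0")
        case True
        then obtain x y :: real where xy: "x \<noteq> 0" "b = x / \<bar>x\<bar>" "y \<noteq> 0" "b' = y / \<bar>y\<bar>"
          using v a0 e by (auto simp: values_I_def)
        then have pm: "b \<in> {1, -1}" "b' \<in> {1, -1}" by (auto simp: abs_if)
        have "b' * n\<^sup>2 = b" using bb t by simp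
        then have "b' > 0 \<longleftrightarrow> b > 0" using n by (metis zero_less_mult_pos2 zero_less_power mult_pos_pos)
        then show ?thesis using pm True a0 by auto
      next
        case False
        then have "a = 1" "a' = 1" using v a0 e by (auto simp: values_I_def)
        then show ?thesis using aa bb t n by auto
      qed
    qed
  next
    case False
    then have e: "\<nu> = 0" "\<nu>' = 0" using range \<open>\<nu>' = \<nu>\<close> by auto
    show ?thesis
    proof (cases "\<epsilon> = 1")
      case True
      then have ee: "\<epsilon> = 1" "\<epsilon>' = 1" "n = 1" using \<open>\<epsilon>' = \<epsilon>\<close> n1 by auto
      show ?thesis
      proof (cases "a = 0")
        case True
        then show ?thesis using v a0 e ee by (auto simp: values_I_def)
      next
        case False
        then have a: "a = 1" "a' = 1" and "b \<ge> 0" "b' \<ge> 0" using v a0 e ee by (auto simp: values_I_def)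
        moreover have "\<bar>t\<bar> = 1" using aa a ee by simp
        moreover have "b' = b * t" using bb ee by simp
        ultimately show ?thesis
          by (metis abs_mult abs_of_nonneg mult.right_neutral)
      qed
    next
      case False
      then have ee: "\<epsilon> = 0" "\<epsilon>' = 0" using range \<open>\<epsilon>' = \<epsilon>\<close> by auto
      then show ?thesis using v a0 b0 e by (auto simp: values_I_def)
    qed
  qed
  with tc(1) \<open>\<epsilon>' = \<epsilon>\<close> \<open>\<nu>' = \<nu>\<close> show ?thesis by simp
qed

text \<open>Again \<open>e 4\<close> is determined up to a real factor. The vector
  \<open>e 2\<close> is both \<open>P (e 4) (e 1)\<close> and \<open>R (e 4) (e 1)\<close>, and
  \<open>e 3\<close> is reached through whichever of \<open>\<epsilon>\<close> and
  \<open>\<mu>\<close> is nonzero.\<close>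

lemma unique_II:
  assumes b: "basis10 J \<omega>" and b': "basis10 J \<omega>'"
    and h: "has_II \<omega> (of_real \<epsilon>) \<mu> \<nu> (of_real a) b" and h': "has_II \<omega>' (of_real \<epsilon>') \<mu>' \<nu>' (of_real a') b'"
    and v: "(\<epsilon>, \<mu>, \<nu>, a, b) \<in> values_II" "(\<epsilon>', \<mu>', \<nu>', a', b') \<in> values_II"
  shows "\<epsilon>' = \<epsilon> \<and> \<mu>' = \<mu> \<and> \<nu>' = \<nu> \<and> a' = a \<and> b' = b"
proof -
  obtain e e' where d: "dual \<omega> e" and d': "dual \<omega>' e'" using b b' basis10_dual by meson
  note w = dualD[OF d] and w' = dualD[OF d'] and h = has_IID[OF h] and h' = has_IID[OF h']
  have em: "\<epsilon> \<noteq> 0 \<or> \<mu> \<noteq> 0" "\<epsilon>' \<noteq> 0 \<or> \<mu>' \<noteq> 0" using v by (auto simp: values_II_def)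
  note f = w'(17)[THEN dual_expand_form[OF d]] w'(18)[THEN dual_expand_form[OF d]]
    w'(19)[THEN dual_expand_form[OF d]] w'(20)[THEN dual_expand_form[OF d]]
  have R4: "R X (e 4) = 0" for X
    by (rule dual_eq_0[OF d]) (simp_all add: h w)
  have R4': "\<omega>' k (R X (e 4)) = 0" if "\<omega>' k \<in> forms10 J" for k X by (simp add: R4 form10[OF that])
  have m14: "\<omega>' 1 (e 4) = 0" using R4'[of 2 "e' 4"] by (simp add: h' w')
  have "of_real \<epsilon>' * \<omega>' 2 (e 4) = 0" using R4'[of 3 "e' 1"] m14 by (simp add: h' w')
  moreover have "of_real \<mu>' * \<omega>' 2 (e 4) = 0" using R4'[of 3 "e' 4"] m14 by (simp add: h' w')
  ultimately have m24: "\<omega>' 2 (e 4) = 0" using em by auto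
  have m34: "\<omega>' 3 (e 4) = 0" using R4'[of 4 "e' 1"] m14 m24 by (simp add: h' w')
  define t where "t = \<omega>' 4 (e 4)"
  let ?l = "\<omega>' 1 (e 1)"
  have t0: "t \<noteq> 0"
  proof
    assume "t = 0"
    then have "e 4 = 0" using m14 m24 m34 by (intro dual_eq_0[OF d']) (simp_all add: t_def)
    then show False using w(16) form10(5)[OF w(20)] by simp
  qed
  have m2: "\<omega>' 1 (e 2) = 0" "\<omega>' 2 (e 2) = cnj t * ?l"
    "\<omega>' 3 (e 2) = \<i> * of_real \<mu>' * (cnj t * \<omega>' 2 (e 1))" "\<omega>' 4 (e 2) = 0"
    using f[of "R (e 4) (e 1)"] m14 m24 m34 by (simp_all add: h h' w t_def)
  have m22': "\<omega>' 2 (e 2) = t * ?l"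
    using f(2)[of "P (e 4) (e 1)"] m14 by (simp add: h h' w t_def)
  have m13: "\<omega>' 1 (e 3) = 0"
    using f(2)[of "R (e 4) (e 3)"] m14 m24 t0 by (simp add: h h' w t_def)
  have m11: "?l \<noteq> 0" using f(1)[of "e' 1"] m14 m2 m13 by (auto simp: w')
  have "cnj t = t" using m2(2) m22' m11 by simp
  define r where "r = Re t"
  have t: "t = of_real r" using \<open>cnj t = t\<close> by (simp add: r_def complex_eq_iff)
  have r0: "r \<noteq> 0" using t0 t by simp
  have "of_real \<mu> * \<omega>' 2 (e 3) = 0"
    using f(2)[of "R (e 4) (e 2)"] m2 m14 m24 by (simp add: h h' w)
  moreover have "of_real \<epsilon> * \<omega>' 2 (e 3) = 0"
    using f(2)[of "P (e 2) (e 1)"] m2 by (simp add: h h' w)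
  ultimately have m23: "\<omega>' 2 (e 3) = 0" using em by auto
  have "of_real \<mu> * \<omega>' 4 (e 3) = 0"
    using f(4)[of "R (e 4) (e 2)"] m14 m24 m34 by (simp add: h h' w)
  moreover have "of_real \<epsilon> * \<omega>' 4 (e 3) = 0"
    using f(4)[of "P (e 2) (e 1)"] by (simp add: h h' w)
  ultimately have m43: "\<omega>' 4 (e 3) = 0" using em by auto
  have m33: "cnj ?l * \<omega>' 3 (e 3) = t"
    using f(4)[of "R (e 1) (e 3)"] m13 m23 by (simp add: h h' w t_def)
  have m41: "\<omega>' 4 (e 1) = 0"
    using f(2)[of "R (e 1) (e 1)"] m24 m23 m11 by (simp add: h h' w)
  have "\<i> * of_real \<mu> * \<omega>' 3 (e 3) = \<i> * of_real \<mu>' * cnj t * \<omega>' 2 (e 2)"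
    using f(3)[of "R (e 4) (e 2)"] m14 m24 m34 by (simp add: h h' w t_def)
  then have "of_real \<mu> * (cnj ?l * \<omega>' 3 (e 3)) = of_real \<mu>' * t * t * (cnj ?l * ?l)"
    using m22' \<open>cnj t = t\<close> by simp
  then have "complex_of_real \<mu> = of_real (\<mu>' * r * (cmod ?l)\<^sup>2)"
    unfolding m33 cnj_mult_self using t0 by (simp add: t)
  then have \<mu>: "\<mu> = \<mu>' * r * (cmod ?l)\<^sup>2" by (simp only: of_real_eq_iff)
  have "of_real \<epsilon> * \<omega>' 3 (e 3) = of_real \<epsilon>' * (t * ?l * ?l)"
    using f(3)[of "P (e 2) (e 1)"] m2(1,4) m41 m22' by (simp add: h h' w)
  then have "of_real \<epsilon> * (cnj ?l * \<omega>' 3 (e 3)) = of_real \<epsilon>' * t * (cnj ?l * ?l * ?l)" by simp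
  then have \<epsilon>: "of_real \<epsilon> = of_real \<epsilon>' * (cnj ?l * ?l * ?l)" unfolding m33 using t0 by simp
  define u where "u = cnj ?l * \<omega>' 2 (e 1)"
  have cu: "cnj (\<omega>' 2 (e 1)) * ?l = cnj u" by (simp add: u_def)
  have "of_real a' * (cnj ?l * ?l) + of_real \<epsilon>' * (cnj (\<omega>' 2 (e 1)) * ?l - cnj ?l * \<omega>' 2 (e 1)) = of_real a * \<omega>' 3 (e 3)"
    using f(3)[of "R (e 1) (e 1)"] m34 m41 by (simp add: h h' w)
  then have a: "of_real a' * (cnj ?l * ?l) + of_real \<epsilon>' * (cnj u - u) = of_real a * \<omega>' 3 (e 3)"
    unfolding cu by (simp add: u_def)
  have "\<i> * of_real \<nu>' * (cnj ?l * ?l) - of_real \<mu>' * (cnj (\<omega>' 2 (e 1)) * \<omega>' 2 (e 1))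
      + \<i> * of_real b' * (cnj (\<omega>' 2 (e 1)) * ?l - cnj ?l * \<omega>' 2 (e 1))
      + \<i> * (cnj (\<omega>' 3 (e 1)) * ?l - cnj ?l * \<omega>' 3 (e 1)) = \<i> * of_real \<nu> * of_real r"
    using f(4)[of "R (e 1) (e 1)"] m43 by (simp add: h h' w flip: t t_def)
  then have "\<i> * of_real \<nu>' * of_real ((cmod ?l)\<^sup>2) - of_real \<mu>' * of_real ((cmod (\<omega>' 2 (e 1)))\<^sup>2)
      + \<i> * of_real b' * (cnj u - u)
      + \<i> * (cnj (\<omega>' 3 (e 1)) * ?l - cnj ?l * \<omega>' 3 (e 1)) = \<i> * of_real \<nu> * of_real r"
    unfolding cnj_mult_self cu by (simp add: u_def)
  \<comment> \<open>Apart from the two terms with \<open>\<nu>'\<close> and \<open>\<nu>\<close>,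
    everything is real.\<close>
  from arg_cong[OF this, of Im] have \<nu>: "\<nu>' * (cmod ?l)\<^sup>2 = \<nu> * r" by simp
  have "- of_real \<mu>' * (cnj (\<omega>' 2 (e 1)) * \<omega>' 2 (e 2)) - \<i> * of_real b' * (cnj ?l * \<omega>' 2 (e 2))
      - \<i> * (cnj ?l * \<omega>' 3 (e 2)) = - \<i> * of_real b * t"
    using f(4)[of "R (e 1) (e 2)"] m43 m2(1) by (simp add: h h' w t_def)
  then have "(- of_real \<mu>' * (cnj (\<omega>' 2 (e 1)) * ?l) - \<i> * of_real b' * (cnj ?l * ?l)
      + of_real \<mu>' * u) * t = (- \<i> * of_real b) * t"
    unfolding m22' m2(3) \<open>cnj t = t\<close> by (simp add: u_def algebra_simps)
  then have "- of_real \<mu>' * cnj u - \<i> * of_real b' * of_real ((cmod ?l)\<^sup>2) + of_real \<mu>' * u = - \<i> * of_real b"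
    unfolding cu cnj_mult_self by (simp only: mult_right_cancel[OF t0])
  from arg_cong[OF this, of Im] have bb: "b = b' * (cmod ?l)\<^sup>2 - 2 * \<mu>' * Im u" by simp
  have cl: "(cmod ?l)\<^sup>2 > 0" using m11 by simp
  have "cmod (of_real \<epsilon>) = cmod (of_real \<epsilon>' * (cnj ?l * ?l * ?l))" by (simp only: \<epsilon>)
  then have \<epsilon>n: "\<bar>\<epsilon>\<bar> = \<bar>\<epsilon>'\<bar> * cmod ?l ^ 3" by (simp add: norm_mult power3_eq_cube)
  have range: "\<epsilon> \<in> {0,1}" "\<epsilon>' \<in> {0,1}" "\<mu> \<in> {0,1}" "\<mu>' \<in> {0,1}" "\<nu> \<in> {0,1}" "\<nu>' \<in> {0,1}"
    using v by (auto simp: values_II_def)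
  have \<epsilon>\<epsilon>: "\<epsilon>' = \<epsilon>" using range \<epsilon>n m11 by auto
  have \<mu>\<mu>: "\<mu>' = \<mu>" using range \<mu> r0 cl by auto
  have \<nu>\<nu>: "\<nu>' = \<nu>" using range \<nu> r0 cl by auto
  have "a' = a \<and> b' = b"
  proof (cases "\<epsilon> = 1")
    case True
    then have e1: "\<epsilon> = 1" "\<epsilon>' = 1" using \<epsilon>\<epsilon> by auto
    have "cmod ?l ^ 3 = 1" using \<epsilon>n e1 by simp
    \<comment> \<open>Knowing the modulus gives \<open>cnj ?l * ?l = 1\<close>, and the relation for
      \<open>\<epsilon>\<close> then reduces to \<open>?l = 1\<close>.\<close>
    then have l1: "cmod ?l = 1" using power_eq_imp_eq_base[of "cmod ?l" 3 1] by simp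
    then have ll: "cnj ?l * ?l = 1" unfolding cnj_mult_self by simp
    then have l: "?l = 1" using \<epsilon> e1 by simp
    then have "\<omega>' 3 (e 3) = of_real r" using m33 t by simp
    then have a: "of_real a' + (cnj u - u) = complex_of_real (a * r)" using a ll e1 by simp
    \<comment> \<open>Since \<open>cnj u - u\<close> is imaginary, the real part compares
      \<open>a'\<close> with \<open>a\<close>, and the imaginary part gives \<open>Im u = 0\<close>,
      which removes the correction in the relation for \<open>b\<close>.\<close>
    from arg_cong[OF this, of Re] arg_cong[OF this, of Im] have a: "a' = a * r" and "Im u = 0" by simp_all
    then have b: "b' = b" using bb l1 by simp
    have \<mu>: "\<mu> = \<mu> * r" and \<nu>: "\<nu> = \<nu> * r" using \<mu> \<nu> \<mu>\<mu> \<nu>\<nu> l1 by auto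
    show ?thesis
    proof (cases "\<mu> = 0 \<and> \<nu> = 0")
      case True
      \<comment> \<open>Here nothing fixes \<open>r\<close>, but \<open>a\<close> and
        \<open>a'\<close> are 0 or 1 and differ by the nonzero factor \<open>r\<close>.\<close>
      then have "a \<in> {0, 1}" "a' \<in> {0, 1}" using v e1 \<mu>\<mu> \<nu>\<nu> by (auto simp: values_II_def)
      then show ?thesis using a b r0 by auto
    next
      case False
      then have "r = 1" using \<mu> \<nu> range by auto
      then show ?thesis using a b by simp
    qed
  next
    case False
    then have e0: "\<epsilon> = 0" "\<epsilon>' = 0" using range \<epsilon>\<epsilon> by auto
    have m330: "\<omega>' 3 (e 3) \<noteq> 0" using m33 t0 by auto
    have "a' = 0 \<longleftrightarrow> a = 0" using a e0 m11 m330 by (metis (no_types, lifting) add_cancel_right_right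
          complex_cnj_zero_iff mult_eq_0_iff of_real_eq_0_iff)
    then show ?thesis using v e0 by (auto simp: values_II_def)
  qed
  with \<epsilon>\<epsilon> \<mu>\<mu> \<nu>\<nu> show ?thesis by simp
qed

end

section \<open>Ascending type, Dolbeault cohomology and equivalence\<close>

lemma ascending_series_UNIV_mono:
  assumes "ascending_series br k = UNIV" "k \<le> m"
  shows "ascending_series br m = UNIV"
  using assms(2)
proof (induction rule: dec_induct)
  case base then show ?case by (rule assms(1))
next
  case (step n) then show ?case by auto
qed

lemma ascending_type_eq:
  assumes "ascending_series br (Suc s) = UNIV" "ascending_series br s \<noteq> UNIV"
  shows "ascending_type br = map (\<lambda>k. dim (ascending_series br k)) [1..<Suc (Suc s)]"
proof -
  have "(LEAST s. ascending_series br s = UNIV) = Suc s"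
  proof (rule Least_equality)
    fix y assume "ascending_series br y = UNIV"
    then show "Suc s \<le> y"
      using assms(2) ascending_series_UNIV_mono[of br y s] by (meson not_less_eq_eq)
  qed (rule assms(1))
  then show ?thesis by (simp add: ascending_type_def)
qed

section \<open>Ascending central series of the two normal forms\<close>

context complex_lie8 begin

text \<open>These are the proper nonzero terms of the ascending series that occur in the two
  families; each is parametrized injectively by a Euclidean space. The one with the constant
  \<open>c\<close> arises only in Family I with \<open>a = 0\<close> and
  \<open>\<epsilon> = 1\<close>.\<close>

lemma dim_coordinates:
  assumes d: "dual \<omega> e"
  shows "dim {X. \<omega> 1 X = 0 \<and> \<omega> 2 X = 0 \<and> \<omega> 3 X = 0 \<and> Re (\<omega> 4 X) = 0} = 1" (is "dim ?A1 = 1")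
    and "dim {X. \<omega> 1 X = 0 \<and> \<omega> 2 X = 0 \<and> Re (\<omega> 4 X) = 0} = 3" (is "dim ?A3 = 3")
    and "dim {X. \<omega> 1 X = 0 \<and> Re (\<omega> 2 X) = 0 \<and> Re (\<omega> 4 X) = c * Im (\<omega> 2 X)} = 4" (is "dim ?A4 = 4")
    and "dim {X. \<omega> 1 X = 0 \<and> Re (\<omega> 4 X) = 0} = 5" (is "dim ?A5 = 5")
    and "dim {X. \<omega> 1 X = 0} = 6" (is "dim ?A6 = 6")
proof -
  note w = dualD[OF d]
  note fs = form10(2)[OF w(17)] form10(2)[OF w(18)] form10(2)[OF w(19)] form10(2)[OF w(20)]
    form10(8)[OF w(17)] form10(8)[OF w(18)] form10(8)[OF w(19)] form10(8)[OF w(20)] w(1-16)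
  have expand: "X = \<omega> 2 X \<odot> e 2 + \<omega> 3 X \<odot> e 3 + \<omega> 4 X \<odot> e 4" if "\<omega> 1 X = 0" for X
    using dual_expand[OF d, of X] that by simp
  have imag: "\<i> * of_real (Im z) = z" if "Re z = 0" for z
    using that by (simp add: complex_eq_iff)
  have dim: "dim S = DIM('e)" if "linear f" "\<And>x. f x \<in> S \<and> g (f x) = x" "\<And>X. X \<in> S \<Longrightarrow> f (g X) = X"
    for f :: "'e::euclidean_space \<Rightarrow> 'a" and g S
  proof -
    have "inj f" using that(2) by (metis injI)
    moreover have "range f = S" using that(2,3) by (metis (no_types, lifting) image_subset_iff rangeI subsetI subset_antisym)
    ultimately show ?thesis using dim_linear_inj_range[OF that(1)] by simp
  qed
  define f1 where "f1 = (\<lambda>r::real. (\<i> * of_real r) \<odot> e 4)"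
  have l: "linear f1" by (rule linearI) (auto simp: f1_def scl_def algebra_simps)
  have "dim ?A1 = DIM(real)"
  proof (rule dim[OF l, of _ "\<lambda>X. Im (\<omega> 4 X)"])
    fix X assume X: "X \<in> ?A1"
    then have "\<omega> 1 X = 0" by simp
    from expand[OF this, symmetric] X show "f1 (Im (\<omega> 4 X)) = X"
      by (simp add: f1_def imag)
  qed (auto simp: f1_def fs)
  then show "dim ?A1 = 1" by simp
  define f3 where "f3 = (\<lambda>(z::complex, r::real). z \<odot> e 3 + (\<i> * of_real r) \<odot> e 4)"
  have l: "linear f3" by (rule linearI) (auto simp: f3_def scl_def algebra_simps)
  have "dim ?A3 = DIM(complex \<times> real)"
  proof (rule dim[OF l, of _ "\<lambda>X. (\<omega> 3 X, Im (\<omega> 4 X))"])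
    fix X assume X: "X \<in> ?A3"
    then have "\<omega> 1 X = 0" by simp
    from expand[OF this, symmetric] X show "f3 ((\<omega> 3 X, Im (\<omega> 4 X))) = X"
      by (simp add: f3_def imag)
  qed (auto simp: f3_def fs)
  then show "dim ?A3 = 3" by simp
  define f4 where "f4 = (\<lambda>(s::real, z::complex, r::real). (\<i> * of_real s) \<odot> e 2 + z \<odot> e 3
     + Complex (c * s) r \<odot> e 4)"
  have l: "linear f4" by (rule linearI) (auto simp: f4_def scl_def algebra_simps)
  have "dim ?A4 = DIM(real \<times> complex \<times> real)"
  proof (rule dim[OF l, of _ "\<lambda>X. (Im (\<omega> 2 X), \<omega> 3 X, Im (\<omega> 4 X))"])
    fix X assume X: "X \<in> ?A4"
    then have "\<omega> 1 X = 0" by simp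
    moreover have C: "Complex (c * Im (\<omega> 2 X)) (Im (\<omega> 4 X)) = \<omega> 4 X"
      using X by (simp add: complex_eq_iff)
    ultimately show "f4 ((Im (\<omega> 2 X), \<omega> 3 X, Im (\<omega> 4 X))) = X"
      using X expand[of X, symmetric] by (simp add: f4_def imag)
  qed (auto simp: f4_def fs)
  then show "dim ?A4 = 4" by simp
  define f5 where "f5 = (\<lambda>(y::complex, z::complex, r::real). y \<odot> e 2 + z \<odot> e 3 + (\<i> * of_real r) \<odot> e 4)"
  have l: "linear f5" by (rule linearI) (auto simp: f5_def scl_def algebra_simps)
  have "dim ?A5 = DIM(complex \<times> complex \<times> real)"
  proof (rule dim[OF l, of _ "\<lambda>X. (\<omega> 2 X, \<omega> 3 X, Im (\<omega> 4 X))"])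
    fix X assume X: "X \<in> ?A5"
    then have "\<omega> 1 X = 0" by simp
    from expand[OF this, symmetric] X show "f5 ((\<omega> 2 X, \<omega> 3 X, Im (\<omega> 4 X))) = X"
      by (simp add: f5_def imag)
  qed (auto simp: f5_def fs)
  then show "dim ?A5 = 5" by simp
  define f6 where "f6 = (\<lambda>(y::complex, z::complex, u::complex). y \<odot> e 2 + z \<odot> e 3 + u \<odot> e 4)"
  have l: "linear f6" by (rule linearI) (auto simp: f6_def scl_def algebra_simps)
  have "dim ?A6 = DIM(complex \<times> complex \<times> complex)"
  proof (rule dim[OF l, of _ "\<lambda>X. (\<omega> 2 X, \<omega> 3 X, \<omega> 4 X)"])
    fix X assume X: "X \<in> ?A6"
    then have "\<omega> 1 X = 0" by simp
    from expand[OF this, symmetric] X show "f6 ((\<omega> 2 X, \<omega> 3 X, \<omega> 4 X)) = X"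
      by (simp add: f6_def imag)
  qed (auto simp: f6_def fs)
  then show "dim ?A6 = 6" by simp
qed

lemma series_I:
  assumes b: "basis10 J \<omega>" and h: "has_I \<omega> (of_real \<epsilon>) \<nu> (of_real a) b \<delta>" and \<delta>: "\<delta> \<noteq> 0"
    and ab: "a \<noteq> 0 \<or> b \<noteq> 0"
  shows "ascending_series br 1 = {X. \<omega> 1 X = 0 \<and> \<omega> 2 X = 0 \<and> \<omega> 3 X = 0 \<and> Re (\<omega> 4 X) = 0}" (is "_ = ?A1")
    and "ascending_series br 2 = {X. \<omega> 1 X = 0 \<and> of_real a * \<omega> 2 X = 0 \<and>
       2 * of_real (Re (\<omega> 4 X)) + \<i> * of_real \<epsilon> * of_real (b / \<delta>) * cnj (\<omega> 2 X) = 0}" (is "_ = ?A2")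
    and "ascending_series br 3 = (if a * \<epsilon> = 0 \<and> \<epsilon> * (b * \<epsilon> / \<delta>) = 2 * \<nu> then UNIV else {X. \<omega> 1 X = 0})" (is "_ = ?A3")
    and "ascending_series br 4 = UNIV"
proof -
  obtain e where d: "dual \<omega> e" using b basis10_dual by meson
  note w = dualD[OF d] and h = has_ID[OF h]
  note brw = w(17)[THEN form10_P(3)] w(18)[THEN form10_P(3)] w(19)[THEN form10_P(3)] w(20)[THEN form10_P(3)]
  note wJ = w(17)[THEN form10(7)] w(18)[THEN form10(7)] w(19)[THEN form10(7)] w(20)[THEN form10(7)]
  have zero: "X = 0 \<longleftrightarrow> \<omega> 1 X = 0 \<and> \<omega> 2 X = 0 \<and> \<omega> 3 X = 0 \<and> \<omega> 4 X = 0" for X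
    using dual_eq_0[OF d, of X] form10(5)[OF w(17)] form10(5)[OF w(18)] form10(5)[OF w(19)] form10(5)[OF w(20)]
    by auto
  have x1: "\<omega> 1 X = 0" if "\<omega> 3 (br X (e 4)) = 0" for X
    using that by (simp add: brw h w)
  \<comment> \<open>Pairing with \<open>e 1\<close> and with \<open>J (e 1)\<close> separates the
    parts of \<open>\<omega> 3 (br X Y)\<close> that are linear and antilinear in
    \<open>\<omega> 1 Y\<close>.\<close>
  have x34: "of_real a * \<omega> 2 X = 0 \<and> 2 * of_real (Re (\<omega> 4 X)) + \<i> * of_real \<epsilon> * of_real (b / \<delta>) * cnj (\<omega> 2 X) = 0"
    if "\<omega> 1 X = 0" "\<omega> 3 (br X (e 1)) = 0" "\<omega> 3 (br X (J (e 1))) = 0" for X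
  proof -
    let ?u = "\<omega> 4 X + cnj (\<omega> 4 X) + \<i> * of_real \<epsilon> * of_real (b / \<delta>) * cnj (\<omega> 2 X)"
    have 1: "?u - of_real a * \<omega> 2 X = 0"
      using that(1,2) by (simp add: brw h w algebra_simps)
    have "\<i> * (?u + of_real a * \<omega> 2 X) = 0"
      using that(1,3) by (simp add: brw h w wJ algebra_simps)
    then have 2: "?u + of_real a * \<omega> 2 X = 0" by simp
    have "2 * (of_real a * \<omega> 2 X) = (?u + of_real a * \<omega> 2 X) - (?u - of_real a * \<omega> 2 X)" by simp
    then have 3: "of_real a * \<omega> 2 X = 0" unfolding 1 2 by simp
    moreover have "2 * of_real (Re (\<omega> 4 X)) = \<omega> 4 X + cnj (\<omega> 4 X)" by (simp add: complex_add_cnj)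
    ultimately show ?thesis using 1 by simp
  qed
  show s1: "ascending_series br 1 = ?A1"
  proof (intro set_eqI iffI)
    fix X assume "X \<in> ascending_series br 1"
    then have 0: "br X Y = 0" for Y by (simp add: One_nat_def)
    then have c: "\<omega> k (br X Y) = 0" if "\<omega> k \<in> forms10 J" for k Y by (simp add: form10(5)[OF that])
    have 1: "\<omega> 1 X = 0" using x1[OF c[OF w(19)]] .
    note 2 = x34[OF 1 c[OF w(19)] c[OF w(19)]]
    have "of_real b * (cnj (\<omega> 2 X) - \<omega> 2 X) = 0" using c[OF w(20), of "e 2"] 1 by (simp add: brw h w algebra_simps)
    moreover have "of_real b * (\<i> * cnj (\<omega> 2 X) + \<i> * \<omega> 2 X) = 0"
      using c[OF w(20), of "J (e 2)"] 1 by (simp add: brw h w wJ algebra_simps)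
    ultimately have "of_real b * \<omega> 2 X = 0" by (auto simp: complex_eq_iff)
    then have 3: "\<omega> 2 X = 0" using 2 ab by auto
    have "\<i> * of_real \<delta> * (cnj (\<omega> 3 X) + \<omega> 3 X) = 0"
      using c[OF w(20), of "e 1"] 1 by (simp add: brw h w algebra_simps)
    moreover have "of_real \<delta> * (\<omega> 3 X - cnj (\<omega> 3 X)) = 0"
      using c[OF w(20), of "J (e 1)"] 1 by (simp add: brw h w wJ algebra_simps)
    ultimately have "\<omega> 3 X = 0" using \<delta> by (auto simp: complex_eq_iff)
    with 1 2 3 show "X \<in> ?A1" by simp
  next
    fix X assume "X \<in> ?A1"
    then have X: "\<omega> 1 X = 0" "\<omega> 2 X = 0" "\<omega> 3 X = 0" "cnj (\<omega> 4 X) = - \<omega> 4 X" by (auto simp: complex_eq_iff)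
    have "br X Y = 0" for Y unfolding zero by (simp add: brw h X)
    then show "X \<in> ascending_series br 1" by (simp add: One_nat_def)
  qed
  show s2: "ascending_series br 2 = ?A2"
  proof (intro set_eqI iffI)
    fix X assume "X \<in> ascending_series br 2"
    then have "br X Y \<in> ascending_series br 1" for Y by (simp add: numeral_2_eq_2 One_nat_def)
    then have c: "\<omega> 3 (br X Y) = 0" for Y by (simp add: s1)
    have 1: "\<omega> 1 X = 0" using x1[OF c] .
    show "X \<in> ?A2" using x34[OF 1 c c] 1 by simp
  next
    fix X assume X: "X \<in> ?A2"
    have 4: "\<omega> 4 X + cnj (\<omega> 4 X) = - (\<i> * of_real \<epsilon> * of_real (b / \<delta>) * cnj (\<omega> 2 X))"
      using X by (simp add: complex_add_cnj eq_neg_iff_add_eq_0)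
    have "br X Y \<in> ?A1" for Y
    proof -
      have "\<omega> 3 (br X Y) = (\<omega> 4 X + cnj (\<omega> 4 X) + \<i> * of_real \<epsilon> * of_real (b / \<delta>) * cnj (\<omega> 2 X)) * \<omega> 1 Y
          - of_real a * \<omega> 2 X * cnj (\<omega> 1 Y)"
        using X by (simp add: brw h algebra_simps)
      then have "\<omega> 3 (br X Y) = 0" using X unfolding 4 by simp
      moreover have "Re (\<omega> 4 (br X Y)) = 0" "\<omega> 1 (br X Y) = 0" "\<omega> 2 (br X Y) = 0"
        using X by (simp_all add: brw h algebra_simps)
      ultimately show ?thesis by simp
    qed
    then have "br X Y \<in> ascending_series br 1" for Y by (simp add: s1)
    then show "X \<in> ascending_series br 2" by (simp add: numeral_2_eq_2 One_nat_def)
  qed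
  \<comment> \<open>On a commutator the conditions of \<open>?A2\<close> involve only
    \<open>Im (hh \<omega> 1 1 X Y)\<close>. They hold for all commutators exactly when both scalar
    factors vanish, and then the series stops at the third step.\<close>
  have br_in: "br X Y \<in> ?A2 \<longleftrightarrow> a * \<epsilon> * Im (hh \<omega> 1 1 X Y) = 0 \<and>
      (\<epsilon> * (b * \<epsilon> / \<delta>) - 2 * \<nu>) * Im (hh \<omega> 1 1 X Y) = 0" for X Y
  proof -
    define m where "m = Im (hh \<omega> 1 1 X Y)"
    have 2: "\<omega> 2 (br X Y) = \<i> * of_real (2 * \<epsilon> * m)"
      by (simp add: brw h m_def complex_eq_iff algebra_simps)
    have 4: "Re (\<omega> 4 (br X Y)) = - 2 * \<nu> * m"
      by (simp add: brw h m_def algebra_simps)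
    have A: "2 * complex_of_real (- 2 * \<nu> * m) + \<i> * of_real \<epsilon> * of_real (b / \<delta>) * cnj (\<i> * of_real (2 * \<epsilon> * m))
       = of_real (2 * ((\<epsilon> * (b * \<epsilon> / \<delta>) - 2 * \<nu>) * m))"
      by (simp add: algebra_simps)
    have B: "complex_of_real a * (\<i> * of_real (2 * \<epsilon> * m)) = \<i> * of_real (2 * (a * \<epsilon> * m))" by simp
    show ?thesis
      unfolding mem_Collect_eq 2 4 A B of_real_eq_0_iff m_def[symmetric] by (simp add: brw h)
  qed
  show s3: "ascending_series br 3 = ?A3"
  proof -
    have s3: "X \<in> ascending_series br 3 \<longleftrightarrow> (\<forall>Y. br X Y \<in> ?A2)" for X
      using ascending_series.simps(2)[of br 2] unfolding s2[symmetric] by simp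
    show ?thesis
    proof (cases "a * \<epsilon> = 0 \<and> \<epsilon> * (b * \<epsilon> / \<delta>) = 2 * \<nu>")
      case True
      then have "br X Y \<in> ?A2" for X Y unfolding br_in by simp
      then have "X \<in> ascending_series br 3" for X unfolding s3 by blast
      then show ?thesis unfolding if_P[OF True] by blast
    next
      case False
      have "\<omega> 1 X = 0" if X: "\<forall>Y. br X Y \<in> ?A2" for X
      proof -
        \<comment> \<open>At \<open>Y = J X\<close> the imaginary part is the squared modulus of
          \<open>\<omega> 1 X\<close>.\<close>
        have "Im (hh \<omega> 1 1 X (J X)) = 0"
          using X[rule_format, of "J X"] False unfolding br_in by auto
        then show ?thesis
          by (simp add: wJ complex_eq_iff sum_power2_eq_zero_iff flip: power2_eq_square)
      qed
      moreover have "br X Y \<in> ?A2" if "\<omega> 1 X = 0" for X Y using that unfolding br_in by simp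
      ultimately have "X \<in> ascending_series br 3 \<longleftrightarrow> \<omega> 1 X = 0" for X unfolding s3 by blast
      then show ?thesis unfolding if_not_P[OF False] by blast
    qed
  qed
  have "br X Y \<in> ascending_series br 3" for X Y unfolding s3 by (simp add: brw h)
  then have "ascending_series br (Suc 3) = UNIV" unfolding ascending_series.simps by blast
  then show "ascending_series br 4 = UNIV" by simp
qed

lemma series_II:
  assumes b: "basis10 J \<omega>" and h: "has_II \<omega> (of_real \<epsilon>) \<mu> \<nu> (of_real a) b" and em: "\<epsilon> \<noteq> 0 \<or> \<mu> \<noteq> 0"
  shows "ascending_series br 1 = {X. \<omega> 1 X = 0 \<and> \<omega> 2 X = 0 \<and> \<omega> 3 X = 0 \<and> Re (\<omega> 4 X) = 0}" (is "_ = ?A1")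
    and "ascending_series br 2 = {X. \<omega> 1 X = 0 \<and> \<omega> 2 X = 0 \<and> Re (\<omega> 4 X) = 0}" (is "_ = ?A2")
    and "ascending_series br 3 = {X. \<omega> 1 X = 0 \<and> Re (\<omega> 4 X) = 0}" (is "_ = ?A3")
    and "ascending_series br 4 = (if \<nu> = 0 then UNIV else {X. \<omega> 1 X = 0})" (is "_ = ?A4")
    and "ascending_series br 5 = UNIV"
proof -
  obtain e where d: "dual \<omega> e" using b basis10_dual by meson
  note w = dualD[OF d] and h = has_IID[OF h]
  note brw = w(17)[THEN form10_P(3)] w(18)[THEN form10_P(3)] w(19)[THEN form10_P(3)] w(20)[THEN form10_P(3)]
  note wJ = w(17)[THEN form10(7)] w(18)[THEN form10(7)] w(19)[THEN form10(7)] w(20)[THEN form10(7)]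
  have zero: "X = 0 \<longleftrightarrow> \<omega> 1 X = 0 \<and> \<omega> 2 X = 0 \<and> \<omega> 3 X = 0 \<and> \<omega> 4 X = 0" for X
    using dual_eq_0[OF d, of X] form10(5)[OF w(17)] form10(5)[OF w(18)] form10(5)[OF w(19)] form10(5)[OF w(20)]
    by auto
  have x1: "\<omega> 1 X = 0" if "\<omega> 2 (br X (e 4)) = 0" for X
    using that by (simp add: brw h w)
  have x4: "Re (\<omega> 4 X) = 0" if "\<omega> 1 X = 0" "\<omega> 2 (br X (e 1)) = 0" for X
    using that by (simp add: brw h w complex_add_cnj)
  have x2: "\<omega> 2 X = 0" if "\<omega> 1 X = 0" "\<omega> 3 (br X (e 1)) = 0" "\<omega> 3 (br X (e 4)) = 0" for X
  proof -
    \<comment> \<open>The equation \<open>2 * z + cnj z = 0\<close> has only the solution 0, by real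
      and imaginary parts.\<close>
    have "of_real \<epsilon> * (2 * \<omega> 2 X + cnj (\<omega> 2 X)) = 0" using that(1,2) by (simp add: brw h w algebra_simps)
    moreover have "2 * \<i> * of_real \<mu> * \<omega> 2 X = 0" using that(1,3) by (simp add: brw h w algebra_simps)
    ultimately show ?thesis using em by (auto simp: complex_eq_iff)
  qed
  show s1: "ascending_series br 1 = ?A1"
  proof (intro set_eqI iffI)
    fix X assume "X \<in> ascending_series br 1"
    then have 0: "br X Y = 0" for Y by (simp add: One_nat_def)
    then have c: "\<omega> k (br X Y) = 0" if "\<omega> k \<in> forms10 J" for k Y by (simp add: form10(5)[OF that])
    have 1: "\<omega> 1 X = 0" using x1[OF c[OF w(18)]] .
    have 2: "\<omega> 2 X = 0" using x2[OF 1 c[OF w(19)] c[OF w(19)]] .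
    have 4: "Re (\<omega> 4 X) = 0" using x4[OF 1 c[OF w(18)]] .
    have "\<i> * (cnj (\<omega> 3 X) + \<omega> 3 X) = 0"
      using c[OF w(20), of "e 1"] 1 2 by (simp add: brw h w algebra_simps)
    moreover have "\<omega> 3 X - cnj (\<omega> 3 X) = 0"
      using c[OF w(20), of "J (e 1)"] 1 2 by (simp add: brw h w wJ algebra_simps)
    ultimately have "\<omega> 3 X = 0" by (auto simp: complex_eq_iff)
    with 1 2 4 show "X \<in> ?A1" by simp
  next
    fix X assume "X \<in> ?A1"
    then have X: "\<omega> 1 X = 0" "\<omega> 2 X = 0" "\<omega> 3 X = 0" "cnj (\<omega> 4 X) = - \<omega> 4 X" by (auto simp: complex_eq_iff)
    have "br X Y = 0" for Y unfolding zero by (simp add: brw h X)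
    then show "X \<in> ascending_series br 1" by (simp add: One_nat_def)
  qed
  show s2: "ascending_series br 2 = ?A2"
  proof (intro set_eqI iffI)
    fix X assume "X \<in> ascending_series br 2"
    then have "br X Y \<in> ascending_series br 1" for Y by (simp add: numeral_2_eq_2 One_nat_def)
    then have c: "\<omega> 2 (br X Y) = 0" "\<omega> 3 (br X Y) = 0" for Y by (simp_all add: s1)
    have 1: "\<omega> 1 X = 0" using x1[OF c(1)] .
    show "X \<in> ?A2" using x2[OF 1 c(2) c(2)] x4[OF 1 c(1)] 1 by simp
  next
    fix X assume "X \<in> ?A2"
    then have X: "\<omega> 1 X = 0" "\<omega> 2 X = 0" "cnj (\<omega> 4 X) = - \<omega> 4 X" by (auto simp: complex_eq_iff)
    have "br X Y \<in> ?A1" for Y by (simp add: brw h X algebra_simps)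
    then have "br X Y \<in> ascending_series br 1" for Y by (simp add: s1)
    then show "X \<in> ascending_series br 2" by (simp add: numeral_2_eq_2 One_nat_def)
  qed
  show s3: "ascending_series br 3 = ?A3"
  proof (intro set_eqI iffI)
    fix X assume "X \<in> ascending_series br 3"
    then have "br X Y \<in> ascending_series br 2" for Y by (simp add: numeral_3_eq_3 numeral_2_eq_2)
    then have c: "\<omega> 2 (br X Y) = 0" for Y by (simp add: s2)
    have 1: "\<omega> 1 X = 0" using x1[OF c] .
    show "X \<in> ?A3" using x4[OF 1 c] 1 by simp
  next
    fix X assume "X \<in> ?A3"
    then have X: "\<omega> 1 X = 0" "cnj (\<omega> 4 X) = - \<omega> 4 X" by (auto simp: complex_eq_iff)
    have "br X Y \<in> ?A2" for Y by (simp add: brw h X algebra_simps)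
    then have "br X Y \<in> ascending_series br 2" for Y by (simp add: s2)
    then show "X \<in> ascending_series br 3" by (simp add: numeral_3_eq_3 numeral_2_eq_2)
  qed
  \<comment> \<open>All other terms of \<open>\<omega> 4 (br X Y)\<close> are imaginary, so
    \<open>\<nu>\<close> alone decides whether the series ends at the fourth or at the fifth
    step.\<close>
  have br_in: "br X Y \<in> ?A3 \<longleftrightarrow> \<nu> * Im (hh \<omega> 1 1 X Y) = 0" for X Y
  proof -
    have "Re (\<omega> 4 (br X Y)) = - 2 * (\<nu> * Im (hh \<omega> 1 1 X Y))"
      by (simp add: brw h algebra_simps)
    then show ?thesis by (simp add: brw(1) h)
  qed
  show s4: "ascending_series br 4 = ?A4"
  proof -
    have s4: "X \<in> ascending_series br 4 \<longleftrightarrow> (\<forall>Y. br X Y \<in> ?A3)" for X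
      using ascending_series.simps(2)[of br 3] unfolding s3[symmetric] by simp
    have "\<omega> 1 X = 0" if "\<nu> \<noteq> 0" "\<forall>Y. br X Y \<in> ?A3" for X
    proof -
      have "Im (hh \<omega> 1 1 X (J X)) = 0"
        using that(2)[rule_format, of "J X"] that(1) unfolding br_in by auto
      then show ?thesis
        by (simp add: wJ complex_eq_iff sum_power2_eq_zero_iff flip: power2_eq_square)
    qed
    moreover have "br X Y \<in> ?A3" if "\<nu> = 0 \<or> \<omega> 1 X = 0" for X Y using that unfolding br_in by auto
    ultimately have "X \<in> ascending_series br 4 \<longleftrightarrow> \<nu> = 0 \<or> \<omega> 1 X = 0" for X unfolding s4 by blast
    then show ?thesis by (auto split: if_split)
  qed
  have "br X Y \<in> ascending_series br 4" for X Y unfolding s4 by (simp add: brw h)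
  then have "ascending_series br (Suc 4) = UNIV" unfolding ascending_series.simps by blast
  then show "ascending_series br 5 = UNIV" by simp
qed

end

lemma values_I_cases:
  assumes "(\<epsilon>, \<nu>, a, b) \<in> values_I"
  obtains "\<epsilon> = 0" "\<nu> = 0" "a = 0" "b = 1" | "\<epsilon> = 0" "\<nu> = 0" "a = 1" "b = 0 \<or> b = 1"
    | "\<epsilon> = 0" "\<nu> = 1" "a = 0" "b = -1 \<or> b = 1" | "\<epsilon> = 0" "\<nu> = 1" "a = 1"
    | "\<epsilon> = 1" "\<nu> = 0" "a = 0" "b = 1" | "\<epsilon> = 1" "\<nu> = 0" "a = 1" "b \<ge> 0"
    | "\<epsilon> = 1" "\<nu> = 1" "a > 0" | "\<epsilon> = 1" "\<nu> = 1" "a = 0" "b \<noteq> 0"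
proof -
  have "c / \<bar>c\<bar> = -1 \<or> c / \<bar>c\<bar> = 1" if "c \<noteq> 0" for c :: real
    using that by (auto simp: abs_if)
  then show thesis using assms that unfolding values_I_def
    by (elim UnE) (auto simp: less_eq_real_def)
qed

text \<open>Only for \<open>\<epsilon> = \<nu> = 1\<close> and \<open>a = 0\<close> does the length
  of the series depend on \<open>b\<close>; the criterion then reads
  \<open>b / \<delta> = 2\<close>.\<close>

lemma type_relation_I_values:
  assumes \<delta>: "\<delta> \<in> {1, -1}" and v: "(\<epsilon>, \<nu>, a, b) \<in> values_I"
    and d: "d = (if a \<noteq> 0 then 3 else if \<epsilon> = 0 then 5 else 4)"
    and t: "t = (if a * \<epsilon> = 0 \<and> \<epsilon> * (b * \<epsilon> / \<delta>) = 2 * \<nu> then [1, d, 8] else [1, d, 6, 8])"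
  shows "type_relation_I t \<delta> (\<epsilon>, \<nu>, a, b)"
  using v
proof (cases rule: values_I_cases)
  case 8
  have "b / \<delta> = 2 \<longleftrightarrow> b = 2 * \<delta>" using \<delta> by auto
  then show ?thesis using 8 d t by (auto simp: type_relation_I_def)
qed (use d t \<delta> in \<open>auto simp: type_relation_I_def\<close>)

lemma type_relation_II_values:
  assumes v: "(\<epsilon>, \<mu>, \<nu>, a, b) \<in> values_II"
    and t: "t = (if \<nu> = 0 then [1, 3, 5, 8] else [1, 3, 5, 6, 8])"
  shows "type_relation_II t (\<epsilon>, \<mu>, \<nu>, a, b)"
  using v t by (auto simp: type_relation_II_def values_II_def)

section \<open>Types of forms, the Dolbeault operator and pullback along isomorphisms\<close>

lemma forms01_cnj: "\<alpha> \<in> forms01 J \<longleftrightarrow> cnj_form \<alpha> \<in> forms10 J"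
proof -
  have 1: "linear \<alpha> \<longleftrightarrow> linear (\<lambda>X. cnj (\<alpha> X))"
  proof
    assume "linear (\<lambda>X. cnj (\<alpha> X))"
    from linear_compose[OF this bounded_linear.linear[OF bounded_linear_cnj]]
    show "linear \<alpha>" by (simp add: o_def)
  next
    assume "linear \<alpha>"
    from linear_compose[OF this bounded_linear.linear[OF bounded_linear_cnj]]
    show "linear (\<lambda>X. cnj (\<alpha> X))" by (simp add: o_def)
  qed
  have 2: "z = - \<i> * y \<longleftrightarrow> cnj z = \<i> * cnj y" for y z
    by (auto simp: complex_eq_iff)
  show ?thesis unfolding forms01_def forms10_def cnj_form_def mem_Collect_eq 1 2 ..
qed

lemma cnj_cnj_form [simp]: "cnj_form (cnj_form \<alpha>) = \<alpha>"
  by (simp add: cnj_form_def)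

text \<open>The behaviour under \<open>J\<close> in the arguments is linear in the form, so it
  passes from wedge products to their spans; it is what tells the three types apart.\<close>

lemma wedge_types:
  shows "\<eta> \<in> forms20 J \<Longrightarrow> \<eta> (J X, Y) = \<i> * \<eta> (X, Y) \<and> \<eta> (X, J Y) = \<i> * \<eta> (X, Y)"
    and "\<zeta> \<in> forms11 J \<Longrightarrow> \<zeta> (J X, J Y) = \<zeta> (X, Y)"
    and "\<gamma> \<in> forms02 J \<Longrightarrow> \<gamma> (J X, Y) = - \<i> * \<gamma> (X, Y) \<and> \<gamma> (X, J Y) = - \<i> * \<gamma> (X, Y)"
  unfolding forms20_def forms11_def forms02_def
  by (induction rule: cform.span_induct_alt;
      auto simp: forms10_def forms01_def wedge_def cscale_def algebra_simps)+

text \<open>Since the decomposition of a 2-form into its types is unique, the definite description in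
  \<open>dbar01\<close> denotes the (0,2)-part whenever one is exhibited.\<close>

lemma dbar01_eq:
  assumes J: "\<And>X. J (J X) = - X" and \<alpha>: "\<And>X Y. \<alpha> (br X (- Y)) = - \<alpha> (br X Y)"
    and \<gamma>: "\<gamma> \<in> forms02 J" and \<zeta>: "\<zeta> \<in> forms11 J" and eq: "ce_d br \<alpha> = \<zeta> + \<gamma>"
  shows "dbar01 br J \<alpha> = \<gamma>"
  unfolding dbar01_def
proof (rule the_equality)
  have "0 \<in> forms20 J" unfolding forms20_def by (rule cform.span_zero)
  then show "\<gamma> \<in> forms02 J \<and> (\<exists>\<eta>\<in>forms20 J. \<exists>\<zeta>\<in>forms11 J. ce_d br \<alpha> = \<eta> + \<zeta> + \<gamma>)"
    using assms by (metis add_0)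
next
  fix \<gamma>' assume "\<gamma>' \<in> forms02 J \<and> (\<exists>\<eta>\<in>forms20 J. \<exists>\<zeta>\<in>forms11 J. ce_d br \<alpha> = \<eta> + \<zeta> + \<gamma>')"
  then obtain \<eta>' \<zeta>' where g': "\<gamma>' \<in> forms02 J" "\<eta>' \<in> forms20 J" "\<zeta>' \<in> forms11 J"
    and eq': "ce_d br \<alpha> = \<eta>' + \<zeta>' + \<gamma>'" by blast
  have *: "\<zeta> (X, Y) + \<gamma> (X, Y) = \<eta>' (X, Y) + \<zeta>' (X, Y) + \<gamma>' (X, Y)" for X Y
    using fun_cong[OF trans[OF eq[symmetric] eq'], of "(X, Y)"] by simp
  have 1: "\<gamma> (X, Y) = \<eta>' (X, Y) + \<gamma>' (X, Y)" for X Y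
  proof -
    \<comment> \<open>Applying \<open>J\<close> to both arguments fixes the (1,1)-parts and reverses
      the sign of the others, so half the difference removes the (1,1)-parts.\<close>
    have **: "\<zeta> (X, Y) - \<gamma> (X, Y) = - \<eta>' (X, Y) + \<zeta>' (X, Y) - \<gamma>' (X, Y)"
      using *[of "J X" "J Y"] wedge_types(1)[OF g'(2)] wedge_types(2)[OF g'(3)] wedge_types(2)[OF \<zeta>]
        wedge_types(3)[OF g'(1)] wedge_types(3)[OF \<gamma>] by simp
    have "2 * \<gamma> (X, Y) = (\<zeta> (X, Y) + \<gamma> (X, Y)) - (\<zeta> (X, Y) - \<gamma> (X, Y))" by simp
    also have "\<dots> = 2 * (\<eta>' (X, Y) + \<gamma>' (X, Y))" unfolding *[of X Y] ** by simp
    finally show ?thesis by (simp only: mult_cancel_left) simp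
  qed
  have "\<gamma> (X, Y) = \<gamma>' (X, Y)" for X Y
  proof -
    \<comment> \<open>Applying \<open>J\<close> to the first argument alone multiplies the
      (2,0)-part by \<open>\<i>\<close> and the (0,2)-parts by \<open>- \<i>\<close>, which forces
      the (2,0)-part to vanish.\<close>
    have **: "- \<i> * \<gamma> (X, Y) = \<i> * \<eta>' (X, Y) - \<i> * \<gamma>' (X, Y)"
      using 1[of "J X" Y] wedge_types(1)[OF g'(2)] wedge_types(3)[OF g'(1)] wedge_types(3)[OF \<gamma>] by simp
    have "\<i> * (2 * \<eta>' (X, Y)) = (\<i> * \<eta>' (X, Y) - \<i> * \<gamma>' (X, Y)) - (- \<i> * (\<eta>' (X, Y) + \<gamma>' (X, Y)))"
      by (simp add: algebra_simps)
    also have "\<dots> = 0" unfolding 1[of X Y, symmetric] ** by simp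
    finally show ?thesis using 1[of X Y] by simp
  qed
  then show "\<gamma>' = \<gamma>" by (simp add: fun_eq_iff)
qed

text \<open>Composing a basis of (1,0)-forms with an isomorphism commutes with conjugation, wedge
  products and the differential. Inequivalence is thereby reduced to uniqueness on a single Lie
  algebra.\<close>

lemma admits_equations_pullback:
  fixes f :: "'g::real_vector \<Rightarrow> 'h::real_vector"
  assumes f: "linear f" "bij f" and br: "\<And>X Y. f (br X Y) = br' (f X) (f Y)" and J: "J = inv f \<circ> J' \<circ> f"
    and a: "admits_equations br' J' e"
  shows "admits_equations br J e"
proof -
  obtain \<omega> where b: "basis10 J' \<omega>" and h: "has_equations br' \<omega> e"
    using a by (auto simp: admits_equations_def)
  have fi: "f (inv f Y) = Y" for Y using f(2) by (simp add: bij_is_surj surj_f_inv_f)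
  have inj: "inv f (f X) = X" for X using f(2) by (simp add: bij_is_inj)
  have fJ: "f (J X) = J' (f X)" for X by (simp add: J fi)
  have linv: "linear (inv f)"
    by (rule linearI) (metis fi inj linear_add[OF f(1)], metis fi inj linear_scale[OF f(1)])
  define \<psi> where "\<psi> k X = \<omega> k (f X)" for k X
  have "basis10 J \<psi>"
    unfolding basis10_iff
  proof (intro conjI ballI allI impI)
    fix k :: nat assume "k \<in> {1..4}"
    then have "\<omega> k \<in> forms10 J'" using b by (simp add: basis10_iff)
    then show "\<psi> k \<in> forms10 J"
      using linear_compose[OF f(1)] by (auto simp: forms10_def \<psi>_def[abs_def] fJ o_def)
  next
    fix \<alpha> assume \<alpha>: "\<alpha> \<in> forms10 J"
    have "inv f (J' Y) = J (inv f Y)" for Y by (simp add: J fi)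
    then have "(\<lambda>Y. \<alpha> (inv f Y)) \<in> forms10 J'"
      using \<alpha> linear_compose[OF linv] by (auto simp: forms10_def o_def)
    then obtain c where c: "\<And>Y. \<alpha> (inv f Y) = (\<Sum>k=1..4. c k * \<omega> k Y)"
      using b by (auto simp: basis10_iff)
    have "\<alpha> X = (\<Sum>k=1..4. c k * \<psi> k X)" for X
      using c[of "f X"] by (simp add: inj \<psi>_def)
    then show "\<exists>c. \<forall>X. \<alpha> X = (\<Sum>k=1..4. c k * \<psi> k X)" by blast
  next
    fix c :: "nat \<Rightarrow> complex" and k :: nat
    assume 0: "\<forall>X. (\<Sum>k=1..4. c k * \<psi> k X) = 0" and k: "k \<in> {1..4}"
    have "(\<Sum>k=1..4. c k * \<omega> k Y) = 0" for Y
      using 0[rule_format, of "inv f Y"] by (simp add: \<psi>_def fi)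
    then show "c k = 0" using b k unfolding basis10_iff by blast
  qed
  moreover have "has_equations br \<psi> e"
  proof -
    define pull :: "('h \<times> 'h \<Rightarrow> complex) \<Rightarrow> 'g \<times> 'g \<Rightarrow> complex" where "pull F = (\<lambda>(X, Y). F (f X, f Y))" for F
    have p: "pull (F + G) = pull F + pull G" "pull (F - G) = pull F - pull G" "pull 0 = 0"
      "pull (c *\<^sub>f F) = c *\<^sub>f pull F" for F G c
      by (auto simp: pull_def fun_eq_iff cscale_def)
    have d: "ce_d br (\<psi> k) = pull (ce_d br' (\<omega> k))" for k
      by (auto simp: pull_def ce_d_def \<psi>_def br)
    have w: "wedge (\<psi> j) (\<psi> k) = pull (wedge (\<omega> j) (\<omega> k))"
      "wedge (\<psi> j) (cnj_form (\<psi> k)) = pull (wedge (\<omega> j) (cnj_form (\<omega> k)))" for j k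
      by (auto simp: pull_def wedge_def \<psi>_def cnj_form_def)
    show ?thesis using h
      by (cases e) (simp_all only: has_equations.simps Let_def d w p(1,2,4)[symmetric], simp_all only: p(3))
  qed
  ultimately show ?thesis by (auto simp: admits_equations_def)
qed

section \<open>Ascending types and Dolbeault dimensions\<close>

context complex_lie8 begin

lemma type_I:
  assumes b: "basis10 J \<omega>" and h: "has_I \<omega> (of_real \<epsilon>) \<nu> (of_real a) b \<delta>" and \<delta>: "\<delta> \<in> {1, -1}"
    and v: "(\<epsilon>, \<nu>, a, b) \<in> values_I"
  shows "type_relation_I (ascending_type br) \<delta> (\<epsilon>, \<nu>, a, b)"
proof -
  have d0: "\<delta> \<noteq> 0" using \<delta> by auto
  have ab: "a \<noteq> 0 \<or> b \<noteq> 0" using v by (auto simp: values_I_def)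
  obtain e where d: "dual \<omega> e" using b basis10_dual by meson
  note w = dualD[OF d] and S = series_I[OF b h d0 ab] and dim = dim_coordinates[OF d]
  define n :: nat where "n = (if a \<noteq> 0 then 3 else if \<epsilon> = 0 then 5 else 4)"
  have \<epsilon>: "\<epsilon> = 0 \<or> \<epsilon> = 1" using v by (auto simp: values_I_def)
  have d1: "dim (ascending_series br 1) = 1" unfolding S(1) by (rule dim(1))
  have d2: "dim (ascending_series br 2) = n"
  proof -
    consider "a \<noteq> 0" | "a = 0" "\<epsilon> = 0" | "a = 0" "\<epsilon> = 1" "b \<noteq> 0" using \<epsilon> ab by auto
    then show ?thesis
    proof cases
      case 1
      then have "ascending_series br 2 = {X. \<omega> 1 X = 0 \<and> \<omega> 2 X = 0 \<and> Re (\<omega> 4 X) = 0}"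
        unfolding S(2) by auto
      then show ?thesis using 1 by (simp add: dim n_def)
    next
      case 2
      then have "ascending_series br 2 = {X. \<omega> 1 X = 0 \<and> Re (\<omega> 4 X) = 0}"
        unfolding S(2) by auto
      then show ?thesis using 2 by (simp add: dim n_def)
    next
      case 3
      \<comment> \<open>The complex equation splits into two real ones; the second expresses
        \<open>Re (\<omega> 4 X)\<close> through \<open>Im (\<omega> 2 X)\<close>.\<close>
      have "2 * complex_of_real x + \<i> * of_real \<epsilon> * of_real (b / \<delta>) * cnj z = 0 \<longleftrightarrow>
         Re z = 0 \<and> x = (- b / (2 * \<delta>)) * Im z" for x z
        using 3 d0 by (auto simp: complex_eq_iff field_simps)
      then have "ascending_series br 2 = {X. \<omega> 1 X = 0 \<and> Re (\<omega> 2 X) = 0 \<and> Re (\<omega> 4 X) = (- b / (2 * \<delta>)) * Im (\<omega> 2 X)}"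
        unfolding S(2) using 3 by simp
      then show ?thesis using 3 by (simp only: dim) (simp add: n_def)
    qed
  qed
  have d3: "dim (ascending_series br 3) = (if a * \<epsilon> = 0 \<and> \<epsilon> * (b * \<epsilon> / \<delta>) = 2 * \<nu> then 8 else 6)"
    unfolding S(3) by (simp add: dim dim8)
  have d4: "dim (ascending_series br 4) = 8" unfolding S(4) by (rule dim8)
  have e1: "e 1 \<notin> {X. \<omega> 1 X = 0}" by (simp add: w)
  have s2: "ascending_series br 2 \<noteq> UNIV" using e1 unfolding S(2) by blast
  have "ascending_type br = (if a * \<epsilon> = 0 \<and> \<epsilon> * (b * \<epsilon> / \<delta>) = 2 * \<nu> then [1, n, 8] else [1, n, 6, 8])"
  proof (cases "a * \<epsilon> = 0 \<and> \<epsilon> * (b * \<epsilon> / \<delta>) = 2 * \<nu>")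
    case True
    then have "ascending_series br (Suc 2) = UNIV" using S(3) by simp
    from ascending_type_eq[OF this s2] have "ascending_type br = map (\<lambda>k. dim (ascending_series br k)) [1,2,3]"
      by (simp add: upt_rec)
    then show ?thesis unfolding if_P[OF True] using d1 d2 d3 True by simp
  next
    case False
    then have s3: "ascending_series br 3 \<noteq> UNIV" using S(3) e1 by auto
    have "ascending_series br (Suc 3) = UNIV" using S(4) by simp
    from ascending_type_eq[OF this s3] have "ascending_type br = map (\<lambda>k. dim (ascending_series br k)) [1,2,3,4]"
      by (simp add: upt_rec)
    then show ?thesis unfolding if_not_P[OF False] using d1 d2 d3 d4 by (simp only: list.map if_not_P[OF False])
  qed
  from type_relation_I_values[OF \<delta> v n_def this] show ?thesis .
qed

lemma type_II:
  assumes b: "basis10 J \<omega>" and h: "has_II \<omega> (of_real \<epsilon>) \<mu> \<nu> (of_real a) b"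
    and v: "(\<epsilon>, \<mu>, \<nu>, a, b) \<in> values_II"
  shows "type_relation_II (ascending_type br) (\<epsilon>, \<mu>, \<nu>, a, b)"
proof -
  have em: "\<epsilon> \<noteq> 0 \<or> \<mu> \<noteq> 0" using v by (auto simp: values_II_def)
  obtain e where d: "dual \<omega> e" using b basis10_dual by meson
  note w = dualD[OF d] and S = series_II[OF b h em] and dim = dim_coordinates[OF d]
  have d1: "dim (ascending_series br 1) = 1" unfolding S(1) by (rule dim(1))
  have d2: "dim (ascending_series br 2) = 3" unfolding S(2) by (rule dim(2))
  have d3: "dim (ascending_series br 3) = 5" unfolding S(3) by (rule dim(4))
  have d4: "dim (ascending_series br 4) = (if \<nu> = 0 then 8 else 6)"
    unfolding S(4) by (simp add: dim dim8)
  have d5: "dim (ascending_series br 5) = 8" unfolding S(5) by (rule dim8)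
  have e1: "e 1 \<notin> {X. \<omega> 1 X = 0}" by (simp add: w)
  have s3: "ascending_series br 3 \<noteq> UNIV" using e1 unfolding S(3) by blast
  have "ascending_type br = (if \<nu> = 0 then [1, 3, 5, 8] else [1, 3, 5, 6, 8])"
  proof (cases "\<nu> = 0")
    case True
    then have "ascending_series br (Suc 3) = UNIV" using S(4) by simp
    from ascending_type_eq[OF this s3] have "ascending_type br = map (\<lambda>k. dim (ascending_series br k)) [1,2,3,4]"
      by (simp add: upt_rec)
    then show ?thesis using d1 d2 d3 d4 True by simp
  next
    case False
    then have s4: "ascending_series br 4 \<noteq> UNIV" using S(4) e1 by auto
    have "ascending_series br (Suc 4) = UNIV" using S(5) by simp
    from ascending_type_eq[OF this s4] have "ascending_type br = map (\<lambda>k. dim (ascending_series br k)) [1,2,3,4,5]"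
      by (simp add: upt_rec)
    then show ?thesis using d1 d2 d3 d4 d5 False by simp
  qed
  from type_relation_II_values[OF v this] show ?thesis .
qed

lemma form01:
  assumes "\<alpha> \<in> forms01 J"
  shows "\<alpha> (X + Y) = \<alpha> X + \<alpha> Y" "\<alpha> (X - Y) = \<alpha> X - \<alpha> Y" "\<alpha> (- X) = - \<alpha> X" "\<alpha> 0 = 0"
    "\<alpha> (t *\<^sub>R X) = of_real t * \<alpha> X" "\<alpha> (c \<odot> X) = cnj c * \<alpha> X"
proof -
  have a: "\<alpha> X = cnj (cnj_form \<alpha> X)" for X by (simp add: cnj_form_def)
  have 1: "cnj_form \<alpha> \<in> forms10 J" using assms by (simp flip: forms01_cnj)
  show "\<alpha> (X + Y) = \<alpha> X + \<alpha> Y" "\<alpha> (X - Y) = \<alpha> X - \<alpha> Y" "\<alpha> (- X) = - \<alpha> X" "\<alpha> 0 = 0"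
    "\<alpha> (t *\<^sub>R X) = of_real t * \<alpha> X" "\<alpha> (c \<odot> X) = cnj c * \<alpha> X"
    by (simp_all add: a form10[OF 1])
qed

text \<open>For a (0,1)-form \<open>\<alpha>\<close>, the composite with \<open>P\<close> is
  antilinear in both arguments and that with \<open>R\<close> has mixed type. So the (0,2)-part of
  the differential is \<open>- \<alpha> (P X Y)\<close>, and the Dolbeault space is the annihilator
  of the values of \<open>P\<close>.\<close>

lemma dolbeault01_eq:
  assumes d: "dual \<omega> e"
  shows "dolbeault01 br J = {\<alpha> \<in> forms01 J. \<forall>X Y. \<alpha> (P X Y) = 0}"
proof -
  note w = dualD[OF d]
  have "dbar01 br J \<alpha> = (\<lambda>(X, Y). - \<alpha> (P X Y))" if \<alpha>: "\<alpha> \<in> forms01 J" for \<alpha>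
  proof (rule dbar01_eq)
    note a = form01[OF \<alpha>]
    have c: "cnj_form (\<omega> j) \<in> forms01 J" if "j \<in> {1..4}" for j
      using that d by (simp add: forms01_cnj dual_def)
    show "(\<lambda>(X, Y). - \<alpha> (P X Y)) \<in> forms02 J"
    proof -
      let ?u = "\<lambda>j k. (- \<alpha> (P (e j) (e k))) *\<^sub>f wedge (cnj_form (\<omega> j)) (cnj_form (\<omega> k))"
      have u: "?u j k \<in> forms02 J" if "j \<in> {1..4}" "k \<in> {1..4}" for j k
        unfolding forms02_def using c that by (intro cform.span_scale cform.span_base) blast
      \<comment> \<open>By antisymmetry of \<open>P\<close> the six pairs of increasing indices
        suffice.\<close>
      have pt: "- \<alpha> (P X Y) = (?u 1 2 + ?u 1 3 + ?u 1 4 + ?u 2 3 + ?u 2 4 + ?u 3 4) (X, Y)" for X Y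
        by (subst dual_expand[OF d, of X], subst dual_expand[OF d, of Y])
          (simp add: P_lin P_scl a P_self P_anti[of "e 1"] P_anti[of "e 2" "e 3"] P_anti[of "e 2" "e 4"]
            P_anti[of "e 3" "e 4"] cscale_def wedge_def cnj_form_def algebra_simps)
      have "(\<lambda>(X, Y). - \<alpha> (P X Y)) = ?u 1 2 + ?u 1 3 + ?u 1 4 + ?u 2 3 + ?u 2 4 + ?u 3 4"
        by (rule ext, unfold split_paired_all prod.case, rule pt)
      also have "\<dots> \<in> forms02 J"
        unfolding forms02_def by (intro cform.span_add; rule u[unfolded forms02_def]; simp)
      finally show ?thesis .
    qed
    show "(\<lambda>(X, Y). \<alpha> (R Y X) - \<alpha> (R X Y)) \<in> forms11 J"
    proof -
      let ?u = "\<lambda>j k. (- \<alpha> (R (e j) (e k))) *\<^sub>f wedge (\<omega> j) (cnj_form (\<omega> k))"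
      let ?v = "\<lambda>j. ?u j 1 + ?u j 2 + ?u j 3 + ?u j 4"
      have u: "?u j k \<in> forms11 J" if "j \<in> {1..4}" "k \<in> {1..4}" for j k
      proof -
        have "\<omega> j \<in> forms10 J" using d that by (simp add: dual_def)
        then show ?thesis
          unfolding forms11_def using c[OF that(2)] by (intro cform.span_scale cform.span_base) blast
      qed
      have R: "\<alpha> (R X Y) = \<omega> 1 X * \<alpha> (R (e 1) Y) + \<omega> 2 X * \<alpha> (R (e 2) Y) + \<omega> 3 X * \<alpha> (R (e 3) Y) + \<omega> 4 X * \<alpha> (R (e 4) Y)"
        for X Y by (subst dual_expand[OF d, of X]) (simp add: R_lin R_scl a)
      have R': "\<alpha> (R Z Y) = cnj (\<omega> 1 Y) * \<alpha> (R Z (e 1)) + cnj (\<omega> 2 Y) * \<alpha> (R Z (e 2))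
         + cnj (\<omega> 3 Y) * \<alpha> (R Z (e 3)) + cnj (\<omega> 4 Y) * \<alpha> (R Z (e 4))"
        for Z Y by (subst dual_expand[OF d, of Y]) (simp add: R_lin R_scl a)
      have pt: "\<alpha> (R Y X) - \<alpha> (R X Y) = (?v 1 + ?v 2 + ?v 3 + ?v 4) (X, Y)" for X Y
        unfolding R[of X Y] R[of Y X] R'[of "e 1" X] R'[of "e 2" X] R'[of "e 3" X] R'[of "e 4" X]
          R'[of "e 1" Y] R'[of "e 2" Y] R'[of "e 3" Y] R'[of "e 4" Y]
        by (simp add: cscale_def wedge_def cnj_form_def algebra_simps)
      have "(\<lambda>(X, Y). \<alpha> (R Y X) - \<alpha> (R X Y)) = ?v 1 + ?v 2 + ?v 3 + ?v 4"
        by (rule ext, unfold split_paired_all prod.case, rule pt)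
      also have "\<dots> \<in> forms11 J"
        unfolding forms11_def by (intro cform.span_add; rule u[unfolded forms11_def]; simp)
      finally show ?thesis .
    qed
    show "\<alpha> (br X (- Y)) = - \<alpha> (br X Y)" for X Y by (simp add: a)
    show "ce_d br \<alpha> = (\<lambda>(X, Y). \<alpha> (R Y X) - \<alpha> (R X Y)) + (\<lambda>(X, Y). - \<alpha> (P X Y))"
      by (simp add: ce_d_def fun_eq_iff br_eq a)
  qed (rule JJ)
  then show ?thesis by (auto simp: dolbeault01_def fun_eq_iff)
qed

text \<open>The conjugates of the \<open>\<omega> k\<close> with \<open>k\<close> in
  \<open>K\<close> form a basis; evaluation at the vectors \<open>e k\<close> reads off the
  coefficients.\<close>

lemma cform_dim_annihilator:
  assumes d: "dual \<omega> e" and K: "K \<subseteq> {1..4}"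
  shows "cform.dim {\<alpha> \<in> forms01 J. \<forall>k\<in>{1..4} - K. \<alpha> (e k) = 0} = card K"
proof -
  define f where "f k = cnj_form (\<omega> k)" for k
  have fe: "f k (e j) = (if j = k then 1 else 0)" if "j \<in> {1..4}" "k \<in> {1..4}" for j k
    using d that by (simp add: f_def cnj_form_def dual_def)
  have f01: "f k \<in> forms01 J" if "k \<in> {1..4}" for k
    using d that by (simp add: f_def forms01_cnj dual_def)
  have fin: "finite K" using K finite_subset by blast
  have inj: "inj_on f K"
    by (rule inj_onI) (metis K fe subsetD zero_neq_one)
  have sumf: "(\<Sum>k\<in>L. c k *\<^sub>f f k) X = (\<Sum>k\<in>L. c k * f k X)" for c X and L :: "nat set"
    by (induction L rule: infinite_finite_induct) (auto simp: cscale_def)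
  have "cform.independent (f ` K)"
  proof (rule cform.independent_if_scalars_zero)
    fix u v assume u: "(\<Sum>v\<in>f ` K. u v *\<^sub>f v) = 0" and v: "v \<in> f ` K"
    then obtain j where j: "j \<in> K" "v = f j" by blast
    have "(\<Sum>k\<in>K. u (f k) *\<^sub>f f k) (e j) = 0"
      using u by (subst (asm) sum.reindex[OF inj]) simp
    then have "(\<Sum>k\<in>K. u (f k) * f k (e j)) = 0" by (simp add: sumf)
    also have "(\<Sum>k\<in>K. u (f k) * f k (e j)) = (\<Sum>k\<in>K. if k = j then u (f k) else 0)"
    proof (rule sum.cong[OF refl])
      fix k assume "k \<in> K"
      then have "f k (e j) = (if j = k then 1 else 0)" using K j(1) by (intro fe) auto
      then show "u (f k) * f k (e j) = (if k = j then u (f k) else 0)" by simp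
    qed
    finally show "u v = 0" using fin j by simp
  qed (use fin in simp)
  moreover have "cform.span (f ` K) = {\<alpha> \<in> forms01 J. \<forall>k\<in>{1..4} - K. \<alpha> (e k) = 0}" (is "_ = ?S")
  proof
    have "cform.subspace ?S"
      by (rule cform.subspaceI)
        (auto simp: forms01_def cscale_def algebra_simps linear_iff scaleR_conv_of_real)
    moreover have "f ` K \<subseteq> ?S"
    proof (rule image_subsetI)
      fix k assume k: "k \<in> K"
      then have kk: "k \<in> {1..4}" using K by blast
      have "f k (e j) = 0" if j: "j \<in> {1..4} - K" for j
      proof -
        have "j \<noteq> k" "j \<in> {1..4}" using j k by auto
        then show ?thesis using fe[of j k] kk by simp
      qed
      then show "f k \<in> ?S" using f01[OF kk] by blast
    qed
    ultimately show "cform.span (f ` K) \<subseteq> ?S" by (rule cform.span_minimal[rotated])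
    show "?S \<subseteq> cform.span (f ` K)"
    proof
      fix \<alpha> assume \<alpha>: "\<alpha> \<in> ?S"
      then have a: "\<alpha> \<in> forms01 J" by simp
      have "\<alpha> X = (\<Sum>k\<in>K. \<alpha> (e k) *\<^sub>f f k) X" for X
      proof -
        have "\<alpha> X = (\<Sum>k=1..4. \<alpha> (e k) * f k X)" unfolding sum_1_4
          by (subst dual_expand[OF d, of X]) (simp add: form01[OF a] f_def cnj_form_def)
        also have "\<dots> = (\<Sum>k\<in>K. \<alpha> (e k) * f k X)"
          by (rule sum.mono_neutral_right) (use K \<alpha> in auto)
        finally show ?thesis by (simp only: sumf)
      qed
      then have "\<alpha> = (\<Sum>k\<in>K. \<alpha> (e k) *\<^sub>f f k)" by blast
      also have "\<dots> \<in> cform.span (f ` K)"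
        by (intro cform.span_sum cform.span_scale cform.span_base) auto
      finally show "\<alpha> \<in> cform.span (f ` K)" .
    qed
  qed
  ultimately show ?thesis
    using inj by (metis card_image cform.dim_eq_card_independent cform.dim_span)
qed

text \<open>The values of \<open>P\<close> fill the line of \<open>e 3\<close>: one condition on a
  four-dimensional space.\<close>

lemma dolbeault_I:
  assumes b: "basis10 J \<omega>" and h: "has_I \<omega> k \<nu> a b \<delta>"
  shows "cform.dim (dolbeault01 br J) = 3"
proof -
  obtain e where d: "dual \<omega> e" using b basis10_dual by meson
  note w = dualD[OF d] and h = has_ID[OF h]
  have P: "P X Y = aa \<omega> 4 1 X Y \<odot> e 3" for X Y
    using dual_expand[OF d, of "P X Y"] by (simp add: h)
  have "(\<forall>X Y. \<alpha> (P X Y) = 0) \<longleftrightarrow> \<alpha> (e 3) = 0" if "\<alpha> \<in> forms01 J" for \<alpha>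
  proof
    assume "\<forall>X Y. \<alpha> (P X Y) = 0"
    then have "\<alpha> (P (e 4) (e 1)) = 0" by blast
    then show "\<alpha> (e 3) = 0" by (simp add: P w)
  qed (simp add: P form01[OF that])
  then have "dolbeault01 br J = {\<alpha> \<in> forms01 J. \<forall>k\<in>{1..4} - {1,2,4}. \<alpha> (e k) = 0}"
    unfolding dolbeault01_eq[OF d]
  proof -
    have "{1..4} - {1,2,4} = {3::nat}" by auto
    with \<open>\<And>\<alpha>. \<alpha> \<in> forms01 J \<Longrightarrow> _\<close> show "{\<alpha> \<in> forms01 J. \<forall>X Y. \<alpha> (P X Y) = 0} = {\<alpha> \<in> forms01 J. \<forall>k\<in>{1..4} - {1,2,4}. \<alpha> (e k) = 0}"
      by auto
  qed
  then show ?thesis using cform_dim_annihilator[OF d, of "{1,2,4}"] by simp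
qed

text \<open>\<open>P (e 4) (e 1)\<close> is \<open>e 2\<close>, and a nonzero
  \<open>\<epsilon>\<close> or \<open>\<mu>\<close> contributes \<open>e 3\<close>: two conditions
  on a four-dimensional space.\<close>

lemma dolbeault_II:
  assumes b: "basis10 J \<omega>" and h: "has_II \<omega> \<epsilon> \<mu> \<nu> a b" and em: "\<epsilon> \<noteq> 0 \<or> \<mu> \<noteq> 0"
  shows "cform.dim (dolbeault01 br J) = 2"
proof -
  obtain e where d: "dual \<omega> e" using b basis10_dual by meson
  note w = dualD[OF d] and h = has_IID[OF h]
  have P: "P X Y = aa \<omega> 4 1 X Y \<odot> e 2 + (\<epsilon> * aa \<omega> 2 1 X Y + \<i> * of_real \<mu> * aa \<omega> 4 2 X Y) \<odot> e 3" for X Y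
    using dual_expand[OF d, of "P X Y"] by (simp add: h)
  have eq: "(\<forall>X Y. \<alpha> (P X Y) = 0) \<longleftrightarrow> \<alpha> (e 2) = 0 \<and> \<alpha> (e 3) = 0" if "\<alpha> \<in> forms01 J" for \<alpha>
  proof
    assume 0: "\<forall>X Y. \<alpha> (P X Y) = 0"
    then have "\<alpha> (P (e 4) (e 1)) = 0" "\<alpha> (P (e 4) (e 2)) = 0" "\<alpha> (P (e 2) (e 1)) = 0" by blast+
    then show "\<alpha> (e 2) = 0 \<and> \<alpha> (e 3) = 0" using em by (auto simp: P w form01[OF that])
  qed (simp add: P form01[OF that])
  have "{1..4} - {1,4} = {2,3::nat}" by auto
  then have "dolbeault01 br J = {\<alpha> \<in> forms01 J. \<forall>k\<in>{1..4} - {1,4}. \<alpha> (e k) = 0}"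
    unfolding dolbeault01_eq[OF d] using eq by auto
  then show ?thesis using cform_dim_annihilator[OF d, of "{1,4}"] by simp
qed

end

section \<open>Nilpotency and one-dimensional center\<close>

lemma subspace_ascending_series:
  assumes "lie_bracket br"
  shows "subspace (ascending_series br k)"
proof -
  have b: "bilinear br" using assms by (simp add: lie_bracket_def)
  show ?thesis
    by (induction k) (auto simp: subspace_def bilinear_ladd[OF b] bilinear_lmul[OF b] bilinear_lzero[OF b])
qed

lemma ascending_series_mono:
  assumes "lie_bracket br"
  shows "ascending_series br k \<subseteq> ascending_series br (Suc k)"
proof (induction k)
  case 0
  have b: "bilinear br" using assms by (simp add: lie_bracket_def)
  show ?case by (auto simp: bilinear_lzero[OF b])
next
  case (Suc k) then show ?case by auto
qed

locale complex_nil = complex_lie8 +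
  assumes nil: "nilpotent_lie br" and center1: "dim (lie_center br) = 1"
begin

definition T :: 'a where "T = (SOME T. T \<noteq> 0 \<and> lie_center br = span {T})"

lemma T: "T \<noteq> 0" "lie_center br = span {T}"
proof -
  have sub: "subspace (lie_center br)"
    by (auto simp: lie_center_def subspace_def)
  obtain B where B: "B \<subseteq> lie_center br" "independent B" "lie_center br \<subseteq> span B" "card B = 1"
    using real_vector.basis_exists[of "lie_center br"] center1 by metis
  then obtain t where t: "B = {t}" by (metis card_1_singletonE)
  have "t \<noteq> 0" using B(2) t by (auto simp: dependent_zero)
  moreover have "span B \<subseteq> lie_center br" using B(1) sub by (rule span_minimal)
  ultimately have "\<exists>T. T \<noteq> 0 \<and> lie_center br = span {T}" using B(3) t by blast
  from someI_ex[OF this] show "T \<noteq> 0" "lie_center br = span {T}" by (simp_all add: T_def)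
qed

lemma br_T [simp]: "br T Y = 0" "br Y T = 0"
proof -
  have "T \<in> lie_center br" using T(2) by (simp add: span_base)
  then show "br T Y = 0" by (simp add: lie_center_def)
  then show "br Y T = 0" using br_anti[of T Y] by simp
qed

text \<open>Since \<open>T\<close> is central, \<open>br E\<close> commutes with \<open>J\<close>; hence \<open>P\<close> and \<open>R\<close> agree on \<open>E\<close>.\<close>

definition E :: 'a where "E = - J T"

lemma E_nonzero: "E \<noteq> 0"
proof
  assume "E = 0"
  then have "J (J T) = 0" by (simp add: E_def)
  then show False using T(1) by simp
qed

lemma JE: "J E = T"
  by (simp add: E_def)

lemma R_E: "R E Y = P E Y"
  by (simp add: R_def P_def JE)

text \<open>In the integrability identity for \<open>X\<close> and \<open>E\<close> the two terms
  with \<open>J E = T\<close> drop out, and the other two are twice \<open>R X E\<close>.\<close>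

lemma R_right_E: "R X E = 0"
proof -
  show ?thesis using nijenhuis[of X E] by (simp add: R_def JE)
qed

text \<open>Under these hypotheses both \<open>v\<close> and \<open>J v\<close> are central, hence
  real multiples of \<open>T\<close>; but \<open>J\<close> has no real eigenvalue, as the sum of
  squares shows.\<close>

lemma central_eq_0:
  assumes "\<And>X. P v X = 0" "\<And>X. R v X = 0" "\<And>X. R X v = 0"
  shows "v = 0"
proof -
  have "v \<in> lie_center br" by (simp add: lie_center_def br_eq assms)
  moreover have "J v \<in> lie_center br" by (simp add: lie_center_def br_eq assms PR_simps)
  ultimately obtain c d where c: "v = c *\<^sub>R T" "J v = d *\<^sub>R T"
    unfolding T(2) span_singleton by blast
  have a: "c *\<^sub>R J T = d *\<^sub>R T" using c by simp
  have b: "- (c *\<^sub>R T) = d *\<^sub>R J T" using arg_cong[OF a, of J] by simp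
  have "- (c * c) *\<^sub>R T = c *\<^sub>R (- (c *\<^sub>R T))" by simp
  also have "\<dots> = d *\<^sub>R (c *\<^sub>R J T)" unfolding b by (simp add: mult.commute)
  also have "\<dots> = (d * d) *\<^sub>R T" unfolding a by simp
  finally have "(d * d) *\<^sub>R T - (- (c * c)) *\<^sub>R T = 0" by simp
  then have "(c * c + d * d) *\<^sub>R T = 0" by (simp add: scaleR_left_distrib add.commute)
  then have "c * c + d * d = 0" using T(1) by simp
  then have "c = 0" by (simp add: sum_squares_eq_zero_iff)
  then show ?thesis using c(1) by simp
qed

lemma N_nonzero: obtains v where "P E v \<noteq> 0"
proof -
  have "\<exists>v. P E v \<noteq> 0"
  proof (rule ccontr)
    assume "\<not> ?thesis"
    then have "P E v = 0" for v by blast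
    then have "E = 0" using central_eq_0[of E] by (simp add: R_E R_right_E)
    then show False using E_nonzero by simp
  qed
  then show thesis using that by blast
qed

text \<open>The \<open>J\<close>-stable hull of a term of the ascending series.\<close>

definition W :: "nat \<Rightarrow> 'a set" where
  "W k = {A + J B | A B. A \<in> ascending_series br k \<and> B \<in> ascending_series br k}"

text \<open>If \<open>v\<close> and \<open>J v\<close> lie in a term of the series, then
  \<open>P X v\<close> and \<open>J (P X v) = P (J X) v\<close> lie in the preceding one. For
  \<open>R\<close> this fails, but \<open>R X\<close> lowers the hulls \<open>W k\<close>. The
  exponent \<open>s\<close> is common to all \<open>X\<close>.\<close>

lemma nilpotent_PR: "\<exists>s. \<forall>X v. (P X ^^ s) v = 0 \<and> (R X ^^ s) v = 0"
proof -
  obtain s where s: "ascending_series br s = UNIV" using nil by (auto simp: nilpotent_lie_def)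
  have sub: "subspace (ascending_series br k)" for k by (rule subspace_ascending_series[OF lie])
  have br_in: "br X A \<in> ascending_series br k" if "A \<in> ascending_series br (Suc k)" for X A k
    using that br_anti[of X A] subspace_neg[OF sub] by (metis (mono_tags, lifting) ascending_series.simps(2) br_anti mem_Collect_eq)
  have P0: "v \<in> ascending_series br k \<Longrightarrow> J v \<in> ascending_series br k \<Longrightarrow> (P X ^^ k) v = 0" for X v k
  proof (induction k arbitrary: v)
    case (Suc k)
    have in1: "P Y v \<in> ascending_series br k" for Y
      unfolding P_def by (intro subspace_scale subspace_diff sub br_in Suc.prems)
    then have "J (P X v) \<in> ascending_series br k" by (metis P_J(1))
    with in1 show ?case using Suc.IH[of "P X v"] by (simp add: funpow_swap1)
  qed simp
  have R0: "v \<in> W k \<Longrightarrow> (R X ^^ k) v = 0" for X v k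
  proof (induction k arbitrary: v)
    case 0 then show ?case by (simp add: W_def)
  next
    case (Suc k)
    then obtain A B where v: "v = A + J B" "A \<in> ascending_series br (Suc k)" "B \<in> ascending_series br (Suc k)"
      by (auto simp: W_def)
    let ?A = "(1/2) *\<^sub>R br X A - (1/2) *\<^sub>R br (J X) B" and ?B = "(1/2) *\<^sub>R br (J X) A + (1/2) *\<^sub>R br X B"
    have "R X v = ?A + J ?B"
      unfolding v(1) by (simp add: R_lin R_J) (simp add: R_def algebra_simps)
    moreover have "?A \<in> ascending_series br k" "?B \<in> ascending_series br k"
      by (intro subspace_diff subspace_add subspace_scale sub br_in v)+
    ultimately have "R X v \<in> W k" unfolding W_def by blast
    then show ?case using Suc.IH[of "R X v"] by (simp add: funpow_swap1)
  qed
  have "v = v + J 0" for v by simp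
  then have "W s = UNIV" unfolding W_def s by blast
  then show ?thesis using P0[of _ s] R0[of _ s] s by blast
qed

text \<open>The last proper member of the filtration \<open>W\<close> contains the commutator: forms that vanish on it
  are Salamon's closed (1,0)-forms, and they annihilate the center.\<close>

lemma proper_ideal:
  "\<exists>U. V.subspace U \<and> E \<in> U \<and> U \<noteq> UNIV \<and> (\<forall>X Y. P X Y \<in> U) \<and> (\<forall>X Y. R X Y \<in> U)"
proof -
  have sub: "subspace (ascending_series br k)" for k by (rule subspace_ascending_series[OF lie])
  have br_in: "br X A \<in> ascending_series br k" "br A X \<in> ascending_series br k" 
    if "A \<in> ascending_series br (Suc k)" for X A k
    using that br_anti[of X A] subspace_neg[OF sub] by (metis (mono_tags, lifting) ascending_series.simps(2) br_anti mem_Collect_eq)+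
  have subW: "subspace (W k)" for k
  proof (rule subspaceI)
    have "0 = 0 + J 0" by simp
    then show "0 \<in> W k" unfolding W_def using subspace_0[OF sub] by blast
  next
    fix x y assume "x \<in> W k" "y \<in> W k"
    then obtain A B C D where "x = A + J B" "y = C + J D" "A \<in> ascending_series br k" "B \<in> ascending_series br k"
      "C \<in> ascending_series br k" "D \<in> ascending_series br k" unfolding W_def by blast
    then have "x + y = (A + C) + J (B + D)" "A + C \<in> ascending_series br k" "B + D \<in> ascending_series br k"
      by (simp_all add: subspace_add[OF sub])
    then show "x + y \<in> W k" unfolding W_def by blast
  next
    fix c :: real and x assume "x \<in> W k"
    then obtain A B where "x = A + J B" "A \<in> ascending_series br k" "B \<in> ascending_series br k" unfolding W_def by blast
    then have "c *\<^sub>R x = c *\<^sub>R A + J (c *\<^sub>R B)" "c *\<^sub>R A \<in> ascending_series br k" "c *\<^sub>R B \<in> ascending_series br k"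
      by (simp_all add: subspace_scale[OF sub] scaleR_right_distrib)
    then show "c *\<^sub>R x \<in> W k" unfolding W_def by blast
  qed
  have JW: "J x \<in> W k" if x: "x \<in> W k" for x k
  proof -
    obtain A B where "x = A + J B" "A \<in> ascending_series br k" "B \<in> ascending_series br k"
      using x unfolding W_def by blast
    then have "J x = - B + J A" "- B \<in> ascending_series br k" by (simp_all add: subspace_neg[OF sub])
    with \<open>A \<in> _\<close> show ?thesis unfolding W_def by blast
  qed
  have inW: "A \<in> W k" if "A \<in> ascending_series br k" for A k
  proof -
    have "A = A + J 0" by simp
    then show ?thesis unfolding W_def using that subspace_0[OF sub] by blast
  qed
  obtain s where s: "ascending_series br s = UNIV" using nil by (auto simp: nilpotent_lie_def)
  then have "W s = UNIV" using inW by blast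
  define n where "n = (LEAST n. W n = UNIV)"
  have n: "W n = UNIV" unfolding n_def by (rule LeastI) (rule \<open>W s = UNIV\<close>)
  have W0: "W 0 = {0}" by (auto simp: W_def)
  have "n \<noteq> 0"
  proof
    assume "n = 0"
    then have "E \<in> {0}" using n W0 by auto
    then show False using E_nonzero by simp
  qed
  then obtain k where k: "n = Suc k" by (cases n) auto
  have Wk: "W k \<noteq> UNIV" using not_less_Least[of k "\<lambda>n. W n = UNIV"] k unfolding n_def by simp
  have T1: "ascending_series br 1 = span {T}"
    using T(2) by (simp add: lie_center_def One_nat_def)
  \<comment> \<open>Needed to have \<open>T\<close>, and hence \<open>E\<close>, inside
    \<open>W k\<close>: if \<open>k\<close> were 0, the complex line of \<open>T\<close> would be
    everything.\<close>
  have "k \<noteq> 0"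
  proof
    assume "k = 0"
    then have U: "W 1 = UNIV" using n k by (simp add: One_nat_def)
    obtain X where X: "\<And>x y z. X \<noteq> x \<odot> T + y \<odot> 0 + z \<odot> 0"
      using exists_outside3[of T 0 0] by blast
    have "X \<in> W 1" using U by simp
    then obtain c d where "X = c *\<^sub>R T + J (d *\<^sub>R T)" by (auto simp: W_def T1 span_singleton)
    then have "X = Complex c d \<odot> T" by (simp add: scl_def)
    then show False using X[of "Complex c d" 0 0] by simp
  qed
  have "ascending_series br 1 \<subseteq> ascending_series br k"
    using \<open>k \<noteq> 0\<close> lift_Suc_mono_le[of "ascending_series br" 1 k] ascending_series_mono[OF lie] by (simp add: Suc_leI One_nat_def)
  then have "T \<in> ascending_series br k" using T1 by (auto simp: span_base)
  then have "T \<in> W k" by (rule inW)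
  then have EW: "E \<in> W k" unfolding E_def by (intro subspace_neg subW JW)
  have gJ: "br A (J B) \<in> W k" if A: "A \<in> ascending_series br (Suc k)" for A B
    using br_in(2)[OF A] inW by blast
  \<comment> \<open>The critical term, since neither \<open>J A\<close> nor \<open>J B\<close> need
    lie in the series. Integrability rewrites it through brackets with one argument in the
    series.\<close>
  have JJ_in: "br (J A) (J B) \<in> W k" if "A \<in> ascending_series br (Suc k)" "B \<in> ascending_series br (Suc k)" for A B
    unfolding br_JJ by (intro subspace_add subW JW inW br_in that)
  have br_in_W: "br X Y \<in> W k" for X Y
  proof -
    have "X \<in> W (Suc k)" "Y \<in> W (Suc k)" using n k by auto
    then obtain A B C D where XY: "X = A + J B" "Y = C + J D" and m: "A \<in> ascending_series br (Suc k)"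
      "B \<in> ascending_series br (Suc k)" "C \<in> ascending_series br (Suc k)" "D \<in> ascending_series br (Suc k)"
      by (auto simp: W_def)
    have "br X Y = br A C + br A (J D) + br (J B) C + br (J B) (J D)" by (simp add: XY)
    also have "\<dots> \<in> W k"
      by (intro subspace_add[OF subW] JJ_in m inW[OF br_in(2)[OF m(1)]] inW[OF br_in(1)[OF m(3)]])
    finally show ?thesis .
  qed
  have "V.subspace (W k)"
  proof (rule V.subspaceI)
    show "0 \<in> W k" by (rule subspace_0[OF subW])
    show "x + y \<in> W k" if "x \<in> W k" "y \<in> W k" for x y using that by (rule subspace_add[OF subW])
    show "c \<odot> x \<in> W k" if "x \<in> W k" for c x
      unfolding scl_def by (intro subspace_add[OF subW] subspace_scale[OF subW] JW that)
  qed
  moreover have "P X Y \<in> W k" "R X Y \<in> W k" for X Y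
    unfolding P_def R_def by (intro subspace_scale subspace_diff subspace_add subW JW br_in_W)+
  ultimately show ?thesis using EW Wk by blast
qed

section \<open>Consequences of nilpotency for \<open>P X\<close> and \<open>R X\<close>\<close>

lemma pow_zero_imp:
  fixes f :: "'a \<Rightarrow> 'a"
  assumes "\<And>v. (f ^^ s) v = (0::'a)" "f 0 = 0" obtains n where "n > 0" "(f ^^ (n - 1)) u \<noteq> 0" "\<And>m. m \<ge> n \<Longrightarrow> (f ^^ m) u = 0" | "u = 0"
proof (cases "u = 0")
  case False
  define n where "n = (LEAST n. (f ^^ n) u = 0)"
  have n: "(f ^^ n) u = 0" unfolding n_def by (rule LeastI[of _ s]) (rule assms)
  have "n > 0" using n False by (cases n) auto
  moreover have "(f ^^ (n - 1)) u \<noteq> 0"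
    using not_less_Least[of "n - 1" "\<lambda>n. (f ^^ n) u = 0"] \<open>n > 0\<close> unfolding n_def by simp
  moreover have "(f ^^ m) u = 0" if "m \<ge> n" for m
    using that
  proof (induction rule: dec_induct)
    case base show ?case by (rule n)
  next
    case (step m) then show ?case using assms(2) by simp
  qed
  ultimately show thesis using that by blast
qed (use that in blast)

lemma P_pow_lin: "(P X ^^ n) (c \<odot> u + d \<odot> v) = c \<odot> (P X ^^ n) u + d \<odot> (P X ^^ n) v"
  by (induction n) (simp_all add: P_lin P_scl)

text \<open>Let \<open>n\<close> be the least exponent with \<open>(P X ^^ n) u = 0\<close>; it is
  at least 3. Applying the powers \<open>n - 1\<close>, \<open>n - 2\<close> and
  \<open>n - 3\<close> of \<open>P X\<close> to the relation leaves successively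
  \<open>\<gamma>\<close>, \<open>\<beta>\<close> and \<open>\<alpha>\<close> times a nonzero
  vector.\<close>

lemma P_nilpotent3:
  assumes nz: "P X (P X u) \<noteq> 0" and eq: "P X (P X (P X u)) = \<alpha> \<odot> P X (P X u) + \<beta> \<odot> P X u + \<gamma> \<odot> u"
  shows "\<alpha> = 0 \<and> \<beta> = 0 \<and> \<gamma> = 0"
proof -
  obtain s where s: "\<And>v. (P X ^^ s) v = 0" using nilpotent_PR by blast
  have "u \<noteq> 0" using nz by (auto simp: P_zero)
  then obtain n where n: "n > 0" "(P X ^^ (n - 1)) u \<noteq> 0" "\<And>m. m \<ge> n \<Longrightarrow> (P X ^^ m) u = 0"
    using pow_zero_imp[where f = "P X" and s = s and u = u, OF s P_zero(2)] by metis
  have sw: "(P X ^^ m) (P X v) = (P X ^^ Suc m) v" for m v by (simp add: funpow_swap1)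
  have "(P X ^^ m) (P X (P X (P X u))) = \<alpha> \<odot> (P X ^^ m) (P X (P X u)) + \<beta> \<odot> (P X ^^ m) (P X u) + \<gamma> \<odot> (P X ^^ m) u" for m
    unfolding eq using P_pow_lin[of m X \<alpha> "P X (P X u)" \<beta> "P X u"] 
      P_pow_lin[of m X 1 "\<alpha> \<odot> P X (P X u) + \<beta> \<odot> P X u" \<gamma> u] by simp
  then have m: "(P X ^^ (m + 3)) u = \<alpha> \<odot> (P X ^^ (m + 2)) u + \<beta> \<odot> (P X ^^ (m + 1)) u + \<gamma> \<odot> (P X ^^ m) u" for m
    unfolding sw by (simp add: eval_nat_numeral One_nat_def)
  have n3: "n \<ge> 3"
  proof (rule ccontr)
    assume "\<not> n \<ge> 3"
    then have "(P X ^^ 2) u = 0" by (intro n(3)) simp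
    then show False using nz by (simp add: numeral_2_eq_2)
  qed
  have "\<gamma> \<odot> (P X ^^ (n - 1)) u = 0" using m[of "n - 1"] n by (simp add: P_zero)
  then have \<gamma>: "\<gamma> = 0" using n(2) by simp
  have "n - 2 + 3 = n + 1" "n - 2 + 2 = n" "n - 2 + 1 = n - 1" using n3 by auto
  then have "\<beta> \<odot> (P X ^^ (n - 1)) u = 0" using m[of "n - 2"] n(3) \<gamma> by (simp add: P_zero)
  then have \<beta>: "\<beta> = 0" using n(2) by simp
  have "n - 3 + 3 = n" "n - 3 + 2 = n - 1" using n3 by auto
  then have "\<alpha> \<odot> (P X ^^ (n - 1)) u = 0" using m[of "n - 3"] n(3) \<gamma> \<beta> by (simp add: P_zero)
  then show ?thesis using \<beta> \<gamma> n(2) by simp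
qed

lemma P_eigen:
  assumes "P X v = c \<odot> v" "v \<noteq> 0"
  shows "c = 0"
proof -
  obtain s where s: "\<And>v. (P X ^^ s) v = 0" using nilpotent_PR by blast
  have "(P X ^^ n) v = c ^ n \<odot> v" for n
    by (induction n) (simp_all add: P_scl assms(1) mult.commute)
  then show ?thesis using s[of v] assms(2) by simp
qed

text \<open>Applying \<open>P X\<close> once more turns the quadratic relation into a cubic one
  without constant term; the case where the second power already kills \<open>u\<close> is settled
  directly.\<close>

lemma P_nilpotent2:
  assumes nz: "P X u \<noteq> 0" and eq: "P X (P X u) = \<beta> \<odot> P X u + \<gamma> \<odot> u"
  shows "\<beta> = 0 \<and> \<gamma> = 0"
proof (cases "P X (P X u) = 0")
  case True
  have "P X (P X (P X u)) = \<beta> \<odot> P X (P X u) + \<gamma> \<odot> P X u" unfolding eq by (simp add: P_lin P_scl eq)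
  then have "\<gamma> = 0" using True nz by (simp add: P_zero)
  then show ?thesis using eq True nz by simp
next
  case False
  have "P X (P X (P X u)) = P X (\<beta> \<odot> P X u + \<gamma> \<odot> u)" using eq by simp
  also have "\<dots> = \<beta> \<odot> P X (P X u) + \<gamma> \<odot> P X u + 0 \<odot> u" by (simp add: P_lin P_scl)
  finally show ?thesis using P_nilpotent3[OF False, of \<beta> \<gamma> 0] by blast
qed

text \<open>Since \<open>R X E = 0\<close>, \<open>R X\<close> acts on the quotient by the line of
  \<open>E\<close>, nilpotently, and \<open>v\<close> represents an eigenvector there.\<close>

lemma R_eigen:
  assumes "R X v = c \<odot> v + d \<odot> E" "\<And>z. v \<noteq> z \<odot> E"
  shows "c = 0"
proof (rule ccontr)
  assume c: "c \<noteq> 0"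
  obtain s where s: "\<And>v. (R X ^^ s) v = 0" using nilpotent_PR by blast
  have "\<exists>z. (R X ^^ n) v = c ^ n \<odot> v + z \<odot> E" for n
  proof (induction n)
    case 0 show ?case by (rule exI[of _ 0]) simp
  next
    case (Suc n)
    then obtain z where "(R X ^^ n) v = c ^ n \<odot> v + z \<odot> E" by blast
    then have "(R X ^^ Suc n) v = c ^ Suc n \<odot> v + (c ^ n * d) \<odot> E"
      by (simp add: R_lin R_scl R_right_E assms(1) V.scale_right_distrib mult.commute)
    then show ?case by blast
  qed
  then obtain z where "c ^ s \<odot> v + z \<odot> E = 0" using s by metis
  then have "(1 / c ^ s) \<odot> (c ^ s \<odot> v + z \<odot> E) = 0" by simp
  then have "v + (z / c ^ s) \<odot> E = 0" using c by (simp add: V.scale_right_distrib)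
  then have "v = (- (z / c ^ s)) \<odot> E" by (simp add: eq_neg_iff_add_eq_0)
  then show False using assms(2) by blast
qed

text \<open>Modulo \<open>E\<close>, \<open>R X\<close> acts on \<open>a\<close> and
  \<open>b\<close> by a nilpotent 2 by 2 matrix, so trace and determinant vanish.\<close>

lemma R_nilpotent2:
  assumes a: "R X a = p \<odot> a + q \<odot> b + u \<odot> E" and b: "R X b = r \<odot> a + s \<odot> b + v \<odot> E"
    and ind: "\<And>x y z. x \<odot> a + y \<odot> b + z \<odot> E = 0 \<Longrightarrow> x = 0 \<and> y = 0"
  shows "p + s = 0 \<and> p * s = q * r"
proof -
  have root: "c = 0" if c: "c * c - (p + s) * c + (p * s - q * r) = 0" for c
  proof -
    have *: "c = 0" if xy: "x * p + y * r = c * x" "x * q + y * s = c * y" "x \<noteq> 0 \<or> y \<noteq> 0" for x y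
    proof (rule R_eigen)
      have "R X (x \<odot> a + y \<odot> b) = (x * p + y * r) \<odot> a + (x * q + y * s) \<odot> b + (x * u + y * v) \<odot> E"
        by (simp add: R_lin R_scl a b V.scale_right_distrib V.scale_left_distrib algebra_simps)
      then show "R X (x \<odot> a + y \<odot> b) = c \<odot> (x \<odot> a + y \<odot> b) + (x * u + y * v) \<odot> E"
        unfolding xy(1,2) by (simp add: V.scale_right_distrib)
      fix z show "x \<odot> a + y \<odot> b \<noteq> z \<odot> E"
        using ind[of x y "- z"] xy(3) by auto
    qed
    \<comment> \<open>An eigenvector for the root \<open>c\<close> is \<open>(r, c - p)\<close>, or
      \<open>(c - s, q)\<close> if that vanishes; if both vanish the matrix is scalar.\<close>
    show ?thesis
    proof (cases "r = 0 \<and> c = p")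
      case False
      have "r * p + (c - p) * r = c * r" "r * q + (c - p) * s = c * (c - p)"
        using c by (simp_all add: algebra_simps)
      from *[OF this] False show ?thesis by auto
    next
      case True
      show ?thesis
      proof (cases "q = 0 \<and> c = s")
        case True with \<open>r = 0 \<and> c = p\<close> show ?thesis using *[of 1 0] by simp
      next
        case False
        have "(c - s) * p + q * r = c * (c - s)" "(c - s) * q + q * s = c * q"
          using c by (simp_all add: algebra_simps)
        from *[OF this] False show ?thesis by auto
      qed
    qed
  qed
  \<comment> \<open>A square root of the discriminant; half of the trace plus or minus
    \<open>D\<close> are the two roots, and both are 0.\<close>
  define D where "D = csqrt ((p + s)\<^sup>2 - 4 * (p * s - q * r))"
  have D: "D * D = (p + s)\<^sup>2 - 4 * (p * s - q * r)"
    using power2_csqrt[of "(p + s)\<^sup>2 - 4 * (p * s - q * r)"] by (simp add: D_def power2_eq_square)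
  have c: "(t + d) / 2 * ((t + d) / 2) - t * ((t + d) / 2) + u = (d * d - (t\<^sup>2 - 4 * u)) / 4"
    for t d u :: complex by (simp add: field_simps power2_eq_square)
  have 1: "((p + s) + D) / 2 = 0" by (rule root) (simp only: c D, simp)
  have 2: "((p + s) - D) / 2 = 0"
    using root[of "((p + s) + (- D)) / 2"] unfolding c by (simp add: D)
  have "p + s = ((p + s) + D) / 2 + ((p + s) - D) / 2" by (simp add: field_simps)
  then have ps: "p + s = 0" unfolding 1 2 by simp
  then have "D = 0" using 1 by simp
  then have "p * s - q * r = 0" using D ps by simp
  with ps show ?thesis by simp
qed

end

section \<open>Adapted bases\<close>

context complex_lie8 begin

lemma dual_eqI:
  assumes d: "dual \<omega> e" and "\<omega> 1 X = \<omega> 1 Y" "\<omega> 2 X = \<omega> 2 Y" "\<omega> 3 X = \<omega> 3 Y" "\<omega> 4 X = \<omega> 4 Y"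
  shows "X = Y"
  using dual_expand[OF d, of X] dual_expand[OF d, of Y] assms(2-) by simp

lemma P_expand:
  assumes d: "dual \<omega> e"
  shows "P X Y = aa \<omega> 1 2 X Y \<odot> P (e 1) (e 2) + aa \<omega> 1 3 X Y \<odot> P (e 1) (e 3) + aa \<omega> 1 4 X Y \<odot> P (e 1) (e 4)
    + aa \<omega> 2 3 X Y \<odot> P (e 2) (e 3) + aa \<omega> 2 4 X Y \<odot> P (e 2) (e 4) + aa \<omega> 3 4 X Y \<odot> P (e 3) (e 4)"
  by (subst dual_expand[OF d, of X], subst dual_expand[OF d, of Y])
    (simp add: P_lin P_scl P_self P_anti[of "e 1"] P_anti[of "e 2" "e 3"] P_anti[of "e 2" "e 4"]
      P_anti[of "e 3" "e 4"] V.scale_left_diff_distrib V.scale_right_distrib algebra_simps)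

lemma R_expand:
  assumes d: "dual \<omega> e"
  shows "R X Y = hh \<omega> 1 1 X Y \<odot> R (e 1) (e 1) + hh \<omega> 1 2 X Y \<odot> R (e 1) (e 2) + hh \<omega> 1 3 X Y \<odot> R (e 1) (e 3)
    + hh \<omega> 1 4 X Y \<odot> R (e 1) (e 4)
    + hh \<omega> 2 1 X Y \<odot> R (e 2) (e 1) + hh \<omega> 2 2 X Y \<odot> R (e 2) (e 2) + hh \<omega> 2 3 X Y \<odot> R (e 2) (e 3)
    + hh \<omega> 2 4 X Y \<odot> R (e 2) (e 4)
    + hh \<omega> 3 1 X Y \<odot> R (e 3) (e 1) + hh \<omega> 3 2 X Y \<odot> R (e 3) (e 2) + hh \<omega> 3 3 X Y \<odot> R (e 3) (e 3)
    + hh \<omega> 3 4 X Y \<odot> R (e 3) (e 4)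
    + hh \<omega> 4 1 X Y \<odot> R (e 4) (e 1) + hh \<omega> 4 2 X Y \<odot> R (e 4) (e 2) + hh \<omega> 4 3 X Y \<odot> R (e 4) (e 3)
    + hh \<omega> 4 4 X Y \<odot> R (e 4) (e 4)"
  by (subst dual_expand[OF d, of X], subst dual_expand[OF d, of Y])
    (simp add: R_lin R_scl V.scale_right_distrib algebra_simps)

lemmas PR_linear = P_lin(1,2) P_scl P_neg P_diff P_zero P_self R_lin(1,2) R_scl R_neg R_diff R_zero

lemma dual_forms:
  assumes "dual \<omega> e"
  shows "\<omega> 1 (X + Y) = \<omega> 1 X + \<omega> 1 Y" "\<omega> 1 (X - Y) = \<omega> 1 X - \<omega> 1 Y" "\<omega> 1 (- X) = - \<omega> 1 X" "\<omega> 1 0 = 0" "\<omega> 1 (c \<odot> X) = c * \<omega> 1 X"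
    "\<omega> 2 (X + Y) = \<omega> 2 X + \<omega> 2 Y" "\<omega> 2 (X - Y) = \<omega> 2 X - \<omega> 2 Y" "\<omega> 2 (- X) = - \<omega> 2 X" "\<omega> 2 0 = 0" "\<omega> 2 (c \<odot> X) = c * \<omega> 2 X"
    "\<omega> 3 (X + Y) = \<omega> 3 X + \<omega> 3 Y" "\<omega> 3 (X - Y) = \<omega> 3 X - \<omega> 3 Y" "\<omega> 3 (- X) = - \<omega> 3 X" "\<omega> 3 0 = 0" "\<omega> 3 (c \<odot> X) = c * \<omega> 3 X"
    "\<omega> 4 (X + Y) = \<omega> 4 X + \<omega> 4 Y" "\<omega> 4 (X - Y) = \<omega> 4 X - \<omega> 4 Y" "\<omega> 4 (- X) = - \<omega> 4 X" "\<omega> 4 0 = 0" "\<omega> 4 (c \<odot> X) = c * \<omega> 4 X"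
  using dualD(17-20)[OF assms] by (simp_all add: form10)

end

section \<open>Structure equations from a table of values of \<open>P\<close>\<close>

context complex_nil begin

lemma central_dual:
  assumes d: "dual \<omega> e"
    and z: "P (e 1) v = 0" "P (e 2) v = 0" "P (e 3) v = 0" "P (e 4) v = 0"
      "R (e 1) v = 0" "R (e 2) v = 0" "R (e 3) v = 0" "R (e 4) v = 0"
      "R v (e 1) = 0" "R v (e 2) = 0" "R v (e 3) = 0" "R v (e 4) = 0"
  shows "v = 0"
proof (rule central_eq_0)
  show "P v X = 0" "R v X = 0" "R X v = 0" for X
    by (subst dual_expand[OF d, of X],
      simp add: PR_linear z P_anti[of v])+
qed

text \<open>One table serves both origins of Family II: \<open>m = 1\<close> when \<open>P E\<close>
  has rank 2, and \<open>m = 0\<close> with \<open>c = 1\<close> when it has rank 1. As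
  \<open>e 2\<close> and a multiple of \<open>e 3\<close> are values of \<open>P\<close>,
  \<open>R_P\<close> controls \<open>R (e 2)\<close> and \<open>R (e 3)\<close> through
  \<open>R (e 1)\<close>.\<close>

lemma family_II_exists:
  assumes d: "dual \<omega> e" and e4: "e 4 = E"
    and P41: "P (e 4) (e 1) = e 2" and P42: "P (e 4) (e 2) = m \<odot> e 3" and P43: "P (e 4) (e 3) = 0"
    and P12: "P (e 1) (e 2) = c \<odot> e 3" and P13: "P (e 1) (e 3) = 0" and P23: "P (e 2) (e 3) = 0"
    and mc: "m \<noteq> 0 \<or> c \<noteq> 0" and R\<omega>1: "\<And>X Y. \<omega> 1 (R X Y) = 0"
  shows "\<exists>\<epsilon> \<mu> \<nu> a b. (\<epsilon>, \<mu>, \<nu>, a, b) \<in> values_II \<and> admits_equations br J (Eqs_II \<epsilon> \<mu> \<nu> a b)"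
proof -
  note w = dualD(1-16)[OF d] and f = dual_forms[OF d]
  have Pt: "P (e 1) (e 4) = - e 2" "P (e 2) (e 4) = - (m \<odot> e 3)" "P (e 3) (e 4) = 0"
    "P (e 2) (e 1) = - (c \<odot> e 3)" "P (e 3) (e 1) = 0" "P (e 3) (e 2) = 0"
    by (simp_all add: P_anti[of _ "e 4"] P_anti[of "e 2" "e 1"] P_anti[of "e 3" "e 1"] P_anti[of "e 3" "e 2"]
      P41 P42 P43 P12 P13 P23)
  note Pt = Pt P41 P42 P43 P12 P13 P23
  have R4: "R (e 4) Y = P (e 4) Y" and R_4: "R Y (e 4) = 0" for Y
    by (simp_all add: e4 R_E R_right_E)
  define k2 k3 k4 where "k2 = \<omega> 2 (R (e 1) (e 1))" and "k3 = \<omega> 3 (R (e 1) (e 1))" and "k4 = \<omega> 4 (R (e 1) (e 1))"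
  define x y p where "x = \<omega> 2 (R (e 1) (e 2))" and "y = \<omega> 3 (R (e 1) (e 2))" and "p = \<omega> 4 (R (e 1) (e 2))"
  define z t s where "z = \<omega> 2 (R (e 1) (e 3))" and "t = \<omega> 3 (R (e 1) (e 3))" and "s = \<omega> 4 (R (e 1) (e 3))"
  have R11: "R (e 1) (e 1) = k2 \<odot> e 2 + k3 \<odot> e 3 + k4 \<odot> e 4"
    by (rule dual_eqI[OF d]) (simp_all add: f w R\<omega>1 k2_def k3_def k4_def)
  have R12: "R (e 1) (e 2) = x \<odot> e 2 + y \<odot> e 3 + p \<odot> e 4"
    by (rule dual_eqI[OF d]) (simp_all add: f w R\<omega>1 x_def y_def p_def)
  have R13: "R (e 1) (e 3) = z \<odot> e 2 + t \<odot> e 3 + s \<odot> e 4"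
    by (rule dual_eqI[OF d]) (simp_all add: f w R\<omega>1 z_def t_def s_def)
  have tx: "x + t = 0" "x * t = y * z"
  proof -
    have ind: "a = 0 \<and> b = 0" if "a \<odot> e 2 + b \<odot> e 3 + g \<odot> E = 0" for a b g
      using arg_cong[OF that, of "\<omega> 2"] arg_cong[OF that, of "\<omega> 3"] by (simp add: f w flip: e4)
    show "x + t = 0" "x * t = y * z"
      using R_nilpotent2[OF R12[unfolded e4] R13[unfolded e4] ind] by auto
  qed
  have t: "t = - x" using tx(1) by (simp add: eq_neg_iff_add_eq_0 add.commute)
  have xx: "x * x = - (y * z)" using tx(2) unfolding t by (simp add: minus_equation_iff[of "x * x"])
  note tab = R11 R12 R13 R4 R_4 Pt PR_linear f w
  have R2: "R (e 2) Y = R (e 4) (R (e 1) Y) - R (e 1) (R (e 4) Y)" for Y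
    using R_P[of "e 4" "e 1" Y] by (simp only: P41)
  have R21: "R (e 2) (e 1) = (- x) \<odot> e 2 + (m * k2 - y) \<odot> e 3 + (- p) \<odot> e 4"
    unfolding R2 by (rule dual_eqI[OF d]) (simp_all add: tab algebra_simps)
  have R22: "R (e 2) (e 2) = (- (m * z)) \<odot> e 2 + (2 * m * x) \<odot> e 3 + (- (m * s)) \<odot> e 4"
    unfolding R2 by (rule dual_eqI[OF d]) (simp_all add: tab t algebra_simps)
  have R23: "R (e 2) (e 3) = (m * z) \<odot> e 3"
    unfolding R2 by (rule dual_eqI[OF d]) (simp_all add: tab)
  have mz: "m * z = 0"
  proof (rule R_eigen)
    show "R (e 2) (e 3) = (m * z) \<odot> e 3 + 0 \<odot> E" using R23 by simp
    show "e 3 \<noteq> q \<odot> E" for q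
    proof
      assume "e 3 = q \<odot> E"
      from arg_cong[OF this, of "\<omega> 3"] show False by (simp add: f w flip: e4)
    qed
  qed
  have R3m: "cnj m \<odot> R (e 3) Y = R (e 4) (R (e 2) Y) - R (e 2) (R (e 4) Y)" for Y
    using R_P[of "e 4" "e 2" Y] by (simp only: P42 R_scl)
  have R3c: "cnj c \<odot> R (e 3) Y = R (e 1) (R (e 2) Y) - R (e 2) (R (e 1) Y)" for Y
    using R_P[of "e 1" "e 2" Y] by (simp only: P12 R_scl)
  note tab2 = tab R21 R22 R23
  have z: "z = 0"
  proof (cases "m = 0")
    case False then show ?thesis using mz by simp
  next
    \<comment> \<open>Now \<open>e 3\<close> is a value of \<open>P\<close> only through
      \<open>c\<close>. By \<open>R3c\<close>, neither \<open>R (e 3) (e 1)\<close> nor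
      \<open>R (e 3) (e 3)\<close> has components along \<open>e 2\<close> and \<open>e 3\<close>;
      the mixed Jacobi identity then leaves \<open>c * z = 0\<close>.\<close>
    case m: True
    then have c: "c \<noteq> 0" using mc by simp
    have 1: "\<omega> 2 (R (e 3) (e 1)) = 0" "\<omega> 3 (R (e 3) (e 1)) = 0"
      using arg_cong[OF R3c[of "e 1"], of "\<omega> 2"] arg_cong[OF R3c[of "e 1"], of "\<omega> 3"] c xx
      by (simp_all add: tab2 m t)
    have R31: "R (e 3) (e 1) = \<omega> 4 (R (e 3) (e 1)) \<odot> e 4"
      by (rule dual_eqI[OF d]) (simp_all add: f w R\<omega>1 1)
    have "\<omega> 2 (R (e 3) (e 3)) = 0" "\<omega> 3 (R (e 3) (e 3)) = 0"
      using arg_cong[OF R3c[of "e 3"], of "\<omega> 2"] arg_cong[OF R3c[of "e 3"], of "\<omega> 3"] c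
      by (simp_all add: tab2 m t)
    moreover have "c * z - cnj k3 * \<omega> 3 (R (e 3) (e 3)) = 0"
      using arg_cong[OF R_of_P[of "e 1" "e 1" "e 3"], of "\<omega> 3"]
      by (subst (asm) R31) (simp add: tab2 m algebra_simps)
    ultimately show ?thesis using c by simp
  qed
  have x: "x = 0" using xx z by simp
  note zero = x z t
  define Z where "Z = \<omega> 4 (R (e 3) (e 1))"
  have R3z: "g = 0" if "cnj m * g = 0" "cnj c * g = 0" for g using that mc by auto
  have R31: "R (e 3) (e 1) = Z \<odot> e 4"
  proof -
    have "\<omega> 2 (R (e 3) (e 1)) = 0"
      by (rule R3z) (use arg_cong[OF R3m[of "e 1"], of "\<omega> 2"] arg_cong[OF R3c[of "e 1"], of "\<omega> 2"]
        in \<open>simp_all add: tab2 zero\<close>)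
    moreover have "\<omega> 3 (R (e 3) (e 1)) = 0"
      by (rule R3z) (use arg_cong[OF R3m[of "e 1"], of "\<omega> 3"] arg_cong[OF R3c[of "e 1"], of "\<omega> 3"]
        in \<open>simp_all add: tab2 zero\<close>)
    ultimately show ?thesis
      by (intro dual_eqI[OF d]) (simp_all add: f w R\<omega>1 Z_def)
  qed
  have R3: "R (e 3) (e j) = 0" if "j = 2 \<or> j = 3" for j
  proof -
    have "\<omega> 2 (R (e 3) (e j)) = 0"
      by (rule R3z) (use that arg_cong[OF R3m[of "e j"], of "\<omega> 2"] arg_cong[OF R3c[of "e j"], of "\<omega> 2"]
        in \<open>auto simp add: tab2 zero\<close>)
    moreover have "\<omega> 3 (R (e 3) (e j)) = 0"
      by (rule R3z) (use that arg_cong[OF R3m[of "e j"], of "\<omega> 3"] arg_cong[OF R3c[of "e j"], of "\<omega> 3"]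
        in \<open>auto simp add: tab2 zero\<close>)
    moreover have "\<omega> 4 (R (e 3) (e j)) = 0"
      by (rule R3z) (use that arg_cong[OF R3m[of "e j"], of "\<omega> 4"] arg_cong[OF R3c[of "e j"], of "\<omega> 4"]
        in \<open>auto simp add: tab2 zero\<close>)
    ultimately show ?thesis
      by (intro dual_eqI[OF d]) (simp_all add: f R\<omega>1)
  qed
  have R32: "R (e 3) (e 2) = 0" and R33: "R (e 3) (e 3) = 0" by (simp_all add: R3)
  note tab3 = tab2 R31 R32 R33 zero
  \<comment> \<open>With \<open>Z = cnj s\<close> this says that \<open>m * s\<close> equals its
    conjugate; it is the future parameter \<open>\<mu>\<close>.\<close>
  have mZ: "cnj m * Z = m * s"
    using arg_cong[OF R3m[of "e 1"], of "\<omega> 4"] by (simp add: tab3)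
  have sZ: "Z = cnj s"
    using arg_cong[OF R_of_P[of "e 1" "e 1" "e 3"], of "\<omega> 2"] by (simp add: tab3 complex_eq_iff)
  have s: "s \<noteq> 0"
  proof
    assume s: "s = 0"
    have "e 3 = 0" by (rule central_dual[OF d]) (simp_all add: tab3 sZ s)
    then show False using w(11) f(14) by simp
  qed
  have ms: "m * s = of_real (Re (m * s))"
  proof -
    have real: "u = of_real (Re u)" if "cnj u = u" for u using that by (simp add: complex_eq_iff)
    show ?thesis by (rule real) (use mZ sZ in simp)
  qed
  \<comment> \<open>Three coordinates of this identity give in turn that \<open>p\<close> is
    imaginary, that \<open>Im k4\<close> vanishes unless \<open>m = 0\<close>, and the relation for
    \<open>c * s\<close> required by \<open>normalize_II\<close>.\<close>
  have J12: "c \<odot> R (e 1) (e 3) = P (R (e 1) (e 1)) (e 2) + P (e 1) (R (e 1) (e 2)) - R (R (e 1) (e 1)) (e 2) + R (R (e 2) (e 1)) (e 1)"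
    using R_of_P[of "e 1" "e 1" "e 2"] by (simp only: P12 R_scl)
  have p: "Re p = 0" using arg_cong[OF J12, of "\<omega> 2"] by (simp add: tab3 complex_eq_iff)
  have k4: "m = 0 \<or> Im k4 = 0" using arg_cong[OF J12, of "\<omega> 3"] by (auto simp add: tab3 complex_eq_iff)
  have "c * s = cnj k2 * (m * s) + (cnj k2 * (cnj m * Z) - cnj y * Z)"
    using arg_cong[OF J12, of "\<omega> 4"] by (simp add: tab3 algebra_simps)
  then have cs: "c * s = 2 * cnj k2 * of_real (Re (m * s)) - cnj y * cnj s"
    unfolding sZ mZ[unfolded sZ] by (subst ms[symmetric]) simp
  define \<mu> where "\<mu> = Re (m * s)"
  note ms = ms[folded \<mu>_def] and cs = cs[folded \<mu>_def]
  obtain \<omega>' where b': "basis10 J \<omega>'" and h': "has_II \<omega>' (\<i> * s * (m * cnj k2 - c)) \<mu> (Im k4) (\<i> * s * k3) (- Im p)"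
  proof (rule normalize_II[OF dual_basis10[OF d] s ms cs p])
    fix X Y
    show "\<omega> 1 (P X Y) = 0" "\<omega> 2 (P X Y) = aa \<omega> 4 1 X Y" "\<omega> 3 (P X Y) = c * aa \<omega> 1 2 X Y + m * aa \<omega> 4 2 X Y"
      "\<omega> 4 (P X Y) = 0"
      unfolding P_expand[OF d, of X Y] by (simp_all add: tab3 algebra_simps)
    show "\<omega> 1 (R X Y) = 0" by (rule R\<omega>1)
    show "\<omega> 2 (R X Y) = hh \<omega> 4 1 X Y + k2 * hh \<omega> 1 1 X Y"
      "\<omega> 3 (R X Y) = k3 * hh \<omega> 1 1 X Y + y * hh \<omega> 1 2 X Y + (k2 * m - y) * hh \<omega> 2 1 X Y + m * hh \<omega> 4 2 X Y"
      "\<omega> 4 (R X Y) = k4 * hh \<omega> 1 1 X Y + p * (hh \<omega> 1 2 X Y - hh \<omega> 2 1 X Y)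
        - of_real \<mu> * hh \<omega> 2 2 X Y + s * hh \<omega> 1 3 X Y + cnj s * hh \<omega> 3 1 X Y"
      unfolding R_expand[OF d, of X Y] ms[symmetric] by (simp_all add: tab3 sZ algebra_simps)
  qed
  show ?thesis
  proof (rule listed_II[OF b' h'])
    show "\<i> * s * (m * cnj k2 - c) \<noteq> 0 \<or> \<mu> \<noteq> 0"
      using ms s mc by auto
    show "Im k4 = 0" if "\<mu> \<noteq> 0" using that k4 by (auto simp: \<mu>_def)
  qed
qed

end

context complex_nil begin

text \<open>Here \<open>e 3\<close> is the only value of \<open>P\<close> on basis pairs, up to sign
  and zero. \<open>R (e 3)\<close> is again expressed through \<open>R (e 1)\<close>, but
  \<open>R (e 2)\<close> is known only to commute with \<open>R (e 1)\<close>.\<close>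

lemma family_I_exists:
  assumes d: "dual \<omega> e" and e4: "e 4 = E"
    and P41: "P (e 4) (e 1) = e 3" and P42: "P (e 4) (e 2) = 0" and P43: "P (e 4) (e 3) = 0"
    and P12: "P (e 1) (e 2) = 0" and P13: "P (e 1) (e 3) = 0" and P23: "P (e 2) (e 3) = 0"
    and R\<omega>1: "\<And>X Y. \<omega> 1 (R X Y) = 0"
  shows "\<exists>\<delta> \<epsilon> \<nu> a b. \<delta> \<in> {1, -1} \<and> (\<epsilon>, \<nu>, a, b) \<in> values_I \<and> admits_equations br J (Eqs_I \<delta> \<epsilon> \<nu> a b)"
proof -
  note w = dualD(1-16)[OF d] and f = dual_forms[OF d]
  have Pt: "P (e 1) (e 4) = - e 3" "P (e 2) (e 4) = 0" "P (e 3) (e 4) = 0"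
    "P (e 2) (e 1) = 0" "P (e 3) (e 1) = 0" "P (e 3) (e 2) = 0"
    by (simp_all add: P_anti[of _ "e 4"] P_anti[of "e 2" "e 1"] P_anti[of "e 3" "e 1"] P_anti[of "e 3" "e 2"]
      P41 P42 P43 P12 P13 P23)
  note Pt = Pt P41 P42 P43 P12 P13 P23
  have R4: "R (e 4) Y = P (e 4) Y" and R_4: "R Y (e 4) = 0" for Y
    by (simp_all add: e4 R_E R_right_E)
  define k2 k3 k4 where "k2 = \<omega> 2 (R (e 1) (e 1))" and "k3 = \<omega> 3 (R (e 1) (e 1))" and "k4 = \<omega> 4 (R (e 1) (e 1))"
  define a2 a3 a4 where "a2 = \<omega> 2 (R (e 1) (e 2))" and "a3 = \<omega> 3 (R (e 1) (e 2))" and "a4 = \<omega> 4 (R (e 1) (e 2))"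
  define b2 b3 q where "b2 = \<omega> 2 (R (e 1) (e 3))" and "b3 = \<omega> 3 (R (e 1) (e 3))" and "q = \<omega> 4 (R (e 1) (e 3))"
  define l2 l3 l4 where "l2 = \<omega> 2 (R (e 2) (e 1))" and "l3 = \<omega> 3 (R (e 2) (e 1))" and "l4 = \<omega> 4 (R (e 2) (e 1))"
  define n2 n3 n4 where "n2 = \<omega> 2 (R (e 2) (e 2))" and "n3 = \<omega> 3 (R (e 2) (e 2))" and "n4 = \<omega> 4 (R (e 2) (e 2))"
  have R11: "R (e 1) (e 1) = k2 \<odot> e 2 + k3 \<odot> e 3 + k4 \<odot> e 4"
    by (rule dual_eqI[OF d]) (simp_all add: f w R\<omega>1 k2_def k3_def k4_def)
  have R12: "R (e 1) (e 2) = a2 \<odot> e 2 + a3 \<odot> e 3 + a4 \<odot> e 4"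
    by (rule dual_eqI[OF d]) (simp_all add: f w R\<omega>1 a2_def a3_def a4_def)
  have R13: "R (e 1) (e 3) = b2 \<odot> e 2 + b3 \<odot> e 3 + q \<odot> e 4"
    by (rule dual_eqI[OF d]) (simp_all add: f w R\<omega>1 b2_def b3_def q_def)
  have R21: "R (e 2) (e 1) = l2 \<odot> e 2 + l3 \<odot> e 3 + l4 \<odot> e 4"
    by (rule dual_eqI[OF d]) (simp_all add: f w R\<omega>1 l2_def l3_def l4_def)
  have R22: "R (e 2) (e 2) = n2 \<odot> e 2 + n3 \<odot> e 3 + n4 \<odot> e 4"
    by (rule dual_eqI[OF d]) (simp_all add: f w R\<omega>1 n2_def n3_def n4_def)
  note tab = R11 R12 R13 R21 R22 R4 R_4 Pt PR_linear f w
  have R3: "R (e 3) Y = R (e 4) (R (e 1) Y) - R (e 1) (R (e 4) Y)" for Y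
    using R_P[of "e 4" "e 1" Y] by (simp only: P41)
  have R31: "R (e 3) (e 1) = - (b2 \<odot> e 2 + b3 \<odot> e 3 + q \<odot> e 4)" and R32: "R (e 3) (e 2) = 0"
    and R33: "R (e 3) (e 3) = 0"
    unfolding R3 by (simp_all add: tab)
  have R23: "R (e 2) (e 3) = 0"
    using R_P[of "e 4" "e 2" "e 1"] by (simp add: tab)
  note tab2 = tab R31 R32 R33 R23
  have ind: "x = 0 \<and> y = 0" if "x \<odot> e 2 + y \<odot> e 3 + g \<odot> E = 0" for x y g
    using arg_cong[OF that, of "\<omega> 2"] arg_cong[OF that, of "\<omega> 3"] by (simp add: f w flip: e4)
  have ab: "a2 + b3 = 0" "a2 * b3 = a3 * b2"
    using R_nilpotent2[OF R12[unfolded e4] R13[unfolded e4] ind] by auto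
  have R23': "R (e 2) (e 3) = 0 \<odot> e 2 + 0 \<odot> e 3 + 0 \<odot> E" by (simp add: R23)
  have n2: "n2 = 0"
    using R_nilpotent2[OF R22[unfolded e4] R23' ind] by auto
  have comm: "R (e 1) (R (e 2) Y) = R (e 2) (R (e 1) Y)" for Y
    using R_P[of "e 1" "e 2" Y] by (simp add: P12 R_zero)
  have J131: "P (R (e 1) (e 1)) (e 3) + P (e 1) (R (e 1) (e 3)) - R (R (e 1) (e 1)) (e 3) + R (R (e 3) (e 1)) (e 1) = 0"
    using R_of_P[of "e 1" "e 1" "e 3"] by (simp only: P13 R_zero)
  have J121: "P (R (e 1) (e 1)) (e 2) + P (e 1) (R (e 1) (e 2)) - R (R (e 1) (e 1)) (e 2) + R (R (e 2) (e 1)) (e 1) = 0"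
    using R_of_P[of "e 1" "e 1" "e 2"] by (simp only: P12 R_zero)
  \<comment> \<open>For nonzero \<open>b2\<close>, the vector \<open>?v\<close> below, which is
    \<open>R (e 1) (e 3)\<close> without its \<open>e 4\<close> component, would be annihilated by
    \<open>P\<close> and \<open>R\<close> from both sides. The numbered relations are the
    coordinates needed for this.\<close>
  have b2: "b2 = 0"
  proof (rule ccontr)
    assume b2: "b2 \<noteq> 0"
    have J: "P (R (e 1) (e 2)) (e 3) + P (e 2) (R (e 1) (e 3)) - R (R (e 2) (e 1)) (e 3) + R (R (e 3) (e 1)) (e 2) = 0"
      using R_of_P[of "e 1" "e 2" "e 3"] by (simp only: P23 R_zero)
    have n34: "n3 = 0" "n4 = 0"
      using arg_cong[OF J, of "\<omega> 3"] arg_cong[OF J, of "\<omega> 4"] b2 by (simp_all add: tab2)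
    have 2: "cnj b2 * l2 = cnj b3 * b2" and 3: "q + cnj b2 * l3 + cnj q = cnj b3 * b3" and 4: "cnj b2 * l4 = cnj b3 * q"
      using arg_cong[OF J131, of "\<omega> 2"] arg_cong[OF J131, of "\<omega> 3"] arg_cong[OF J131, of "\<omega> 4"]
      by (simp_all add: tab2 n34 algebra_simps)
    have 5: "a4 = cnj l2 * l3 - cnj l3 * b3 + cnj l4"
      using arg_cong[OF J121, of "\<omega> 3"] by (simp add: tab2 n34 algebra_simps)
    have "l2 * a2 + l3 * b2 = 0"
      using arg_cong[OF comm[of "e 1"], of "\<omega> 2"] by (simp add: tab2 n2)
    moreover have a2: "a2 = - b3" using ab(1) by (simp add: eq_neg_iff_add_eq_0)
    ultimately have 6: "b2 * l3 = l2 * b3" by (simp add: algebra_simps)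
    have "b2 * (cnj b2 * l3) = (cnj b2 * l2) * b3" using 6 by (simp add: algebra_simps)
    then have "b2 * (cnj b2 * l3) = b2 * (cnj b3 * b3)" unfolding 2 by (simp add: algebra_simps)
    then have 7: "cnj b2 * l3 = cnj b3 * b3" using b2 by simp
    then have qq: "cnj q = - q" using 3 by (simp add: algebra_simps eq_neg_iff_add_eq_0)
    have c: "b2 * cnj l2 = b3 * cnj b2" "b2 * cnj l3 = b3 * cnj b3" "b2 * cnj l4 = b3 * cnj q"
      using arg_cong[OF 2, of cnj] arg_cong[OF 7, of cnj] arg_cong[OF 4, of cnj] by simp_all
    have "b2 * a4 = (b2 * cnj l2) * l3 - (b2 * cnj l3) * b3 + b2 * cnj l4"
      unfolding 5 by (simp add: algebra_simps)
    also have "\<dots> = b3 * (cnj b2 * l3) - b3 * (cnj b3 * b3) + b3 * cnj q" unfolding c by (simp add: algebra_simps)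
    also have "\<dots> = - b3 * q" unfolding 7 qq by simp
    finally have h: "b2 * a4 + b3 * q = 0" by simp
    let ?v = "b2 \<odot> e 2 + b3 \<odot> e 3"
    have "a3 * b2 = - (b3 * b3)" using ab(2) unfolding a2 by simp
    then have "b2 * a3 + b3 * b3 = 0" by (simp add: mult.commute[of b2])
    then have R1v: "R (e 1) ?v = 0"
      by (intro dual_eqI[OF d]) (simp_all add: tab2 a2 h)
    have Rv1: "R ?v (e 1) = 0"
      by (intro dual_eqI[OF d]) (simp_all add: tab2 2 4 7)
    have "?v = 0"
      by (rule central_dual[OF d]) (simp_all only: R1v Rv1, simp_all add: tab2 n2 n34)
    then have "\<omega> 2 ?v = 0" by (simp only: f)
    then show False using b2 by (simp add: f w)
  qed
  have b3: "b3 = 0" and a2: "a2 = 0" using ab b2 by auto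
  note tab3 = tab2 b2 b3 a2 n2
  have qq: "cnj q = - q" using arg_cong[OF J131, of "\<omega> 3"] by (simp add: tab3 eq_neg_iff_add_eq_0 add.commute)
  have q: "q \<noteq> 0"
  proof
    assume q: "q = 0"
    have "e 3 = 0" by (rule central_dual[OF d]) (simp_all add: tab3 q)
    then show False using w(11) f(14) by simp
  qed
  have n3: "n3 = 0" using arg_cong[OF comm[of "e 2"], of "\<omega> 4"] q by (simp add: tab3)
  have l2: "l2 = 0" using arg_cong[OF J121, of "\<omega> 2"] by (simp add: tab3)
  have l4: "l4 = cnj a4"
    using arg_cong[OF J121, of "\<omega> 3"] by (simp add: tab3 n3 l2 complex_eq_iff)
  have l3: "l3 * q = k2 * n4" using arg_cong[OF comm[of "e 1"], of "\<omega> 4"] by (simp add: tab3 n3 l2)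
  have "P (R (e 2) (e 1)) (e 2) + P (e 1) (R (e 2) (e 2)) - R (R (e 1) (e 2)) (e 2) + R (R (e 2) (e 2)) (e 1) = 0"
    using R_of_P[of "e 2" "e 1" "e 2"] by (simp only: P12 R_zero)
  from arg_cong[OF this, of "\<omega> 3"] have n4: "n4 = of_real (Re n4)"
    by (simp add: tab3 n3 complex_eq_iff)
  define b where "b = Re n4"
  \<comment> \<open>By \<open>qq\<close>, \<open>q\<close> is imaginary; the sign is that of the
    \<open>hh \<omega> 1 3\<close> term in \<open>has_I\<close>.\<close>
  define \<delta> where "\<delta> = - Im q"
  have q\<delta>: "q = - \<i> * of_real \<delta>" using qq by (simp add: \<delta>_def complex_eq_iff)
  have \<delta>: "\<delta> \<noteq> 0" using q q\<delta> by auto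
  note n4 = n4[folded b_def]
  have l3': "l3 = \<i> * k2 * of_real (b / \<delta>)"
  proof -
    have "l3 * of_real \<delta> = \<i> * (l3 * q)" by (simp add: q\<delta> mult.left_commute[of l3])
    also have "\<dots> = \<i> * (k2 * of_real b)" using l3 by (simp flip: n4)
    finally show ?thesis using \<delta> by (simp add: field_simps)
  qed
  obtain \<omega>' where b': "basis10 J \<omega>'" and h': "has_I \<omega>' k2 (Im k4) a3 b \<delta>"
  proof (rule normalize_I[OF dual_basis10[OF d] \<delta> l3'])
    fix X Y
    show "\<omega> 1 (P X Y) = 0" "\<omega> 2 (P X Y) = 0" "\<omega> 3 (P X Y) = aa \<omega> 4 1 X Y" "\<omega> 4 (P X Y) = 0"
      unfolding P_expand[OF d, of X Y] by (simp_all add: tab3 algebra_simps)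
    show "\<omega> 1 (R X Y) = 0" by (rule R\<omega>1)
    show "\<omega> 2 (R X Y) = k2 * hh \<omega> 1 1 X Y"
      "\<omega> 3 (R X Y) = hh \<omega> 4 1 X Y + k3 * hh \<omega> 1 1 X Y + a3 * hh \<omega> 1 2 X Y + l3 * hh \<omega> 2 1 X Y"
      "\<omega> 4 (R X Y) = k4 * hh \<omega> 1 1 X Y + a4 * hh \<omega> 1 2 X Y + cnj a4 * hh \<omega> 2 1 X Y
        + of_real b * hh \<omega> 2 2 X Y + \<i> * of_real \<delta> * (hh \<omega> 3 1 X Y - hh \<omega> 1 3 X Y)"
      unfolding R_expand[OF d, of X Y] n4[symmetric]
      by (simp_all add: tab3 l2 l4 n3 q\<delta> algebra_simps)
  qed
  \<comment> \<open>If both vanished, the second vector of the normalized basis would be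
    central.\<close>
  have "a3 \<noteq> 0 \<or> b \<noteq> 0"
  proof (rule ccontr)
    assume "\<not> ?thesis"
    then have 0: "a3 = 0" "b = 0" by auto
    obtain e' where d': "dual \<omega>' e'" using basis10_dual[OF b'] by blast
    note h = has_ID[OF h'] and w' = dualD(1-16)[OF d'] and f' = dual_forms[OF d']
    have "e' 2 = 0"
      by (rule central_dual[OF d'], rule_tac [!] dual_eqI[OF d']) (simp_all add: h w' f' 0)
    then show False using w'(6) f'(9) by simp
  qed
  then show ?thesis by (rule listed_I[OF b' h' \<delta>])
qed

text \<open>A component of \<open>P (e 1) (e 3)\<close> along \<open>E\<close> is the last
  alternative to Family I in the rank 1 case. The vanishing trace and determinant of
  \<open>R (e 1)\<close> modulo \<open>E\<close> contradict the Jacobi identity if it is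
  present.\<close>

lemma no_central_commutator:
  assumes d: "dual \<omega> e" and e4: "e 4 = E"
    and P41: "P (e 4) (e 1) = e 2" and P42: "P (e 4) (e 2) = 0" and P43: "P (e 4) (e 3) = 0"
    and P12: "P (e 1) (e 2) = 0" and P13: "P (e 1) (e 3) = c \<odot> e 4" and P23: "P (e 2) (e 3) = 0"
    and R\<omega>1: "\<And>X Y. \<omega> 1 (R X Y) = 0"
  shows "c = 0"
proof (rule ccontr)
  assume c: "c \<noteq> 0"
  note w = dualD(1-16)[OF d] and f = dual_forms[OF d]
  have Pt: "P (e 1) (e 4) = - e 2" "P (e 2) (e 4) = 0" "P (e 3) (e 4) = 0"
    "P (e 2) (e 1) = 0" "P (e 3) (e 1) = - (c \<odot> e 4)" "P (e 3) (e 2) = 0"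
    by (simp_all add: P_anti[of _ "e 4"] P_anti[of "e 2" "e 1"] P_anti[of "e 3" "e 1"] P_anti[of "e 3" "e 2"]
      P41 P42 P43 P12 P13 P23)
  note Pt = Pt P41 P42 P43 P12 P13 P23
  have R4: "R (e 4) Y = P (e 4) Y" and R_4: "R Y (e 4) = 0" for Y
    by (simp_all add: e4 R_E R_right_E)
  define k2 k3 k4 where "k2 = \<omega> 2 (R (e 1) (e 1))" and "k3 = \<omega> 3 (R (e 1) (e 1))" and "k4 = \<omega> 4 (R (e 1) (e 1))"
  define x y z where "x = \<omega> 2 (R (e 1) (e 2))" and "y = \<omega> 3 (R (e 1) (e 2))" and "z = \<omega> 4 (R (e 1) (e 2))"
  define x' y' z' where "x' = \<omega> 2 (R (e 1) (e 3))" and "y' = \<omega> 3 (R (e 1) (e 3))" and "z' = \<omega> 4 (R (e 1) (e 3))"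
  define l2 l3 l4 where "l2 = \<omega> 2 (R (e 3) (e 1))" and "l3 = \<omega> 3 (R (e 3) (e 1))" and "l4 = \<omega> 4 (R (e 3) (e 1))"
  define n2 n3 n4 where "n2 = \<omega> 2 (R (e 3) (e 3))" and "n3 = \<omega> 3 (R (e 3) (e 3))" and "n4 = \<omega> 4 (R (e 3) (e 3))"
  have R11: "R (e 1) (e 1) = k2 \<odot> e 2 + k3 \<odot> e 3 + k4 \<odot> e 4"
    by (rule dual_eqI[OF d]) (simp_all add: f w R\<omega>1 k2_def k3_def k4_def)
  have R12: "R (e 1) (e 2) = x \<odot> e 2 + y \<odot> e 3 + z \<odot> e 4"
    by (rule dual_eqI[OF d]) (simp_all add: f w R\<omega>1 x_def y_def z_def)
  have R13: "R (e 1) (e 3) = x' \<odot> e 2 + y' \<odot> e 3 + z' \<odot> e 4"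
    by (rule dual_eqI[OF d]) (simp_all add: f w R\<omega>1 x'_def y'_def z'_def)
  have R31: "R (e 3) (e 1) = l2 \<odot> e 2 + l3 \<odot> e 3 + l4 \<odot> e 4"
    by (rule dual_eqI[OF d]) (simp_all add: f w R\<omega>1 l2_def l3_def l4_def)
  have R33: "R (e 3) (e 3) = n2 \<odot> e 2 + n3 \<odot> e 3 + n4 \<odot> e 4"
    by (rule dual_eqI[OF d]) (simp_all add: f w R\<omega>1 n2_def n3_def n4_def)
  note tab = R11 R12 R13 R31 R33 R4 R_4 Pt PR_linear f w
  have R2: "R (e 2) Y = R (e 4) (R (e 1) Y) - R (e 1) (R (e 4) Y)" for Y
    using R_P[of "e 4" "e 1" Y] by (simp only: P41)
  have R21: "R (e 2) (e 1) = - (x \<odot> e 2 + y \<odot> e 3 + z \<odot> e 4)" and R22: "R (e 2) (e 2) = 0"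
    and R23: "R (e 2) (e 3) = 0"
    unfolding R2 by (simp_all add: tab)
  have R32: "R (e 3) (e 2) = 0"
    using R_P[of "e 4" "e 3" "e 1"] by (simp add: tab)
  note tab2 = tab R21 R22 R23 R32
  have ind: "a = 0 \<and> b = 0" if "a \<odot> e 2 + b \<odot> e 3 + g \<odot> E = 0" for a b g
    using arg_cong[OF that, of "\<omega> 2"] arg_cong[OF that, of "\<omega> 3"] by (simp add: f w flip: e4)
  have xy: "x + y' = 0" "x * y' = y * x'"
    using R_nilpotent2[OF R12[unfolded e4] R13[unfolded e4] ind] by auto
  have R32': "R (e 3) (e 2) = 0 \<odot> e 2 + 0 \<odot> e 3 + 0 \<odot> E" by (simp add: R32)
  have n3: "n3 = 0"
    using R_nilpotent2[OF R32' R33[unfolded e4] ind] by auto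
  have comm: "cnj c \<odot> R (e 4) Y = R (e 1) (R (e 3) Y) - R (e 3) (R (e 1) Y)" for Y
    using R_P[of "e 1" "e 3" Y] by (simp only: P13 R_scl)
  have J: "c \<odot> R (e 1) (e 4) = P (R (e 1) (e 1)) (e 3) + P (e 1) (R (e 1) (e 3)) - R (R (e 1) (e 1)) (e 3) + R (R (e 3) (e 1)) (e 1)"
    using R_of_P[of "e 1" "e 1" "e 3"] by (simp only: P13 R_scl)
  have l3: "cnj l3 * l3 = cnj l2 * y" using arg_cong[OF J, of "\<omega> 3"] by (simp add: tab2 n3)
  \<comment> \<open>The right side \<open>cnj c\<close> is nonzero; it contradicts \<open>E2\<close>
    if \<open>y\<close> is nonzero and makes \<open>e 2\<close> central if \<open>y\<close>
    vanishes.\<close>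
  have E2: "l2 * x + l3 * x' - k3 * n2 = cnj c" and E3: "l2 * y + l3 * y' = 0"
    using arg_cong[OF comm[of "e 1"], of "\<omega> 2"] arg_cong[OF comm[of "e 1"], of "\<omega> 3"]
    by (simp_all add: tab2 n3)
  have F: "y * n2 = 0" using arg_cong[OF comm[of "e 2"], of "\<omega> 2"] by (simp add: tab2 n3)
  have G: "n2 * z = y' * n4" using arg_cong[OF comm[of "e 3"], of "\<omega> 4"] by (simp add: tab2 n3)
  have y': "y' = - x" using xy(1) by (simp add: eq_neg_iff_add_eq_0 add.commute)
  show False
  proof (cases "y = 0")
    case False
    then have n2: "n2 = 0" using F by simp
    \<comment> \<open>The vanishing determinant in \<open>xy\<close> carries \<open>E3\<close> over
      to the left side of \<open>E2\<close>.\<close>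
    have "y * (l2 * x + l3 * x') = x * (l2 * y + l3 * y')"
      using xy(2) by (simp add: algebra_simps)
    then have "l2 * x + l3 * x' = 0" using False E3 by simp
    then show False using E2 n2 c by simp
  next
    case y: True
    then have l3: "l3 = 0" using l3 by simp
    have "x = 0" using xy(2) y y' by simp
    \<comment> \<open>\<open>E2\<close> now reads \<open>- k3 * n2 = cnj c\<close>, and
      \<open>G\<close> gives \<open>z = 0\<close>; all coordinates of \<open>R (e 1) (e 2)\<close>
      vanish.\<close>
    then have "n2 \<noteq> 0" and z: "z = 0" using E2 G l3 c y y' by auto
    have "e 2 = 0" by (rule central_dual[OF d]) (simp_all add: tab2 \<open>x = 0\<close> y z)
    then show False using w(6) f(9) by simp
  qed
qed

end

section \<open>Choice of the basis according to the rank of \<open>P E\<close>\<close>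

context complex_nil begin

definition listed :: bool where
  "listed \<longleftrightarrow> (\<exists>\<delta> \<epsilon> \<nu> a b. \<delta> \<in> {1, -1} \<and> (\<epsilon>, \<nu>, a, b) \<in> values_I \<and> admits_equations br J (Eqs_I \<delta> \<epsilon> \<nu> a b)) \<or>
     (\<exists>\<epsilon> \<mu> \<nu> a b. (\<epsilon>, \<mu>, \<nu>, a, b) \<in> values_II \<and> admits_equations br J (Eqs_II \<epsilon> \<mu> \<nu> a b))"

text \<open>Read from the other side, \<open>E\<close> is an eigenvector of the nilpotent map
  \<open>P v\<close>.\<close>

lemma P_E_neq: "P E v = z \<odot> E \<Longrightarrow> z = 0"
proof -
  assume "P E v = z \<odot> E"
  then have "P v E = (- z) \<odot> E" by (simp add: P_anti[of v E])
  from P_eigen[OF this E_nonzero] show "z = 0" by simp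
qed

lemma listed_rank2:
  assumes "P E (P E v) \<noteq> 0"
  shows listed
proof -
  obtain s where s: "\<And>X v. (P X ^^ s) v = 0" using nilpotent_PR by blast
  have "v \<noteq> 0" using assms by (auto simp: P_zero)
  then obtain n where n: "n > 0" "(P E ^^ (n - 1)) v \<noteq> 0" "\<And>m. m \<ge> n \<Longrightarrow> (P E ^^ m) v = 0"
    using pow_zero_imp[where f = "P E" and s = s and u = v, OF s P_zero(2)] by metis
  have n3: "n \<ge> 3"
  proof (rule ccontr)
    assume "\<not> n \<ge> 3"
    then have "(P E ^^ 2) v = 0" by (intro n(3)) simp
    then show False using assms by (simp add: numeral_2_eq_2)
  qed
  \<comment> \<open>Moving along the chain of \<open>v\<close> makes the third power of
    \<open>P E\<close> vanish on \<open>a\<close> while the second does not.\<close>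
  define a where "a = (P E ^^ (n - 3)) v"
  have idx: "n - 1 = Suc (Suc (n - 3))" "n = Suc (Suc (Suc (n - 3)))" using n3 by auto
  have a2: "P E (P E a) \<noteq> 0"
    using n(2) unfolding idx(1) by (simp add: a_def)
  have a3: "P E (P E (P E a)) = 0"
  proof -
    have "(P E ^^ Suc (Suc (Suc (n - 3)))) v = 0" using n(3)[of n] idx(2) by simp
    then show ?thesis by (simp add: a_def)
  qed
  have ind: "w = 0 \<and> x = 0 \<and> y = 0 \<and> z = 0" if 0: "w \<odot> a + x \<odot> P E a + y \<odot> P E (P E a) + z \<odot> E = 0" for w x y z
  proof -
    have "w \<odot> P E (P E a) = 0"
      using arg_cong[OF 0, of "\<lambda>u. P E (P E u)"] by (simp add: PR_linear a3)
    then have w: "w = 0" using a2 by simp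
    have "x \<odot> P E (P E a) = 0"
      using arg_cong[OF 0, of "P E"] by (simp add: PR_linear a3 w)
    then have x: "x = 0" using a2 by simp
    have "P E (y \<odot> P E a) = (- z) \<odot> E"
      using 0 by (simp add: w x PR_linear eq_neg_iff_add_eq_0)
    then have z: "z = 0" using P_E_neq by fastforce
    show ?thesis using 0 a2 by (simp add: w x z)
  qed
  obtain \<omega> e where d: "dual \<omega> e" and e: "e 1 = a" "e 2 = P E a" "e 3 = P E (P E a)" "e 4 = E"
    using dual_exists[of a "P E a" "P E (P E a)" E] ind by metis
  have P41: "P (e 4) (e 1) = e 2" and P42: "P (e 4) (e 2) = 1 \<odot> e 3" and P43: "P (e 4) (e 3) = 0"
    by (simp_all add: e a3)
  note w = dualD(1-16)[OF d] and f = dual_forms[OF d]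
  obtain U where U: "V.subspace U" "E \<in> U" "U \<noteq> UNIV" "\<And>X Y. P X Y \<in> U" "\<And>X Y. R X Y \<in> U"
    using proper_ideal by blast
  have mem: "e 2 \<in> U" "e 3 \<in> U" "e 4 \<in> U" by (simp_all add: e U)
  \<comment> \<open>\<open>U\<close> is proper and contains \<open>e 2\<close>, \<open>e 3\<close>
    and \<open>e 4\<close>, so it lies in the kernel of \<open>\<omega> 1\<close>; hence
    \<open>\<omega> 1\<close> annihilates all values of \<open>P\<close> and
    \<open>R\<close>.\<close>
  have \<omega>U: "\<omega> 1 u = 0" if u: "u \<in> U" for u
  proof (rule ccontr)
    assume nz: "\<omega> 1 u \<noteq> 0"
    have "e 1 = (1 / \<omega> 1 u) \<odot> (u - (\<omega> 2 u \<odot> e 2 + \<omega> 3 u \<odot> e 3 + \<omega> 4 u \<odot> e 4))"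
      by (rule dual_eqI[OF d]) (use nz in \<open>simp_all add: f w\<close>)
    also have "\<dots> \<in> U" by (intro V.subspace_scale V.subspace_diff V.subspace_add U(1) u mem)
    finally have e1: "e 1 \<in> U" .
    have "X \<in> U" for X
      by (subst dual_expand[OF d, of X]) (intro V.subspace_scale V.subspace_add U(1) e1 mem)
    then show False using U(3) by blast
  qed
  have \<omega>P: "\<omega> 1 (P X Y) = 0" and \<omega>R: "\<omega> 1 (R X Y) = 0" for X Y using \<omega>U U by blast+
  define x y z where "x = \<omega> 2 (P (e 1) (e 2))" and "y = \<omega> 3 (P (e 1) (e 2))" and "z = \<omega> 4 (P (e 1) (e 2))"
  have P12: "P (e 1) (e 2) = x \<odot> e 2 + y \<odot> e 3 + z \<odot> e 4"
    by (rule dual_eqI[OF d]) (simp_all add: f w \<omega>P x_def y_def z_def)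
  have Pt: "P (e 2) (e 4) = - e 3" "P (e 1) (e 4) = - e 2" "P (e 3) (e 4) = 0"
    by (simp_all add: P_anti[of _ "e 4"] P41 P42 P43)
  have P13: "P (e 1) (e 3) = x \<odot> e 3"
    using jacobi_P[of "e 4" "e 1" "e 2"] by (simp add: P12 P41 P42 P43 Pt PR_linear)
  have e3: "e 3 \<noteq> 0" using a2 by (simp add: e)
  have x: "x = 0" by (rule P_eigen[OF P13 e3])
  then have P13: "P (e 1) (e 3) = 0" using P13 by simp
  have P23: "P (e 2) (e 3) = 0"
    using jacobi_P[of "e 4" "e 1" "e 3"] by (simp add: P13 P41 P42 P43 Pt PR_linear P_anti[of "e 3" "e 2"])
  \<comment> \<open>The chain of \<open>e 4\<close> under \<open>P (e 1)\<close> closes up: its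
    third power is \<open>- z\<close> times the first. Nilpotency therefore kills
    \<open>z\<close>.\<close>
  have A: "P (e 1) (P (e 1) (e 4)) = - (y \<odot> e 3 + z \<odot> e 4)"
    by (simp add: Pt P12 x PR_linear)
  have z: "z = 0"
  proof (cases "P (e 1) (P (e 1) (e 4)) = 0")
    case True
    from arg_cong[OF this, of "\<omega> 4"] show ?thesis unfolding A by (simp add: f w)
  next
    case False
    have "P (e 1) (P (e 1) (P (e 1) (e 4))) = 0 \<odot> P (e 1) (P (e 1) (e 4)) + (- z) \<odot> P (e 1) (e 4) + 0 \<odot> e 4"
      unfolding A by (simp add: Pt P13 PR_linear)
    from P_nilpotent3[OF False this] show ?thesis by simp
  qed
  have P12: "P (e 1) (e 2) = y \<odot> e 3" using P12 by (simp add: x z)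
  show ?thesis unfolding listed_def
    using family_II_exists[OF d e(4) P41 P42 P43 P12 P13 P23 _ \<omega>R] by simp
qed

text \<open>If \<open>P (e 1) (e 2)\<close> has a component along \<open>e 3\<close>, it can replace
  \<open>e 3\<close> and Family II results with \<open>m = 0\<close>. Otherwise
  \<open>P (e 1) (e 2)\<close> vanishes, a modified \<open>e 3\<close> is annihilated by
  \<open>P (e 1)\<close>, and Family I results.\<close>

lemma listed_rank1_closed:
  assumes d: "dual \<omega> e" and e4: "e 4 = E"
    and P41: "P (e 4) (e 1) = e 2" and P42: "P (e 4) (e 2) = 0" and P43: "P (e 4) (e 3) = 0"
    and \<omega>P: "\<And>X Y. \<omega> 1 (P X Y) = 0" and \<omega>R: "\<And>X Y. \<omega> 1 (R X Y) = 0"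
  shows listed
proof -
  note w = dualD(1-16)[OF d] and f = dual_forms[OF d]
  have Pt: "P (e 2) (e 4) = 0" "P (e 1) (e 4) = - e 2" "P (e 3) (e 4) = 0"
    by (simp_all add: P_anti[of _ "e 4"] P41 P42 P43)
  have P4: "P (e 4) v = \<omega> 1 v \<odot> e 2" for v
    by (subst dual_expand[OF d, of v]) (simp add: P41 P42 P43 PR_linear)
  have P23: "P (e 2) (e 3) = 0"
    using jacobi_P[of "e 4" "e 1" "e 3"] by (simp add: P4 \<omega>P w Pt PR_linear P_anti[of "e 3" "e 2"])
  have e2: "e 2 \<noteq> 0" using w(6) f(9) by auto
  define y2 y3 y4 where "y2 = \<omega> 2 (P (e 1) (e 2))" and "y3 = \<omega> 3 (P (e 1) (e 2))" and "y4 = \<omega> 4 (P (e 1) (e 2))"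
  have P12: "P (e 1) (e 2) = y2 \<odot> e 2 + y3 \<odot> e 3 + y4 \<odot> e 4"
    by (rule dual_eqI[OF d]) (simp_all add: f w \<omega>P y2_def y3_def y4_def)
  \<comment> \<open>The new bases keep the first coordinate form, so its annihilation of
    \<open>R\<close> carries over.\<close>
  have same: "\<omega>' 1 v = \<omega> 1 v" if d': "dual \<omega>' e'" and "\<omega>' 1 (e 1) = 1" "\<omega>' 1 (e 2) = 0" "\<omega>' 1 (e 3) = 0" "\<omega>' 1 (e 4) = 0"
    for \<omega>' e' v
    using dual_expand_form[OF d dualD(17)[OF d'], of v] that(2-) by simp
  show ?thesis
  proof (cases "y3 = 0")
    case False
    let ?c = "P (e 1) (e 2)"
    have ind: "w = 0 \<and> x = 0 \<and> y = 0 \<and> z = 0" if 0: "w \<odot> e 1 + x \<odot> e 2 + y \<odot> ?c + z \<odot> e 4 = 0" for w x y z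
      using arg_cong[OF 0, of "\<omega> 1"] arg_cong[OF 0, of "\<omega> 2"] arg_cong[OF 0, of "\<omega> 3"] arg_cong[OF 0, of "\<omega> 4"] False
      by (simp add: P12 f dualD(1-16)[OF d])
    obtain \<omega>' e' where d': "dual \<omega>' e'" and e': "e' 1 = e 1" "e' 2 = e 2" "e' 3 = ?c" "e' 4 = e 4"
      using dual_exists[of "e 1" "e 2" ?c "e 4"] ind by metis
    note w' = dualD(1-16)[OF d'] and f' = dual_forms[OF d']
    have "\<omega>' 1 ?c = 0" using w'(9) e' by simp
    then have "\<omega>' 1 (e 3) = 0" using False w' by (simp add: P12 f' e')
    then have \<omega>': "\<omega>' 1 v = \<omega> 1 v" for v using same[OF d'] w' by (simp add: e')
    define \<alpha>2 \<alpha>3 \<alpha>4 where "\<alpha>2 = \<omega>' 2 (P (e 1) ?c)" and "\<alpha>3 = \<omega>' 3 (P (e 1) ?c)" and "\<alpha>4 = \<omega>' 4 (P (e 1) ?c)"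
    have P13: "P (e 1) ?c = \<alpha>2 \<odot> e 2 + \<alpha>3 \<odot> ?c + \<alpha>4 \<odot> e 4"
      using dual_expand[OF d', of "P (e 1) ?c"] unfolding \<omega>' \<omega>P e' by (simp add: \<alpha>2_def \<alpha>3_def \<alpha>4_def)
    have nz: "P (e 1) (P (e 1) (e 4)) \<noteq> 0"
    proof
      assume "P (e 1) (P (e 1) (e 4)) = 0"
      then have "?c = 0" by (simp add: Pt PR_linear)
      then show False using w'(11) f'(14) by (simp add: e')
    qed
    have "P (e 1) (P (e 1) (P (e 1) (e 4))) = \<alpha>3 \<odot> P (e 1) (P (e 1) (e 4)) + \<alpha>2 \<odot> P (e 1) (e 4) + (- \<alpha>4) \<odot> e 4"
      using P13 by (simp add: Pt PR_linear)
    from P_nilpotent3[OF nz this] have P13: "P (e 1) ?c = 0" using P13 by simp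
    have "P (e 4) ?c = 0" using P4 \<omega>P by simp
    moreover have "P (e 2) ?c = 0" using P12 P23 Pt by (simp add: PR_linear)
    ultimately show ?thesis unfolding listed_def
      using family_II_exists[OF d', of 0 1] P13 P41 P42 e4 \<omega>R by (simp add: e' \<omega>')
  next
    case y3: True
    have "P (e 1) (P (e 1) (e 4)) = y2 \<odot> P (e 1) (e 4) + (- y4) \<odot> e 4"
      by (simp add: Pt PR_linear P12 y3)
    from P_nilpotent2[OF _ this] have "y2 = 0" "y4 = 0" using e2 by (simp_all add: Pt)
    then have P12: "P (e 1) (e 2) = 0" using P12 y3 by simp
    define x2 x3 x4 where "x2 = \<omega> 2 (P (e 1) (e 3))" and "x3 = \<omega> 3 (P (e 1) (e 3))" and "x4 = \<omega> 4 (P (e 1) (e 3))"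
    have P13: "P (e 1) (e 3) = x2 \<odot> e 2 + x3 \<odot> e 3 + x4 \<odot> e 4"
      by (rule dual_eqI[OF d]) (simp_all add: f w \<omega>P x2_def x3_def x4_def)
    have x3: "x3 = 0"
    proof (rule ccontr)
      assume x3: "x3 \<noteq> 0"
      \<comment> \<open>The coefficients \<open>\<alpha>\<close> and \<open>\<beta>\<close> make
        \<open>?v\<close> an eigenvector of \<open>P (e 1)\<close> with eigenvalue
        \<open>x3\<close>.\<close>
      define \<beta> where "\<beta> = x4 / x3"
      define \<alpha> where "\<alpha> = (x2 - \<beta>) / x3"
      let ?v = "e 3 + \<alpha> \<odot> e 2 + \<beta> \<odot> e 4"
      have x24: "x4 = x3 * \<beta>" "x2 = x3 * \<alpha> + \<beta>" using x3 by (simp_all add: \<alpha>_def \<beta>_def)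
      have "P (e 1) ?v = x3 \<odot> ?v"
        by (rule dual_eqI[OF d]) (simp_all add: PR_linear P13 P12 Pt f w x24 algebra_simps)
      moreover have "?v \<noteq> 0"
      proof
        assume "?v = 0"
        from arg_cong[OF this, of "\<omega> 3"] show False by (simp add: f w)
      qed
      ultimately show False using P_eigen x3 by blast
    qed
    \<comment> \<open>Since \<open>P (e 1) (e 4) = - e 2\<close>, the added multiple of
      \<open>e 4\<close> cancels the component along \<open>e 2\<close>.\<close>
    let ?c = "e 3 + x2 \<odot> e 4"
    have P1c: "P (e 1) ?c = x4 \<odot> e 4" by (simp add: P13 x3 Pt PR_linear)
    have P4c: "P (e 4) ?c = 0" by (simp add: P43 PR_linear)
    have P2c: "P (e 2) ?c = 0" by (simp add: P23 Pt PR_linear)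
    have ind: "w = 0 \<and> x = 0 \<and> y = 0 \<and> z = 0" if 0: "w \<odot> e 1 + x \<odot> e 2 + y \<odot> ?c + z \<odot> e 4 = 0" for w x y z
      using arg_cong[OF 0, of "\<omega> 1"] arg_cong[OF 0, of "\<omega> 2"] arg_cong[OF 0, of "\<omega> 3"] arg_cong[OF 0, of "\<omega> 4"]
      by (simp add: f dualD(1-16)[OF d])
    have x4: "x4 = 0"
    proof -
      obtain \<omega>' e' where d': "dual \<omega>' e'" and e': "e' 1 = e 1" "e' 2 = e 2" "e' 3 = ?c" "e' 4 = e 4"
        using dual_exists[of "e 1" "e 2" ?c "e 4"] ind by metis
      note w' = dualD(1-16)[OF d'] and f' = dual_forms[OF d']
      have "\<omega>' 1 ?c = 0" using w'(9) e' by simp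
      then have "\<omega>' 1 (e 3) = 0" using w' by (simp add: f' e')
      then have \<omega>': "\<omega>' 1 v = \<omega> 1 v" for v using same[OF d'] w' by (simp add: e')
      show ?thesis
        by (rule no_central_commutator[OF d'])
          (simp_all only: e' e4 \<omega>' \<omega>R P41[unfolded e4] P42[unfolded e4] P4c[unfolded e4] P12 P1c[unfolded e4] P2c[unfolded e4])
    qed
    have ind': "w = 0 \<and> x = 0 \<and> y = 0 \<and> z = 0" if 0: "w \<odot> e 1 + x \<odot> ?c + y \<odot> e 2 + z \<odot> e 4 = 0" for w x y z
      using arg_cong[OF 0, of "\<omega> 1"] arg_cong[OF 0, of "\<omega> 2"] arg_cong[OF 0, of "\<omega> 3"] arg_cong[OF 0, of "\<omega> 4"]
      by (simp add: f dualD(1-16)[OF d])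
    \<comment> \<open>Family I expects \<open>P (e 4) (e 1)\<close> in the third place, so
      \<open>e 2\<close> moves there and \<open>?c\<close> becomes the second vector.\<close>
    obtain \<omega>' e' where d': "dual \<omega>' e'" and e': "e' 1 = e 1" "e' 2 = ?c" "e' 3 = e 2" "e' 4 = e 4"
      using dual_exists[of "e 1" ?c "e 2" "e 4"] ind' by metis
    note w' = dualD(1-16)[OF d'] and f' = dual_forms[OF d']
    have "\<omega>' 1 ?c = 0" using w'(5) e' by simp
    then have "\<omega>' 1 (e 3) = 0" using w' by (simp add: f' e')
    then have \<omega>': "\<omega>' 1 v = \<omega> 1 v" for v using same[OF d'] w' by (simp add: e')
    have P1c: "P (e 1) ?c = 0" using P1c x4 by simp
    have Pc2: "P ?c (e 2) = 0" using P2c P_anti[of ?c "e 2"] by simp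
    have "\<exists>\<delta> \<epsilon> \<nu> a b. \<delta> \<in> {1, -1} \<and> (\<epsilon>, \<nu>, a, b) \<in> values_I \<and> admits_equations br J (Eqs_I \<delta> \<epsilon> \<nu> a b)"
      by (rule family_I_exists[OF d'])
        (simp_all only: e' e4 \<omega>' \<omega>R P41[unfolded e4] P42[unfolded e4] P4c[unfolded e4] P12 P1c[unfolded e4] Pc2[unfolded e4])
    then show ?thesis unfolding listed_def by blast
  qed
qed

text \<open>Covers the case where the form obtained from \<open>proper_ideal\<close> is
  \<open>\<omega> 3\<close>: the Jacobi identity and nilpotency then show that
  \<open>\<omega> 1\<close> annihilates all values of \<open>P\<close> and \<open>R\<close> as
  well.\<close>

lemma rank1_closed:
  assumes d: "dual \<omega> e" and e4: "e 4 = E"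
    and P41: "P (e 4) (e 1) = e 2" and P42: "P (e 4) (e 2) = 0" and P43: "P (e 4) (e 3) = 0"
    and \<omega>P3: "\<And>X Y. \<omega> 3 (P X Y) = 0" and \<omega>R3: "\<And>X Y. \<omega> 3 (R X Y) = 0"
  shows "\<omega> 1 (P X Y) = 0" "\<omega> 1 (R X Y) = 0"
proof -
  note w = dualD(1-16)[OF d] and f = dual_forms[OF d]
  have Pt: "P (e 2) (e 4) = 0" "P (e 1) (e 4) = - e 2" "P (e 3) (e 4) = 0"
    by (simp_all add: P_anti[of _ "e 4"] P41 P42 P43)
  have P4: "P (e 4) v = \<omega> 1 v \<odot> e 2" for v
    by (subst dual_expand[OF d, of v]) (simp add: P41 P42 P43 PR_linear)
  have R4: "R (e 4) v = \<omega> 1 v \<odot> e 2" and R_4: "R v (e 4) = 0" for v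
    using P4[of v] by (simp_all add: e4 R_E R_right_E)
  have e2: "e 2 \<noteq> 0" using w(6) f(9) by auto
  have e2E: "e 2 \<noteq> z \<odot> E" for z
  proof
    assume "e 2 = z \<odot> E"
    from arg_cong[OF this, of "\<omega> 2"] show False by (simp add: f w flip: e4)
  qed
  have 12: "\<omega> 1 (P (e 1) (e 2)) = 0"
    using jacobi_P[of "e 4" "e 1" "e 2"] e2 by (simp add: P4 w Pt PR_linear)
  have 32: "P (e 3) (e 2) = (- \<omega> 1 (P (e 1) (e 3))) \<odot> e 2"
    using jacobi_P[of "e 4" "e 1" "e 3"] by (simp add: P4 w Pt PR_linear eq_neg_iff_add_eq_0 add.commute)
  have 13: "\<omega> 1 (P (e 1) (e 3)) = 0" using P_eigen[OF 32 e2] by simp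
  have 23: "P (e 2) (e 3) = 0" using 32 13 P_anti[of "e 2" "e 3"] by simp
  have P1: "\<omega> 1 (P X Y) = 0" for X Y
    unfolding P_expand[OF d, of X Y] by (simp add: f w 12 13 23 Pt)
  then show "\<omega> 1 (P X Y) = 0" .
  \<comment> \<open>As \<open>P (e 4) (e 2) = 0\<close>, \<open>R (e 2)\<close> commutes with
    \<open>R (e 4)\<close>, which is the rank one map onto the line of \<open>e 2\<close>; so
    \<open>e 2\<close> is an eigenvector of \<open>R (e 2)\<close>.\<close>
  have R2: "\<omega> 1 (R (e 2) Y) \<odot> e 2 = \<omega> 1 Y \<odot> R (e 2) (e 2)" for Y
    using R_P[of "e 4" "e 2" Y] by (simp add: P42 R4 PR_linear)
  have "R (e 2) (e 2) = \<omega> 1 (R (e 2) (e 1)) \<odot> e 2 + 0 \<odot> E" using R2[of "e 1"] w by simp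
  from R_eigen[OF this e2E] have R21: "\<omega> 1 (R (e 2) (e 1)) = 0" .
  then have R22: "R (e 2) (e 2) = 0" using R2[of "e 1"] w by simp
  have R23: "\<omega> 1 (R (e 2) (e 3)) = 0" using R2[of "e 3"] w e2 by simp
  have R3: "\<omega> 1 (R (e 3) Y) \<odot> e 2 = \<omega> 1 Y \<odot> R (e 3) (e 2)" for Y
    using R_P[of "e 4" "e 3" Y] by (simp add: P43 R4 PR_linear)
  have "R (e 3) (e 2) = \<omega> 1 (R (e 3) (e 1)) \<odot> e 2 + 0 \<odot> E" using R3[of "e 1"] w by simp
  from R_eigen[OF this e2E] have R31: "\<omega> 1 (R (e 3) (e 1)) = 0" .
  then have R32: "R (e 3) (e 2) = 0" using R3[of "e 1"] w by simp
  have R33: "\<omega> 1 (R (e 3) (e 3)) = 0" using R3[of "e 3"] w e2 by simp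
  have "\<omega> 1 (R (e 1) (e 2)) \<odot> e 2 = 0"
    using R_P[of "e 4" "e 1" "e 2"] by (simp add: P41 R4 R22 w PR_linear)
  then have R12': "\<omega> 1 (R (e 1) (e 2)) = 0" using e2 by simp
  define x z where "x = \<omega> 2 (R (e 1) (e 2))" and "z = \<omega> 4 (R (e 1) (e 2))"
  have R12: "R (e 1) (e 2) = x \<odot> e 2 + z \<odot> E"
    unfolding e4[symmetric] by (rule dual_eqI[OF d]) (simp_all add: f w \<omega>R3 R12' x_def z_def)
  have x: "x = 0" by (rule R_eigen[OF R12 e2E])
  define u k2 k4 where "u = \<omega> 1 (R (e 1) (e 1))" and "k2 = \<omega> 2 (R (e 1) (e 1))" and "k4 = \<omega> 4 (R (e 1) (e 1))"
  have R11: "R (e 1) (e 1) = u \<odot> e 1 + k2 \<odot> e 2 + k4 \<odot> E"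
    unfolding e4[symmetric] by (rule dual_eqI[OF d]) (simp_all add: f w \<omega>R3 u_def k2_def k4_def)
  \<comment> \<open>A nonzero \<open>u\<close> would be an eigenvalue modulo \<open>E\<close>; the
    multiple of \<open>e 2\<close> absorbs the coefficient \<open>k2\<close>.\<close>
  have u: "u = 0"
  proof (rule ccontr)
    assume u: "u \<noteq> 0"
    have "R (e 1) (e 1 + (k2 / u) \<odot> e 2) = u \<odot> (e 1 + (k2 / u) \<odot> e 2) + (k4 + k2 / u * z) \<odot> E"
      unfolding e4[symmetric]
      by (rule dual_eqI[OF d]) (use u in \<open>simp_all add: PR_linear R11 R12 x f w flip: e4\<close>)
    moreover have "e 1 + (k2 / u) \<odot> e 2 \<noteq> z \<odot> E" for z
    proof
      assume "e 1 + (k2 / u) \<odot> e 2 = z \<odot> E"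
      from arg_cong[OF this, of "\<omega> 1"] show False by (simp add: f w flip: e4)
    qed
    ultimately show False using R_eigen u by blast
  qed
  define r where "r = \<omega> 1 (R (e 1) (e 3))"
  have R1: "\<omega> 1 (R X Y) = hh \<omega> 1 3 X Y * r" for X Y
    unfolding R_expand[OF d, of X Y]
    by (simp add: f w R_4 R4 R11 u R12' R21 R22 R23 R31 R32 R33 r_def flip: e4)
  \<comment> \<open>Only \<open>r\<close> is left of \<open>\<omega> 1\<close> on the values of
    \<open>R\<close>, and the mixed Jacobi identity for \<open>e 3\<close>, \<open>e 1\<close>,
    \<open>e 3\<close> makes its squared modulus vanish.\<close>
  have "cnj r * r = 0"
    using arg_cong[OF R_of_P[of "e 3" "e 1" "e 3"], of "\<omega> 1"]
    by (simp add: f P1 R1 w)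
  then show "\<omega> 1 (R X Y) = 0" by (simp add: R1)
qed

lemma listed_rank1:
  assumes N2: "\<And>v. P E (P E v) = 0"
  shows listed
proof -
  obtain a where a: "P E a \<noteq> 0" using N_nonzero by blast
  let ?b = "P E a"
  have Na: "P E ?b = 0" by (rule N2)
  have bE: "?b \<noteq> z \<odot> E" for z using P_E_neq[of a z] a by auto
  have aE: "a \<noteq> y \<odot> ?b + z \<odot> E" for y z
  proof
    assume *: "a = y \<odot> ?b + z \<odot> E"
    from arg_cong[OF this, of "P E"] show False using a by (simp add: PR_linear Na)
  qed
  obtain x where x: "\<And>\<alpha> \<beta> \<gamma>. x \<noteq> \<alpha> \<odot> a + \<beta> \<odot> ?b + \<gamma> \<odot> E"
    using exists_outside3[of a ?b E] by blast
  \<comment> \<open>Because \<open>P E\<close> squares to zero and its image misses the line of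
    \<open>E\<close>, the image is just the line of \<open>?b\<close>.\<close>
  have "\<exists>c. P E x = c \<odot> ?b"
  proof -
    obtain \<omega> e where d: "dual \<omega> e" and e: "e 1 = x" "e 2 = a" "e 3 = ?b" "e 4 = E"
      using dual_exists[of x a ?b E] independent4I[OF E_nonzero bE aE x] by metis
    define c3 c1 c2 c4 where "c3 = \<omega> 1 (P E x)" and "c1 = \<omega> 2 (P E x)" and "c2 = \<omega> 3 (P E x)" and "c4 = \<omega> 4 (P E x)"
    have Nx: "P E x = c3 \<odot> x + c1 \<odot> a + c2 \<odot> ?b + c4 \<odot> E"
      using dual_expand[OF d, of "P E x"] by (simp add: e c1_def c2_def c3_def c4_def)
    have 0: "c3 \<odot> P E x + c1 \<odot> ?b = 0"
      using arg_cong[OF Nx, of "P E"] N2[of x] by (simp add: PR_linear Na)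
    show ?thesis
    proof (cases "c3 = 0")
      case True
      then have "c1 = 0" using 0 a by simp
      with True have "P E (x - c2 \<odot> a) = c4 \<odot> E" using Nx by (simp add: PR_linear)
      then have "c4 = 0" by (rule P_E_neq)
      with True \<open>c1 = 0\<close> have "P E x = c2 \<odot> ?b" using Nx by simp
      then show ?thesis ..
    next
      case False
      then have "P E x = (1 / c3) \<odot> (c3 \<odot> P E x)" by simp
      also have "c3 \<odot> P E x = - (c1 \<odot> ?b)" using 0 by (simp add: eq_neg_iff_add_eq_0)
      also have "(1 / c3) \<odot> (- (c1 \<odot> ?b)) = (- (c1 / c3)) \<odot> ?b" by simp
      finally show ?thesis ..
    qed
  qed
  then obtain c where c: "P E x = c \<odot> ?b" ..
  define y where "y = x - c \<odot> a"
  have Ny: "P E y = 0" by (simp add: y_def PR_linear c)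
  have y: "y \<noteq> \<alpha> \<odot> a + \<beta> \<odot> ?b + \<gamma> \<odot> E" for \<alpha> \<beta> \<gamma>
  proof
    assume "y = \<alpha> \<odot> a + \<beta> \<odot> ?b + \<gamma> \<odot> E"
    then have "x = (\<alpha> + c) \<odot> a + \<beta> \<odot> ?b + \<gamma> \<odot> E"
      by (simp add: y_def V.scale_left_distrib algebra_simps)
    then show False using x by blast
  qed
  have ind: "w = 0 \<and> p = 0 \<and> q = 0 \<and> z = 0" if 0: "w \<odot> a + p \<odot> ?b + q \<odot> y + z \<odot> E = 0" for w p q z
  proof -
    have "q \<odot> y + w \<odot> a + p \<odot> ?b + z \<odot> E = 0" using 0 by (simp add: ac_simps)
    from independent4I[OF E_nonzero bE aE y this] show ?thesis by simp
  qed
  obtain \<omega> e where d: "dual \<omega> e" and e: "e 1 = a" "e 2 = ?b" "e 3 = y" "e 4 = E"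
    using dual_exists[of a ?b y E] ind by metis
  note w = dualD(1-16)[OF d] and f = dual_forms[OF d]
  have P41: "P (e 4) (e 1) = e 2" and P42: "P (e 4) (e 2) = 0" and P43: "P (e 4) (e 3) = 0"
    by (simp_all add: e Na Ny)
  obtain U where U: "V.subspace U" "E \<in> U" "U \<noteq> UNIV" "\<And>X Y. P X Y \<in> U" "\<And>X Y. R X Y \<in> U"
    using proper_ideal by blast
  show ?thesis
  proof (cases "\<forall>u\<in>U. \<omega> 1 u = 0")
    case True
    then show ?thesis using U by (intro listed_rank1_closed[OF d e(4) P41 P42 P43]) auto
  next
    case False
    then obtain u where u: "u \<in> U" "\<omega> 1 u \<noteq> 0" by blast
    \<comment> \<open>As \<open>\<omega> 1\<close> does not vanish on \<open>U\<close>,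
      \<open>a\<close> can be replaced by a vector of \<open>U\<close>. Then \<open>U\<close>
      contains the first, second and fourth basis vectors, and the third form annihilates
      it.\<close>
    define a' where "a' = (1 / \<omega> 1 u) \<odot> u"
    have a'U: "a' \<in> U" unfolding a'_def by (intro V.subspace_scale U(1) u(1))
    have a'1: "\<omega> 1 a' = 1" using u by (simp add: a'_def f)
    have Na': "P E a' = ?b"
    proof -
      have "P (e 4) a' = \<omega> 1 a' \<odot> e 2"
        by (subst dual_expand[OF d, of a']) (simp add: P41 P42 P43 PR_linear)
      then show ?thesis by (simp add: a'1 e)
    qed
    have ind: "w = 0 \<and> p = 0 \<and> q = 0 \<and> z = 0" if 0: "w \<odot> a' + p \<odot> e 2 + q \<odot> e 3 + z \<odot> e 4 = 0" for w p q z
    proof -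
      have "w = 0" using arg_cong[OF 0, of "\<omega> 1"] by (simp add: f dualD(1-16)[OF d] a'1)
      then show ?thesis
        using arg_cong[OF 0, of "\<omega> 2"] arg_cong[OF 0, of "\<omega> 3"] arg_cong[OF 0, of "\<omega> 4"]
        by (simp add: f dualD(1-16)[OF d])
    qed
    obtain \<omega>' e' where d': "dual \<omega>' e'" and e': "e' 1 = a'" "e' 2 = e 2" "e' 3 = e 3" "e' 4 = e 4"
      using dual_exists[of a' "e 2" "e 3" "e 4"] ind by metis
    note w' = dualD(1-16)[OF d'] and f' = dual_forms[OF d']
    have mem: "e' 1 \<in> U" "e' 2 \<in> U" "e' 4 \<in> U" by (simp_all add: e' a'U e U)
    have \<omega>U: "\<omega>' 3 v = 0" if v: "v \<in> U" for v
    proof (rule ccontr)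
      assume nz: "\<omega>' 3 v \<noteq> 0"
      have "e' 3 = (1 / \<omega>' 3 v) \<odot> (v - (\<omega>' 1 v \<odot> e' 1 + \<omega>' 2 v \<odot> e' 2 + \<omega>' 4 v \<odot> e' 4))"
        by (rule dual_eqI[OF d']) (use nz in \<open>simp_all add: f' w'\<close>)
      also have "\<dots> \<in> U" by (intro V.subspace_scale V.subspace_diff V.subspace_add U(1) v mem)
      finally have e3: "e' 3 \<in> U" .
      have "X \<in> U" for X
        by (subst dual_expand[OF d', of X]) (intro V.subspace_scale V.subspace_add U(1) e3 mem)
      then show False using U(3) by blast
    qed
    have e4': "e' 4 = E" and P41': "P (e' 4) (e' 1) = e' 2" and P42': "P (e' 4) (e' 2) = 0" and P43': "P (e' 4) (e' 3) = 0"
      by (simp_all add: e' e Na' Na Ny)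
    show ?thesis
      by (rule listed_rank1_closed[OF d' e4' P41' P42' P43'];
          rule rank1_closed[OF d' e4' P41' P42' P43']; rule \<omega>U; rule U)
  qed
qed

lemma listed: listed
  using listed_rank2 listed_rank1 by blast

end

theorem theorem3p3:
  fixes br :: "'g::real_vector \<Rightarrow> 'g \<Rightarrow> 'g" and J :: "'g \<Rightarrow> 'g"
  assumes "lie_bracket br"
    and "dim (UNIV :: 'g set) = 8"
    and "nilpotent_lie br"
    and "dim (lie_center br) = 1"
    and "complex_structure br J"
  shows "(\<exists>!e. e \<in> listed_equations \<and> admits_equations br J e) \<and>
    (family_I br J \<or> family_II br J) \<and>
    (family_I br J \<longrightarrow>
       (\<exists>\<delta> \<epsilon> \<nu> a b. \<delta> \<in> {1, -1} \<and> (\<epsilon>, \<nu>, a, b) \<in> values_I \<and>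
          admits_equations br J (Eqs_I \<delta> \<epsilon> \<nu> a b) \<and>
          type_relation_I (ascending_type br) \<delta> (\<epsilon>, \<nu>, a, b))) \<and>
    (family_II br J \<longrightarrow>
       (\<exists>\<epsilon> \<mu> \<nu> a b. (\<epsilon>, \<mu>, \<nu>, a, b) \<in> values_II \<and>
          admits_equations br J (Eqs_II \<epsilon> \<mu> \<nu> a b) \<and>
          type_relation_II (ascending_type br) (\<epsilon>, \<mu>, \<nu>, a, b))) \<and>
    (\<forall>(br' :: 'h::real_vector \<Rightarrow> 'h \<Rightarrow> 'h) J' e e'.
       lie_bracket br' \<and> complex_structure br' J' \<and>
       e \<in> listed_equations \<and> admits_equations br J e \<and>
       e' \<in> listed_equations \<and> admits_equations br' J' e' \<and> e \<noteq> e' \<longrightarrow>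
       \<not> equivalent_pairs br J br' J')"
proof -
  interpret complex_nil br J
    by unfold_locales (fact assms)+
  have admitsD_I: "\<exists>\<omega>. basis10 J \<omega> \<and> has_I \<omega> (of_real \<epsilon>) \<nu> (of_real a) b \<delta>"
    if "admits_equations br J (Eqs_I \<delta> \<epsilon> \<nu> a b)" "\<delta> \<in> {1, -1}" for \<delta> \<epsilon> \<nu> a b
    using that has_equations_I unfolding admits_equations_def by blast
  have admitsD_II: "\<exists>\<omega>. basis10 J \<omega> \<and> has_II \<omega> (of_real \<epsilon>) \<mu> \<nu> (of_real a) b"
    if "admits_equations br J (Eqs_II \<epsilon> \<mu> \<nu> a b)" for \<epsilon> \<mu> \<nu> a b
    using that has_equations_II unfolding admits_equations_def by blast
  have nz: "complex_of_real \<epsilon> \<noteq> 0 \<or> \<mu> \<noteq> 0" if "(\<epsilon>, \<mu>, \<nu>, a, b) \<in> values_II" for \<epsilon> \<mu> \<nu> a b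
    using that by (auto simp: values_II_def)
  have listed_cases: "(\<exists>\<delta> \<epsilon> \<nu> a b \<omega>. e = Eqs_I \<delta> \<epsilon> \<nu> a b \<and> \<delta> \<in> {1, -1} \<and> (\<epsilon>, \<nu>, a, b) \<in> values_I \<and>
        basis10 J \<omega> \<and> has_I \<omega> (of_real \<epsilon>) \<nu> (of_real a) b \<delta>) \<or>
      (\<exists>\<epsilon> \<mu> \<nu> a b \<omega>. e = Eqs_II \<epsilon> \<mu> \<nu> a b \<and> (\<epsilon>, \<mu>, \<nu>, a, b) \<in> values_II \<and>
        basis10 J \<omega> \<and> has_II \<omega> (of_real \<epsilon>) \<mu> \<nu> (of_real a) b)"
    if "e \<in> listed_equations" "admits_equations br J e" for e
    using that(1) unfolding listed_equations_def
  proof (elim UnE CollectE exE conjE)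
    fix \<delta> \<epsilon> \<nu> a b assume e: "e = Eqs_I \<delta> \<epsilon> \<nu> a b" and v: "\<delta> \<in> {1, -1}" "(\<epsilon>, \<nu>, a, b) \<in> values_I"
    from admitsD_I[OF that(2)[unfolded e] v(1)] e v show ?thesis by metis
  next
    fix \<epsilon> \<mu> \<nu> a b assume e: "e = Eqs_II \<epsilon> \<mu> \<nu> a b" and v: "(\<epsilon>, \<mu>, \<nu>, a, b) \<in> values_II"
    from admitsD_II[OF that(2)[unfolded e]] e v show ?thesis by metis
  qed
  have unique: "e = e'" if "e \<in> listed_equations" "admits_equations br J e"
    "e' \<in> listed_equations" "admits_equations br J e'" for e e'
    using listed_cases[OF that(1,2)] listed_cases[OF that(3,4)]
  proof (elim disjE exE conjE)
    fix \<delta> \<epsilon> \<nu> a b \<omega> \<delta>' \<epsilon>' \<nu>' a' b' \<omega>'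
    assume "e = Eqs_I \<delta> \<epsilon> \<nu> a b" "e' = Eqs_I \<delta>' \<epsilon>' \<nu>' a' b'"
      and h: "\<delta> \<in> {1, -1}" "(\<epsilon>, \<nu>, a, b) \<in> values_I" "basis10 J \<omega>" "has_I \<omega> (of_real \<epsilon>) \<nu> (of_real a) b \<delta>"
        "\<delta>' \<in> {1, -1}" "(\<epsilon>', \<nu>', a', b') \<in> values_I" "basis10 J \<omega>'" "has_I \<omega>' (of_real \<epsilon>') \<nu>' (of_real a') b' \<delta>'"
    then show ?thesis using unique_I[OF h(3,7,1,5,4,8,2,6)] by simp
  next
    fix \<delta> \<epsilon> \<nu> a b \<omega> \<epsilon>' \<mu>' \<nu>' a' b' \<omega>'
    assume h: "basis10 J \<omega>" "has_I \<omega> (of_real \<epsilon>) \<nu> (of_real a) b \<delta>"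
        "(\<epsilon>', \<mu>', \<nu>', a', b') \<in> values_II" "basis10 J \<omega>'" "has_II \<omega>' (of_real \<epsilon>') \<mu>' \<nu>' (of_real a') b'"
    show ?thesis using I_not_II[OF h(1,4,2,5) nz[OF h(3)]] by blast
  next
    fix \<epsilon>' \<mu>' \<nu>' a' b' \<omega>' \<delta> \<epsilon> \<nu> a b \<omega>
    assume h: "basis10 J \<omega>" "has_I \<omega> (of_real \<epsilon>) \<nu> (of_real a) b \<delta>"
        "(\<epsilon>', \<mu>', \<nu>', a', b') \<in> values_II" "basis10 J \<omega>'" "has_II \<omega>' (of_real \<epsilon>') \<mu>' \<nu>' (of_real a') b'"
    show ?thesis using I_not_II[OF h(1,4,2,5) nz[OF h(3)]] by blast
  next
    fix \<epsilon> \<mu> \<nu> a b \<omega> \<epsilon>' \<mu>' \<nu>' a' b' \<omega>'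
    assume "e = Eqs_II \<epsilon> \<mu> \<nu> a b" "e' = Eqs_II \<epsilon>' \<mu>' \<nu>' a' b'"
      and h: "(\<epsilon>, \<mu>, \<nu>, a, b) \<in> values_II" "basis10 J \<omega>" "has_II \<omega> (of_real \<epsilon>) \<mu> \<nu> (of_real a) b"
        "(\<epsilon>', \<mu>', \<nu>', a', b') \<in> values_II" "basis10 J \<omega>'" "has_II \<omega>' (of_real \<epsilon>') \<mu>' \<nu>' (of_real a') b'"
    then show ?thesis using unique_II[OF h(2,5,3,6,1,4)] by simp
  qed
  have ex: "(\<exists>\<delta> \<epsilon> \<nu> a b. \<delta> \<in> {1, -1} \<and> (\<epsilon>, \<nu>, a, b) \<in> values_I \<and> admits_equations br J (Eqs_I \<delta> \<epsilon> \<nu> a b)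
        \<and> type_relation_I (ascending_type br) \<delta> (\<epsilon>, \<nu>, a, b)) \<and> family_I br J \<or>
     (\<exists>\<epsilon> \<mu> \<nu> a b. (\<epsilon>, \<mu>, \<nu>, a, b) \<in> values_II \<and> admits_equations br J (Eqs_II \<epsilon> \<mu> \<nu> a b)
        \<and> type_relation_II (ascending_type br) (\<epsilon>, \<mu>, \<nu>, a, b)) \<and> family_II br J"
    using listed unfolding listed_def
  proof (elim disjE exE conjE)
    fix \<delta> \<epsilon> \<nu> a b
    assume v: "\<delta> \<in> {1, -1}" "(\<epsilon>, \<nu>, a, b) \<in> values_I" and ad: "admits_equations br J (Eqs_I \<delta> \<epsilon> \<nu> a b)"
    then obtain \<omega> where b: "basis10 J \<omega>" and h: "has_I \<omega> (of_real \<epsilon>) \<nu> (of_real a) b \<delta>"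
      using admitsD_I by blast
    have "family_I br J" using dolbeault_I[OF b h] by (simp add: family_I_def)
    with type_I[OF b h v] v ad show ?thesis by blast
  next
    fix \<epsilon> \<mu> \<nu> a b
    assume v: "(\<epsilon>, \<mu>, \<nu>, a, b) \<in> values_II" and ad: "admits_equations br J (Eqs_II \<epsilon> \<mu> \<nu> a b)"
    then obtain \<omega> where b: "basis10 J \<omega>" and h: "has_II \<omega> (of_real \<epsilon>) \<mu> \<nu> (of_real a) b"
      using admitsD_II by blast
    have "family_II br J" using dolbeault_II[OF b h nz[OF v]] by (simp add: family_II_def)
    with type_II[OF b h v] v ad show ?thesis by blast
  qed
  have excl: "\<not> (family_I br J \<and> family_II br J)" by (simp add: family_I_def family_II_def)
  have "\<exists>e. e \<in> listed_equations \<and> admits_equations br J e"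
    using ex
  proof (elim disjE exE conjE)
    fix \<delta> \<epsilon> \<nu> a b
    assume "\<delta> \<in> {1, -1}" "(\<epsilon>, \<nu>, a, b) \<in> values_I" and ad: "admits_equations br J (Eqs_I \<delta> \<epsilon> \<nu> a b)"
    then have "Eqs_I \<delta> \<epsilon> \<nu> a b \<in> listed_equations" unfolding listed_equations_def by blast
    with ad show ?thesis by blast
  next
    fix \<epsilon> \<mu> \<nu> a b
    assume "(\<epsilon>, \<mu>, \<nu>, a, b) \<in> values_II" and ad: "admits_equations br J (Eqs_II \<epsilon> \<mu> \<nu> a b)"
    then have "Eqs_II \<epsilon> \<mu> \<nu> a b \<in> listed_equations" unfolding listed_equations_def by blast
    with ad show ?thesis by blast
  qed
  with unique have ex1: "\<exists>!e. e \<in> listed_equations \<and> admits_equations br J e" by (intro ex_ex1I) blast+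
  have fam: "family_I br J \<or> family_II br J"
    using ex by (elim disjE conjE) simp_all
  \<comment> \<open>An equivalence would pull the second set of equations back to \<open>br\<close>
    and \<open>J\<close>, where uniqueness applies.\<close>
  have inequiv: "\<not> equivalent_pairs br J br' J'"
    if "e \<in> listed_equations" "admits_equations br J e" "e' \<in> listed_equations" "admits_equations br' J' e'" "e \<noteq> e'"
    for br' :: "'h \<Rightarrow> 'h \<Rightarrow> 'h" and J' e e'
  proof
    assume "equivalent_pairs br J br' J'"
    then obtain f where "linear f" "bij f" "\<And>X Y. f (br X Y) = br' (f X) (f Y)" "J = inv f \<circ> J' \<circ> f"
      unfolding equivalent_pairs_def by blast
    from admits_equations_pullback[OF this that(4)] have "admits_equations br J e'" .
    from unique[OF that(1,2,3) this] that(5) show False by simp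
  qed
  show ?thesis
  proof (intro conjI impI allI)
    show "\<exists>!e. e \<in> listed_equations \<and> admits_equations br J e" by (rule ex1)
    show "family_I br J \<or> family_II br J" by (rule fam)
  next
    assume "family_I br J"
    then have n: "\<not> family_II br J" using excl by blast
    from ex show "\<exists>\<delta> \<epsilon> \<nu> a b. \<delta> \<in> {1, -1} \<and> (\<epsilon>, \<nu>, a, b) \<in> values_I \<and> admits_equations br J (Eqs_I \<delta> \<epsilon> \<nu> a b)
        \<and> type_relation_I (ascending_type br) \<delta> (\<epsilon>, \<nu>, a, b)"
      by (rule disjE) (erule conjunct1, erule conjE, erule notE[OF n])
  next
    assume "family_II br J"
    then have n: "\<not> family_I br J" using excl by blast
    from ex show "\<exists>\<epsilon> \<mu> \<nu> a b. (\<epsilon>, \<mu>, \<nu>, a, b) \<in> values_II \<and> admits_equations br J (Eqs_II \<epsilon> \<mu> \<nu> a b)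
        \<and> type_relation_II (ascending_type br) (\<epsilon>, \<mu>, \<nu>, a, b)"
      by (rule disjE) (erule conjE, erule notE[OF n], erule conjunct1)
  next
    fix br' :: "'h \<Rightarrow> 'h \<Rightarrow> 'h" and J' e e'
    assume h: "lie_bracket br' \<and> complex_structure br' J' \<and> e \<in> listed_equations \<and> admits_equations br J e \<and>
       e' \<in> listed_equations \<and> admits_equations br' J' e' \<and> e \<noteq> e'"
    show "\<not> equivalent_pairs br J br' J'"
      by (rule inequiv[of e e' br' J']) (simp_all add: h)
  qed
qed

end
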